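(* Let $C$ be an algebraically closed field of characteristic zero and let $X$ be an irreducible affine algebraic variety over $C$. Let $\mathcal{L}=a_n(x)\delta^n+a_{n-1}(x)\delta^{n-1}+\dots+a_0(x)\in C(X)(x)[\delta]$ with $a_i(x)\in C(X)(x)$ and $a_n(x)\neq 0$. Assume that $\mathcal{L}$ is irreducible over $\overline{C(X)}(x)$, i.e. irreducible as an element of $\overline{C(X)}(x)[\delta]$. Then there exists an ad-open subset $U$ of $X(C)$ such that for any $c\in U$, the specialized operator $\mathcal{L}^c$ is well-defined and $\mathcal{L}^c$ is irreducible over $C(x)$, i.e. irreducible as an element of $C(x)[\delta]$.
   Context: $C[X]$ is the ring of regular functions on $X$, $C(X)$ the field of rational functions on $X$, and $\overline{C(X)}$ an algebraic closure of $C(X)$. For a field $F$ of characteristic zero, $F(x)$ is the differential field of rational functions with derivation $\delta=\frac{d}{dx}$ (elements of $F$ are constants), and $F(x)[\delta]$ is the ring of linear differential operators over $F(x)$, with $\delta f=f\delta+f'$ for $f\in F(x)$ (in particular $\delta x=x\delta+1$). The order $\mathrm{ord}$ of a nonzero operator is its degree in $\delta$. An operator of positive order in $F(x)[\delta]$ is irreducible if it is not a product of two operators of positive order in $F(x)[\delta]$. $X(C)$ is the set of $C$-points of $X$, identified with $\mathrm{Hom}_C(C[X],C)$ (the $C$-algebra homomorphisms). For $c\in X(C)$ and $f\in C[X]$, $f^c\in C$ is the image of $f$ under $c$; for $f\in C[X][x]$, $f^c\in C[x]$ is obtained by applying $c$ to the coefficients of $f$. The coefficients $a_i$ of $\mathcal{L}$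 are written as quotients of elements of $C[X][x]$, and $\mathcal{L}^c\in C(x)[\delta]$ is obtained by applying $c$ to the coefficients of $\mathcal{L}$ (to numerators and denominators). $\mathcal{L}^c$ is well-defined if the denominators of all coefficients of $\mathcal{L}$ do not vanish under the application of $c$ and $a_n^c\neq 0$. For a finitely generated subgroup $\Gamma$ of the additive group $(C[X],+)$, the set $\mathcal{B}(\Gamma,X)=\{c\in X(C)\mid c \text{ is injective on }\Gamma\}$ is called a basic ad-open subset of $X(C)$. An ad-open subset of $X(C)$ is an intersection of finitely many basic ad-open subsets of $X(C)$. *)

theory Defs
  imports
    "HOL-Computational_Algebra.Computational_Algebra"
    "HOL-Algebra.Algebraic_Closure_Type"
begin

section \<open>The differential field $F(x)$\<close>

text \<open>$F(x)$ is \<^typ>\<open>'f poly fract\<close>.\<close>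

text \<open>Some numerator and (nonzero) denominator of a fraction; what is defined below by
  means of it does not depend on the choice, by \<open>rat_deriv_Fract\<close> and \<open>rat_to_ac_Fract\<close>.\<close>

definition some_quot :: "'a::idom fract \<Rightarrow> 'a \<times> 'a" where
  "some_quot r = (SOME pq. snd pq \<noteq> 0 \<and> r = Fract (fst pq) (snd pq))"

lemma some_quot:
  "snd (some_quot r) \<noteq> 0" "r = Fract (fst (some_quot r)) (snd (some_quot r))"
proof -
  have "\<exists>pq. snd pq \<noteq> 0 \<and> r = Fract (fst pq) (snd pq)"
    by (cases r) auto
  from someI_ex[OF this]
  show "snd (some_quot r) \<noteq> 0" "r = Fract (fst (some_quot r)) (snd (some_quot r))"
    by (simp_all add: some_quot_def)
qed

definition rat_deriv :: "'f::field poly fract \<Rightarrow> 'f poly fract" where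
  "rat_deriv r = (case some_quot r of (p, q) \<Rightarrow> Fract (pderiv p * q - p * pderiv q) (q * q))"

lemma rat_deriv_Fract:
  fixes p q :: "'f::field poly"
  assumes "q \<noteq> 0"
  shows "rat_deriv (Fract p q) = Fract (pderiv p * q - p * pderiv q) (q * q)"
proof -
  obtain a b where ab: "some_quot (Fract p q) = (a, b)"
    by (cases "some_quot (Fract p q)")
  have nz: "b \<noteq> 0" and "Fract p q = Fract a b"
    using some_quot[of "Fract p q"] by (simp_all add: ab)
  then have eq: "a * q = p * b"
    using assms by (simp add: eq_fract)
  have deq: "pderiv a * q = pderiv p * b + p * pderiv b - a * pderiv q"
    using arg_cong[OF eq, of pderiv] by (simp add: pderiv_mult algebra_simps)
  have "(pderiv a * b - a * pderiv b) * (q * q) =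
      (pderiv a * q) * (b * q) - (a * q) * (pderiv b * q)"
    by (simp add: algebra_simps)
  also have "\<dots> = pderiv p * b * b * q - (a * q) * (pderiv q * b)"
    unfolding deq by (simp add: eq algebra_simps)
  also have "\<dots> = (pderiv p * q - p * pderiv q) * (b * b)"
    by (simp add: eq algebra_simps)
  finally show ?thesis
    using nz assms by (simp add: rat_deriv_def ab eq_fract)
qed

lemma rat_deriv_0 [simp]: "rat_deriv 0 = 0"
  by (simp add: fract_expand(1) rat_deriv_Fract eq_fract)

lemma rat_deriv_1 [simp]: "rat_deriv 1 = 0"
  by (simp add: fract_expand rat_deriv_Fract eq_fract)

lemma rat_deriv_add: "rat_deriv (r + s) = rat_deriv r + rat_deriv s"
  by (cases r, cases s)
    (simp add: rat_deriv_Fract eq_fract pderiv_add pderiv_mult algebra_simps)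

lemma rat_deriv_mult: "rat_deriv (r * s) = rat_deriv r * s + r * rat_deriv s"
  by (cases r, cases s)
    (simp add: rat_deriv_Fract eq_fract pderiv_mult algebra_simps)

section \<open>The ring $F(x)[\delta]$\<close>

text \<open>An operator is stored by its coefficients, written to the left of the powers
  of $\delta$. Left multiplication by $\delta$ sends $\sum_j b_j\delta^j$ to
  $\sum_j (b_j\delta^{j+1} + b_j'\delta^j)$.\<close>

typedef (overloaded) 'f diffop = "UNIV :: 'f::field poly fract poly set"
  morphisms op_poly Diffop ..

setup_lifting type_definition_diffop

definition delta_left :: "'f::field poly fract poly \<Rightarrow> 'f poly fract poly" where
  "delta_left Q = pCons 0 Q + map_poly rat_deriv Q"

definition skew_mult ::
  "'f::field poly fract poly \<Rightarrow> 'f poly fract poly \<Rightarrow> 'f poly fract poly" where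
  "skew_mult P Q = (\<Sum>i\<le>degree P. smult (coeff P i) ((delta_left ^^ i) Q))"

lemma delta_left_add: "delta_left (P + Q) = delta_left P + delta_left Q"
  by (rule poly_eqI)
    (simp add: delta_left_def coeff_map_poly coeff_pCons rat_deriv_add split: nat.splits)

lemma delta_left_0 [simp]: "delta_left 0 = 0"
  by (simp add: delta_left_def)

lemma delta_left_smult:
  "delta_left (smult r P) = smult (rat_deriv r) P + smult r (delta_left P)"
  by (rule poly_eqI)
    (simp add: delta_left_def coeff_map_poly coeff_pCons rat_deriv_mult algebra_simps
      split: nat.splits)

lemma delta_left_monom:
  "delta_left (monom r k) = monom (rat_deriv r) k + monom r (Suc k)"
  by (rule poly_eqI) (auto simp: delta_left_def coeff_map_poly coeff_pCons split: nat.splits)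

lemma delta_left_pow_add:
  "(delta_left ^^ i) (P + Q) = (delta_left ^^ i) P + (delta_left ^^ i) Q"
  by (induction i) (simp_all add: delta_left_add)

lemma delta_left_pow_0 [simp]: "(delta_left ^^ i) 0 = 0"
  by (induction i) simp_all

lemma delta_left_pow_one: "(delta_left ^^ i) 1 = monom 1 i"
  by (induction i) (simp_all add: delta_left_monom)

lemma skew_mult_bound:
  assumes "degree P \<le> N"
  shows "skew_mult P Q = (\<Sum>i\<le>N. smult (coeff P i) ((delta_left ^^ i) Q))"
  unfolding skew_mult_def
  by (rule sum.mono_neutral_left) (use assms in \<open>auto simp: coeff_eq_0\<close>)

lemma skew_mult_add_left: "skew_mult (P + P') Q = skew_mult P Q + skew_mult P' Q"
proof -
  let ?N = "max (degree P) (degree P')"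
  show ?thesis
    by (simp add: skew_mult_bound[of _ ?N] degree_add_le smult_add_left sum.distrib)
qed

lemma skew_mult_0_left [simp]: "skew_mult 0 Q = 0"
  by (simp add: skew_mult_def)

lemma skew_mult_add_right: "skew_mult P (Q + Q') = skew_mult P Q + skew_mult P Q'"
  by (simp add: skew_mult_def delta_left_pow_add smult_add_right sum.distrib)

lemma skew_mult_smult_left: "skew_mult (smult r P) Q = smult r (skew_mult P Q)"
proof -
  have "skew_mult (smult r P) Q =
      (\<Sum>i\<le>degree P. smult (coeff (smult r P) i) ((delta_left ^^ i) Q))"
    by (rule skew_mult_bound) (rule degree_smult_le)
  also have "\<dots> = (\<Sum>i\<le>degree P. smult r (smult (coeff P i) ((delta_left ^^ i) Q)))"
    by simp
  also have "\<dots> = smult r (skew_mult P Q)"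
    unfolding skew_mult_def by (induction rule: finite_induct[OF finite_atMost]) (simp_all add: smult_add_right)
  finally show ?thesis .
qed

lemma skew_mult_sum_left:
  "skew_mult (\<Sum>i\<in>A. f i) Q = (\<Sum>i\<in>A. skew_mult (f i) Q)"
  by (induction A rule: infinite_finite_induct) (simp_all add: skew_mult_add_left)

lemma skew_mult_monom: "skew_mult (monom r k) Q = smult r ((delta_left ^^ k) Q)"
proof -
  have "skew_mult (monom r k) Q =
      (\<Sum>i\<le>k. smult (coeff (monom r k) i) ((delta_left ^^ i) Q))"
    by (rule skew_mult_bound) (rule degree_monom_le)
  also have "\<dots> = (\<Sum>i\<le>k. if i = k then smult r ((delta_left ^^ i) Q) else 0)"
    by (rule sum.cong) auto
  finally show ?thesis
    by simp
qed

lemma skew_mult_delta_left: "skew_mult (delta_left P) Q = delta_left (skew_mult P Q)"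
proof -
  have *: "skew_mult (delta_left (monom r k)) Q = delta_left (skew_mult (monom r k) Q)" for r k
    by (simp add: delta_left_monom skew_mult_add_left skew_mult_monom delta_left_smult)
  have sum: "delta_left (\<Sum>i\<in>A. f i) = (\<Sum>i\<in>A. delta_left (f i))" for A and f :: "nat \<Rightarrow> _"
    by (induction A rule: infinite_finite_induct) (simp_all add: delta_left_add)
  have "skew_mult (delta_left (\<Sum>i\<le>degree P. monom (coeff P i) i)) Q =
      delta_left (skew_mult (\<Sum>i\<le>degree P. monom (coeff P i) i) Q)"
    by (simp add: sum skew_mult_sum_left *)
  then show ?thesis
    by (simp only: poly_as_sum_of_monoms)
qed

lemma skew_mult_delta_left_pow:
  "skew_mult ((delta_left ^^ i) P) Q = (delta_left ^^ i) (skew_mult P Q)"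
  by (induction i) (simp_all add: skew_mult_delta_left)

lemma skew_mult_assoc: "skew_mult (skew_mult P Q) R = skew_mult P (skew_mult Q R)"
  unfolding skew_mult_def[of P]
  by (simp add: skew_mult_sum_left skew_mult_smult_left skew_mult_delta_left_pow)

lemma skew_mult_1_left: "skew_mult 1 Q = Q"
  by (simp add: skew_mult_def)

lemma skew_mult_1_right: "skew_mult P 1 = P"
  by (simp add: skew_mult_def delta_left_pow_one smult_monom poly_as_sum_of_monoms)

instantiation diffop :: (field) ring_1
begin

lift_definition zero_diffop :: "'a diffop" is 0 .
lift_definition one_diffop :: "'a diffop" is 1 .
lift_definition plus_diffop :: "'a diffop \<Rightarrow> 'a diffop \<Rightarrow> 'a diffop" is "(+)" .
lift_definition uminus_diffop :: "'a diffop \<Rightarrow> 'a diffop" is uminus .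
lift_definition minus_diffop :: "'a diffop \<Rightarrow> 'a diffop \<Rightarrow> 'a diffop" is "(-)" .
lift_definition times_diffop :: "'a diffop \<Rightarrow> 'a diffop \<Rightarrow> 'a diffop" is skew_mult .

instance
  by standard
    (transfer; simp add: skew_mult_assoc skew_mult_1_left skew_mult_1_right
      skew_mult_add_left skew_mult_add_right)+

end

lift_definition delta :: "'f::field diffop" is "monom 1 1" .

definition rat_op :: "'f::field poly fract \<Rightarrow> 'f diffop" where
  "rat_op r = Diffop [:r:]"

lemma op_poly_rat_op: "op_poly (rat_op r) = [:r:]"
  by (simp add: rat_op_def Diffop_inverse)

text \<open>The order of an operator; the zero operator gets order \<open>0\<close>.\<close>

definition ord_op :: "'f::field diffop \<Rightarrow> nat" where
  "ord_op L = degree (op_poly L)"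

lemma delta_commute: "delta * rat_op r = rat_op r * delta + rat_op (rat_deriv r)"
proof -
  have "skew_mult (monom 1 1) [:r:] = delta_left [:r:]"
    by (simp add: skew_mult_monom)
  also have "\<dots> = monom r 1 + [:rat_deriv r:]"
    by (simp flip: monom_0 add: delta_left_monom)
  also have "monom r 1 = skew_mult [:r:] (monom 1 1)"
    by (simp flip: monom_0 add: skew_mult_monom smult_monom)
  finally show ?thesis
    by (simp flip: op_poly_inject
      add: times_diffop.rep_eq plus_diffop.rep_eq delta.rep_eq op_poly_rat_op)
qed

lemma op_poly_sum: "op_poly (\<Sum>i\<in>A. f i) = (\<Sum>i\<in>A. op_poly (f i))"
  by (induction A rule: infinite_finite_induct)
    (simp_all add: zero_diffop.rep_eq plus_diffop.rep_eq)

lemma op_poly_delta_power: "op_poly (delta ^ i) = monom 1 i"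
proof (induction i)
  case 0
  show ?case by (simp add: one_diffop.rep_eq)
next
  case (Suc i)
  then show ?case
    by (simp add: times_diffop.rep_eq delta.rep_eq skew_mult_monom delta_left_monom)
qed

lemma op_poly_normal_form:
  "op_poly (\<Sum>i\<le>n. rat_op (a i) * delta ^ i) = (\<Sum>i\<le>n. monom (a i) i)"
proof -
  have "op_poly (rat_op (a i) * delta ^ i) = monom (a i) i" for i
    by (simp add: times_diffop.rep_eq op_poly_rat_op op_poly_delta_power
        skew_mult_monom smult_monom flip: monom_0)
  then show ?thesis
    by (simp add: op_poly_sum)
qed

definition irreducible_op :: "'f::field diffop \<Rightarrow> bool" where
  "irreducible_op L \<longleftrightarrow>
    ord_op L > 0 \<and> \<not> (\<exists>A B. L = A * B \<and> ord_op A > 0 \<and> ord_op B > 0)"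

section \<open>Passage to $\overline{K}(x)[\delta]$\<close>

definition rat_to_ac :: "'k::field poly fract \<Rightarrow> 'k alg_closure poly fract" where
  "rat_to_ac r = (case some_quot r of (p, q) \<Rightarrow> Fract (map_poly to_ac p) (map_poly to_ac q))"

lemma map_poly_to_ac_mult:
  "map_poly to_ac (p * q) = map_poly to_ac p * map_poly to_ac q"
  by (rule poly_eqI) (simp add: coeff_map_poly coeff_mult to_ac_sum)

lemma map_poly_to_ac_eq_0_iff: "map_poly to_ac p = 0 \<longleftrightarrow> p = 0"
  by (simp add: poly_eq_iff coeff_map_poly)

lemma rat_to_ac_Fract:
  fixes p q :: "'k::field poly"
  assumes "q \<noteq> 0"
  shows "rat_to_ac (Fract p q) = Fract (map_poly to_ac p) (map_poly to_ac q)"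
proof -
  obtain a b where ab: "some_quot (Fract p q) = (a, b)"
    by (cases "some_quot (Fract p q)")
  have nz: "b \<noteq> 0" and "Fract p q = Fract a b"
    using some_quot[of "Fract p q"] by (simp_all add: ab)
  then have "a * q = p * b"
    using assms by (simp add: eq_fract)
  then have "map_poly to_ac a * map_poly to_ac q = map_poly to_ac p * map_poly to_ac b"
    by (metis map_poly_to_ac_mult)
  then show ?thesis
    using nz assms by (simp add: rat_to_ac_def ab eq_fract map_poly_to_ac_eq_0_iff)
qed

definition op_to_ac :: "'k::field diffop \<Rightarrow> 'k alg_closure diffop" where
  "op_to_ac L = Diffop (map_poly rat_to_ac (op_poly L))"

section \<open>Irreducible affine varieties, points and ad-open sets\<close>

definition unital_ring_hom :: "('a::ring_1 \<Rightarrow> 'b::ring_1) \<Rightarrow> bool" where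
  "unital_ring_hom h \<longleftrightarrow>
    h 1 = 1 \<and> (\<forall>a b. h (a + b) = h a + h b) \<and> (\<forall>a b. h (a * b) = h a * h b)"

definition is_subalgebra :: "('c::field \<Rightarrow> 'r::comm_ring_1) \<Rightarrow> 'r set \<Rightarrow> bool" where
  "is_subalgebra \<iota> A \<longleftrightarrow>
    range \<iota> \<subseteq> A \<and> (\<forall>a\<in>A. \<forall>b\<in>A. a + b \<in> A \<and> a * b \<in> A)"

text \<open>An irreducible affine variety $X$ over $C$ is given by its coordinate ring $C[X]$:
  a type \<^typ>\<open>'r\<close> that is an integral domain, with a structure map \<open>\<iota>\<close> from $C$ that makes
  it a finitely generated $C$-algebra. Then $C(X)$ is \<^typ>\<open>'r fract\<close>.\<close>

definition irreducible_affine_variety :: "('c::field \<Rightarrow> 'r::idom) \<Rightarrow> bool" where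
  "irreducible_affine_variety \<iota> \<longleftrightarrow>
    unital_ring_hom \<iota> \<and> (\<exists>S. finite S \<and> is_subalgebra \<iota> hull S = UNIV)"

definition points :: "('c::field \<Rightarrow> 'r::idom) \<Rightarrow> ('r \<Rightarrow> 'c) set" where
  "points \<iota> = {c. unital_ring_hom c \<and> (\<forall>a. c (\<iota> a) = a)}"

definition basic_ad_open :: "('c::field \<Rightarrow> 'r::idom) \<Rightarrow> ('r \<Rightarrow> 'c) set \<Rightarrow> bool" where
  "basic_ad_open \<iota> B \<longleftrightarrow>
    (\<exists>S. finite S \<and> B = {c \<in> points \<iota>. inj_on c (group_closure S)})"

text \<open>The empty intersection is all of $X(C)$, which is itself basic (take $\Gamma = 0$).\<close>

definition ad_open :: "('c::field \<Rightarrow> 'r::idom) \<Rightarrow> ('r \<Rightarrow> 'c) set \<Rightarrow> bool" where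
  "ad_open \<iota> U \<longleftrightarrow>
    (\<exists>\<B>. finite \<B> \<and> (\<forall>B\<in>\<B>. basic_ad_open \<iota> B) \<and> U = points \<iota> \<inter> \<Inter>\<B>)"

section \<open>Specialization\<close>

text \<open>The operator is given by numerators \<open>num i\<close> and denominators \<open>den i\<close> in $C[X][x]$ of
  its coefficients $a_i$, $i \leq n$; specialization and its well-definedness refer to this
  presentation. As \<^term>\<open>Fract p 0 = 0\<close>, the value of \<open>specialized_op\<close> is meaningful only
  if \<open>specialization_defined\<close> holds.\<close>

definition specialized_coeff ::
  "('r::idom \<Rightarrow> 'c::field) \<Rightarrow> (nat \<Rightarrow> 'r poly) \<Rightarrow> (nat \<Rightarrow> 'r poly) \<Rightarrow> nat \<Rightarrow> 'c poly fract" where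
  "specialized_coeff c num den i = Fract (map_poly c (num i)) (map_poly c (den i))"

definition specialization_defined ::
  "('r::idom \<Rightarrow> 'c::field) \<Rightarrow> nat \<Rightarrow> (nat \<Rightarrow> 'r poly) \<Rightarrow> (nat \<Rightarrow> 'r poly) \<Rightarrow> bool" where
  "specialization_defined c n num den \<longleftrightarrow>
    (\<forall>i\<le>n. map_poly c (den i) \<noteq> 0) \<and> specialized_coeff c num den n \<noteq> 0"

definition specialized_op ::
  "('r::idom \<Rightarrow> 'c::field) \<Rightarrow> nat \<Rightarrow> (nat \<Rightarrow> 'r poly) \<Rightarrow> (nat \<Rightarrow> 'r poly) \<Rightarrow> 'c diffop" where
  "specialized_op c n num den = (\<Sum>i\<le>n. rat_op (specialized_coeff c num den i) * delta ^ i)"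

end

theory Submission
  imports Defs "Jordan_Normal_Form.Determinant"
begin

text \<open>Suppose that the bad points meet every ad-open set. An ultrafilter on $X(C)$ containing the
  ad-open sets and the set of bad points gives an ultrapower $F$ of $C$ and an embedding of $C[X]$
  into $F$, and the ad-open sets guarantee that a nonstandard natural number in $F$ that is
  algebraic over $C(X)$ is standard. A factorization of $\mathcal{L}^c$ defines an invariant subspace of
  the companion module; its Pluecker vector, scaled to a polynomial vector $S$ without common zero,
  solves $DS' + GS = vS$, where $D$ and $G$ come from $\mathcal{L}$ and the polynomial $v$ has bounded
  degree. Let $N$ be the degree of $S$. If $N$ is bounded, the solution exists over $F[x]$, a place
  from $F$ to $\overline{C(X)}$ reduces it to a solution over $\overline{C(X)}[x]$, and
  $\mathcal{L}$ is reducible. Otherwise $N \in F$ is transcendental over $C(X)$, so that $F$ has a derivation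
  $\partial$ that vanishes on $C(X)$ and has $\partial N = 1$. Expanding $S$ at the zeros of $D$ shows
  that the residues of $\partial v/D$ there are zero, and expanding it at infinity shows that the
  residue at infinity is $\partial N = 1$ up to sign. This contradicts the residue theorem.\<close>

section \<open>Division of operators\<close>

text \<open>The obstacle is that the degree of \<open>S\<close> is not bounded in terms of L: x y' =
  m y has the polynomial solution x^m for every natural m, so reducibility of the specialized
  operator may hinge on values of \<open>c\<close> being integers. No Zariski open condition
  excludes all integers at once, but injectivity on a finitely generated group does. Pluecker
  vectors replace the factor itself because its apparent singularities are not controlled: a vector
  without common zero leaves only \<open>v\<close>, of bounded degree, and N unknown. For unbounded
  N there is no limit of \<open>S\<close> in F[x], but its expansions at the points of F and at
  infinity have limits, which are nonzero by that normalization. At a simple zero p of D the residue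
  of v/D is an eigenvalue of the residue matrix of G/D at p, hence algebraic over C(X) and killed by
  \<partial>; applying \<partial> to the expansions gives the same conclusion at every singularity,
  irregular ones included. Irreducibility is assumed over the algebraic closure of C(X) because the
  place takes its values there.\<close>

lemma rat_deriv_to_fract [simp]: "rat_deriv (to_fract p) = to_fract (pderiv p)"
  by (simp add: to_fract_def rat_deriv_Fract)

lemma rat_deriv_minus: "rat_deriv (- r) = - rat_deriv r"
  using rat_deriv_add[of r "- r"] by (simp add: add_eq_0_iff)

lemma rat_deriv_sum: "rat_deriv (\<Sum>i\<in>A. f i) = (\<Sum>i\<in>A. rat_deriv (f i))"
  by (induction A rule: infinite_finite_induct) (simp_all add: rat_deriv_add)

lemma to_fract_power: "to_fract (x ^ n) = to_fract x ^ n"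
  by (induction n) (simp_all add: to_fract_mult)

lemma coeff_delta_left:
  "coeff (delta_left P) l = rat_deriv (coeff P l) + (if l = 0 then 0 else coeff P (l - 1))"
  by (cases l) (simp_all add: delta_left_def coeff_map_poly)

lemma delta_left_pow_degree:
  assumes "Q \<noteq> 0"
  shows "(delta_left ^^ i) Q \<noteq> 0 \<and> degree ((delta_left ^^ i) Q) = i + degree Q \<and>
    lead_coeff ((delta_left ^^ i) Q) = lead_coeff Q"
proof (induction i)
  case (Suc i)
  let ?P = "(delta_left ^^ i) Q"
  have c: "coeff (delta_left ?P) (Suc (degree ?P)) = lead_coeff ?P"
    by (simp add: coeff_delta_left coeff_eq_0)
  have "degree (delta_left ?P) = Suc (degree ?P)"
  proof (rule antisym)
    show "degree (delta_left ?P) \<le> Suc (degree ?P)"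
      by (rule degree_le) (auto simp: coeff_delta_left coeff_eq_0)
    show "Suc (degree ?P) \<le> degree (delta_left ?P)"
      by (rule le_degree) (use c Suc in auto)
  qed
  with c Suc show ?case by auto
qed (use assms in simp)

text \<open>Moving \<delta> past a coefficient only adds terms of lower order, so that leading
  coefficients multiply as in a commutative polynomial ring; in particular there are no zero
  divisors.\<close>

lemma skew_mult_degree:
  assumes "P \<noteq> 0" "Q \<noteq> 0"
  shows "degree (skew_mult P Q) = degree P + degree Q"
    and "lead_coeff (skew_mult P Q) = lead_coeff P * lead_coeff Q"
    and "skew_mult P Q \<noteq> 0"
proof -
  let ?n = "degree P + degree Q"
  have *: "coeff (skew_mult P Q) l = (\<Sum>i\<le>degree P. coeff P i * coeff ((delta_left ^^ i) Q) l)" for l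
    by (simp add: skew_mult_def coeff_sum)
  have "coeff (skew_mult P Q) ?n = (\<Sum>i\<le>degree P. if i = degree P then lead_coeff P * lead_coeff Q else 0)"
    unfolding *
    by (rule sum.cong) (use delta_left_pow_degree[OF assms(2)] in \<open>auto simp: coeff_eq_0\<close>,
      metis)
  then have c: "coeff (skew_mult P Q) ?n = lead_coeff P * lead_coeff Q"
    by simp
  have d: "degree (skew_mult P Q) \<le> ?n"
  proof (rule degree_le, intro allI impI)
    fix l assume "?n < l"
    then show "coeff (skew_mult P Q) l = 0"
      unfolding * using delta_left_pow_degree[OF assms(2)]
      by (intro sum.neutral) (auto simp: coeff_eq_0)
  qed
  have nz: "lead_coeff P * lead_coeff Q \<noteq> 0" using assms by simp
  show 1: "degree (skew_mult P Q) = ?n"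
    using d c nz by (intro antisym le_degree) auto
  show "lead_coeff (skew_mult P Q) = lead_coeff P * lead_coeff Q" unfolding 1 by (rule c)
  show "skew_mult P Q \<noteq> 0" using c nz by auto
qed

lemma skew_mult_minus_left: "skew_mult (- P) Q = - skew_mult P Q"
  using skew_mult_add_left[of P "- P" Q] by (simp add: eq_neg_iff_add_eq_0 add.commute)

lemma skew_mult_diff_left: "skew_mult (P - P') Q = skew_mult P Q - skew_mult P' Q"
  using skew_mult_add_left[of P "- P'" Q] by (simp add: skew_mult_minus_left)

lemma skew_right_division:
  assumes "B \<noteq> 0"
  shows "\<exists>Q R. A = skew_mult Q B + R \<and> (R = 0 \<or> degree R < degree B)"
proof (induction "degree A" arbitrary: A rule: less_induct)
  case less
  show ?case
  proof (cases "A = 0 \<or> degree A < degree B")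
    case True
    then show ?thesis by (intro exI[of _ 0] exI[of _ A]) simp
  next
    case False
    define k where "k = degree A - degree B"
    define M where "M = monom (lead_coeff A / lead_coeff B) k"
    have M: "M \<noteq> 0" "degree M = k" "lead_coeff M = lead_coeff A / lead_coeff B"
      using assms False by (auto simp: M_def degree_monom_eq)
    define A' where "A' = A - skew_mult M B"
    have dM: "degree (skew_mult M B) = degree A" "lead_coeff (skew_mult M B) = lead_coeff A"
      using skew_mult_degree[OF M(1) assms] M False by (auto simp: k_def assms)
    have "A' = 0 \<or> degree A' < degree A"
    proof (cases "degree A = 0")
      case True
      have "A' = 0" unfolding A'_def using True dM
        by (intro poly_eqI) (metis coeff_diff coeff_eq_0 diff_self not_gr_zero coeff_0)
      then show ?thesis ..
    next
      case False
      have "degree A' \<le> degree A - 1"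
      proof (rule degree_le, intro allI impI)
        fix l assume l: "degree A - 1 < l"
        show "coeff A' l = 0"
        proof (cases "l = degree A")
          case True
          then show ?thesis using dM by (simp add: A'_def)
        next
          case False
          then have "l > degree A" using l by auto
          then show ?thesis using dM by (simp add: A'_def coeff_eq_0)
        qed
      qed
      with False show ?thesis by auto
    qed
    then obtain Q R where QR: "A' = skew_mult Q B + R" "R = 0 \<or> degree R < degree B"
    proof
      assume "A' = 0"
      then show ?thesis using that[of 0 0] by simp
    next
      assume "degree A' < degree A"
      from less[OF this] that show ?thesis by blast
    qed
    have "A = skew_mult (M + Q) B + R"
      using QR(1) by (simp add: A'_def skew_mult_add_left algebra_simps)
    with QR(2) show ?thesis by blast
  qed
qed

lemma smult_sum_right: "smult r (\<Sum>i\<in>A. f i) = (\<Sum>i\<in>A. smult r (f i))"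
  by (induction A rule: infinite_finite_induct) (simp_all add: smult_add_right)

definition reducible_skew :: "'f::field poly fract poly \<Rightarrow> bool" where
  "reducible_skew P \<longleftrightarrow> (\<exists>A B. P = skew_mult A B \<and> degree A > 0 \<and> degree B > 0)"

lemma irreducible_op_iff:
  "irreducible_op L \<longleftrightarrow> degree (op_poly L) > 0 \<and> \<not> reducible_skew (op_poly L)"
proof -
  have "(\<exists>A B. L = A * B \<and> ord_op A > 0 \<and> ord_op B > 0) \<longleftrightarrow> reducible_skew (op_poly L)"
    (is "?l \<longleftrightarrow> ?r")
  proof
    assume ?l
    then show ?r unfolding reducible_skew_def ord_op_def by (metis times_diffop.rep_eq)
  next
    assume ?r
    then obtain A B where AB: "op_poly L = skew_mult A B" "degree A > 0" "degree B > 0"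
      by (auto simp: reducible_skew_def)
    then have "L = Diffop A * Diffop B"
      by (simp flip: op_poly_inject add: times_diffop.rep_eq Diffop_inverse)
    with AB show ?l by (intro exI[of _ "Diffop A"] exI[of _ "Diffop B"]) (simp add: ord_op_def Diffop_inverse)
  qed
  then show ?thesis by (simp add: irreducible_op_def ord_op_def)
qed

text \<open>A nonzero coefficient can be absorbed in the left factor; this is what allows
  denominators to be cleared.\<close>

lemma reducible_skew_smult:
  assumes "r \<noteq> 0"
  shows "reducible_skew (smult r P) \<longleftrightarrow> reducible_skew P"
proof -
  have *: "reducible_skew (smult r P)" if "r \<noteq> 0" "reducible_skew P" for r and P :: "'a poly fract poly"
    using that unfolding reducible_skew_def by (metis degree_smult_eq skew_mult_smult_left)
  show ?thesis using *[OF assms, of P] *[of "inverse r" "smult r P"] assms by auto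
qed

text \<open>\<open>J\<close> is a left ideal, being closed under left multiplication by coefficients
  and by \<delta>. By right division an element \<open>B\<close> of least order is a right factor of
  every element of \<open>J\<close>, in particular of \<open>L\<close>. Its order is positive as
  \<open>J\<close> is proper, and smaller than that of \<open>L\<close> because of
  \<open>P\<close>.\<close>

lemma left_ideal_imp_reducible:
  assumes add: "\<And>P Q. P \<in> J \<Longrightarrow> Q \<in> J \<Longrightarrow> P + Q \<in> J"
    and smult: "\<And>r P. P \<in> J \<Longrightarrow> smult r P \<in> J"
    and delta: "\<And>P. P \<in> J \<Longrightarrow> delta_left P \<in> J"
    and L: "L \<in> J"
    and P: "P \<in> J" "P \<noteq> 0" "degree P < degree L"
    and one: "1 \<notin> J"
  shows "reducible_skew L"
proof -
  define B where "B = arg_min degree (\<lambda>P. P \<in> J \<and> P \<noteq> 0)"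
  have B: "B \<in> J" "B \<noteq> 0" and min: "\<And>P. P \<in> J \<Longrightarrow> P \<noteq> 0 \<Longrightarrow> degree B \<le> degree P"
    unfolding B_def
    using arg_min_natI[of "\<lambda>P. P \<in> J \<and> P \<noteq> 0" P degree]
      arg_min_nat_le[of "\<lambda>P. P \<in> J \<and> P \<noteq> 0" _ degree] P by auto
  have zero: "0 \<in> J" using smult[OF L, of 0] by simp
  have sum: "(\<Sum>i\<in>A. f i) \<in> J" if "\<And>i. i \<in> A \<Longrightarrow> f i \<in> J" for A and f :: "nat \<Rightarrow> _"
    using that by (induction A rule: infinite_finite_induct) (auto intro: add zero)
  have pow: "(delta_left ^^ i) P \<in> J" if "P \<in> J" for i P
    using that by (induction i) (auto intro: delta)
  have mult: "skew_mult Q P \<in> J" if "P \<in> J" for Q P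
    unfolding skew_mult_def by (intro sum smult pow that)
  obtain Q R where QR: "L = skew_mult Q B + R" "R = 0 \<or> degree R < degree B"
    using skew_right_division[OF B(2)] by blast
  have "R = L + smult (- 1) (skew_mult Q B)" using QR(1) by simp
  then have "R \<in> J" using add L mult[OF B(1)] smult by metis
  then have "R = 0" using QR(2) min by force
  with QR have eq: "L = skew_mult Q B" by simp
  have B0: "degree B > 0"
  proof (rule ccontr)
    assume "\<not> degree B > 0"
    then obtain b where b: "B = [:b:]" by (auto elim: degree_eq_zeroE)
    then have "smult (inverse b) B = 1" using B(2) by simp
    with smult[OF B(1)] one show False by metis
  qed
  have "L \<noteq> 0" using P by auto
  then have "Q \<noteq> 0" using eq by auto
  then have "degree L = degree Q + degree B" using eq B skew_mult_degree by metis
  moreover have "degree B < degree L" using min P by fastforce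
  ultimately show ?thesis using eq B0 unfolding reducible_skew_def by (metis add_less_same_cancel2 zero_less_iff_neq_zero less_add_same_cancel2)
qed

section \<open>Invariant subspaces and Pluecker vectors\<close>

text \<open>An element of the $k$-th tensor power of $F(x)^n$ is a function on the lists in
  \<open>idx n k\<close>. The vector $(p_0, \dots, p_{n-1})$ stands for the class of $\sum_l p_l\delta^l$ modulo
  the left ideal of $\sum_{l \leq n} N_l\delta^l$. Left multiplication by $N_n\delta$ is then
  $p \mapsto N_n p' + Gp$ with \<open>G = comp_mat n N\<close>, and \<open>tact n G\<close> is the induced action of \<open>G\<close>
  on tensors.\<close>

definition idx :: "nat \<Rightarrow> nat \<Rightarrow> nat list set" where
  "idx n k = {I. set I \<subseteq> {..<n} \<and> length I = k}"

lemma finite_idx [simp]: "finite (idx n k)"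
  unfolding idx_def by (rule finite_lists_length_eq) simp

lemma idx_Cons [simp]: "l # J \<in> idx n (Suc k) \<longleftrightarrow> l < n \<and> J \<in> idx n k"
  by (auto simp: idx_def)

lemma idx_update: "I \<in> idx n k \<Longrightarrow> l < n \<Longrightarrow> I[i := l] \<in> idx n k"
  using set_update_subset_insert[of I i l] by (auto simp: idx_def)

lemma idx_nth: "I \<in> idx n k \<Longrightarrow> i < k \<Longrightarrow> I ! i < n"
  using nth_mem[of i I] by (auto simp: idx_def simp del: nth_mem)

definition tact :: "nat \<Rightarrow> (nat \<Rightarrow> nat \<Rightarrow> 'a) \<Rightarrow> (nat list \<Rightarrow> 'a) \<Rightarrow> nat list \<Rightarrow> 'a::comm_ring_1" where
  "tact n a Y I = (\<Sum>i<length I. \<Sum>l<n. a (I ! i) l * Y (I[i := l]))"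

definition comp_mat :: "nat \<Rightarrow> (nat \<Rightarrow> 'a) \<Rightarrow> nat \<Rightarrow> nat \<Rightarrow> 'a::comm_ring_1" where
  "comp_mat n N l l' = (if l = Suc l' then N n else 0) - (if Suc l' = n then N l else 0)"

text \<open>The line through \<open>S\<close> is stable under N_n d/dx + G acting on the k-th tensor
  power. Arbitrary lists serve as indices, in any order and with repetitions, in place of a basis of
  the exterior power; this keeps signs and sorting out of the action.\<close>

definition tensor_eq ::
  "nat \<Rightarrow> nat \<Rightarrow> (nat \<Rightarrow> 'a poly) \<Rightarrow> 'a poly \<Rightarrow> (nat list \<Rightarrow> 'a::idom poly) \<Rightarrow> bool" where
  "tensor_eq n k N v S \<longleftrightarrow>
    (\<forall>I\<in>idx n k. N n * pderiv (S I) + tact n (comp_mat n N) S I = v * S I)"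

text \<open>\<open>plsum k u S\<close> is $u \wedge S$ for an antisymmetric \<open>S\<close>. If $S = w_1 \wedge \dots \wedge w_k$,
  then every contraction $l \mapsto$ \<open>S (l # J)\<close> is a combination of the $w_i$, and so its wedge product
  with \<open>S\<close> vanishes.\<close>

definition omit :: "nat \<Rightarrow> 'a list \<Rightarrow> 'a list" where
  "omit i I = take i I @ drop (Suc i) I"

definition plsum :: "nat \<Rightarrow> (nat \<Rightarrow> 'a) \<Rightarrow> (nat list \<Rightarrow> 'a) \<Rightarrow> nat list \<Rightarrow> 'a::comm_ring_1" where
  "plsum k u S I = (\<Sum>i\<le>k. (-1) ^ i * u (I ! i) * S (omit i I))"

definition pluecker :: "nat \<Rightarrow> nat \<Rightarrow> (nat list \<Rightarrow> 'a::comm_ring_1) \<Rightarrow> bool" where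
  "pluecker n k S \<longleftrightarrow>
    (\<forall>I\<in>idx n (Suc k). \<forall>J\<in>idx n (k - 1). plsum k (\<lambda>l. S (l # J)) S I = 0)"

lemma idx_omit: "I \<in> idx n (Suc k) \<Longrightarrow> i \<le> k \<Longrightarrow> omit i I \<in> idx n k"
  using set_take_subset[of i I] set_drop_subset[of "Suc i" I] by (auto simp: idx_def omit_def)

lemma idx_nth_Cons:
  "I \<in> idx n (Suc k) \<Longrightarrow> J \<in> idx n (k - 1) \<Longrightarrow> i \<le> k \<Longrightarrow> 0 < k \<Longrightarrow> I ! i # J \<in> idx n k"
  using idx_nth[of I n "Suc k" i] by (auto simp: idx_def)

text \<open>The first summand is the action of \<open>a\<close> on the contraction of
  \<open>Y\<close> with \<open>J\<close>, the second a combination of further contractions. This is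
  why the contractions of a solution span a stable subspace.\<close>

lemma tact_Cons:
  "tact n a Y (l # J) = (\<Sum>l'<n. a l l' * Y (l' # J)) +
    (\<Sum>i<length J. \<Sum>l'<n. a (J ! i) l' * Y (l # J[i := l']))"
  unfolding tact_def by (simp add: lessThan_Suc_eq_insert_0 sum.reindex)

definition op_of :: "nat \<Rightarrow> (nat \<Rightarrow> 'a::field poly) \<Rightarrow> 'a poly fract poly" where
  "op_of n N = (\<Sum>l\<le>n. monom (to_fract (N l)) l)"

lemma coeff_op_of: "coeff (op_of n N) l = (if l \<le> n then to_fract (N l) else 0)"
  by (simp add: op_of_def coeff_sum)

lemma degree_op_of: "N n \<noteq> 0 \<Longrightarrow> degree (op_of n N) = n"
  by (intro antisym degree_le le_degree) (auto simp: coeff_op_of)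

text \<open>Multiplication by \<delta> shifts the coefficients up, and the overflow at \<delta>^n is
  removed by subtracting s (n - 1) times the operator. The factor \<open>N n\<close> keeps all
  entries polynomial.\<close>

lemma sum_comp_mat:
  assumes "l < n"
  shows "(\<Sum>l'<n. comp_mat n N l l' * s l') =
    (if l = 0 then 0 else N n * s (l - 1)) - N l * s (n - 1)"
proof -
  have "(\<Sum>l'<n. comp_mat n N l l' * s l') =
      (\<Sum>l'<n. if l = Suc l' then N n * s l' else 0) - (\<Sum>l'<n. if Suc l' = n then N l * s l' else 0)"
    by (simp add: comp_mat_def sum_subtractf[symmetric] left_diff_distrib if_distrib[of "\<lambda>x. x * _"] cong: if_cong)
  also have "(\<Sum>l'<n. if l = Suc l' then N n * s l' else 0) = (if l = 0 then 0 else N n * s (l - 1))"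
  proof (cases l)
    case (Suc l0)
    have "(\<Sum>l'<n. if l = Suc l' then N n * s l' else 0) = (\<Sum>l'<n. if l' = l0 then N n * s l' else 0)"
      by (rule sum.cong) (auto simp: Suc)
    with Suc assms show ?thesis by simp
  qed simp
  also have "(\<Sum>l'<n. if Suc l' = n then N l * s l' else 0) = (\<Sum>l'<n. if l' = n - 1 then N l * s l' else 0)"
    by (rule sum.cong) (use assms in auto)
  also have "\<dots> = N l * s (n - 1)" using assms by simp
  finally show ?thesis .
qed

text \<open>The contractions of \<open>S\<close> span an invariant subspace \<open>W\<close>. It is proper: if \<open>S I0\<close> is not zero and
  \<open>l\<close> does not occur in \<open>I0\<close>, then $e_l \wedge S$ is not zero at \<open>l # I0\<close>, so that $e_l$ is not in \<open>W\<close>.\<close>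

lemma tensor_eq_imp_reducible:
  fixes N :: "nat \<Rightarrow> 'a::field poly"
  assumes k: "Suc k < n" and N: "N n \<noteq> 0"
    and eq: "tensor_eq n (Suc k) N v S" and pl: "pluecker n (Suc k) S"
    and I0: "I0 \<in> idx n (Suc k)" "S I0 \<noteq> 0"
  shows "reducible_skew (op_of n N)"
proof -
  define L where "L = op_of n N"
  have L: "L \<noteq> 0" "degree L = n" using degree_op_of[of N n] N k by (auto simp: L_def)
  define P where "P = (\<lambda>J. \<Sum>l<n. monom (to_fract (S (l # J))) l)"
  have coeff_P: "coeff (P J) l = (if l < n then to_fract (S (l # J)) else 0)" for J l
    by (simp add: P_def coeff_sum)
  define W where "W = {(\<Sum>J\<in>idx n k. smult (y J) (P J)) |y. True}"
  have W_add: "A + B \<in> W" if "A \<in> W" "B \<in> W" for A B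
  proof -
    from that obtain y z where "A = (\<Sum>J\<in>idx n k. smult (y J) (P J))"
      "B = (\<Sum>J\<in>idx n k. smult (z J) (P J))" by (auto simp: W_def)
    then have "A + B = (\<Sum>J\<in>idx n k. smult (y J + z J) (P J))"
      by (simp add: smult_add_left sum.distrib)
    then show ?thesis unfolding W_def by (intro CollectI exI[of _ "\<lambda>J. y J + z J"]) simp
  qed
  have W_smult: "smult r A \<in> W" if "A \<in> W" for r A
  proof -
    from that obtain y where "A = (\<Sum>J\<in>idx n k. smult (y J) (P J))" by (auto simp: W_def)
    then have "smult r A = (\<Sum>J\<in>idx n k. smult (r * y J) (P J))"
      by (simp add: smult_sum_right)
    then show ?thesis unfolding W_def by (intro CollectI exI[of _ "\<lambda>J. r * y J"]) simp
  qed
  have W_P: "P J \<in> W" if "J \<in> idx n k" for J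
  proof -
    have "P J = (\<Sum>K\<in>idx n k. smult (if K = J then 1 else 0) (P K))"
      using that by (simp add: if_distrib[of "\<lambda>x. smult x _"] cong: if_cong)
    then show ?thesis unfolding W_def by (intro CollectI exI[of _ "\<lambda>K. if K = J then 1 else 0"]) simp
  qed
  have W0: "0 \<in> W" using W_smult[of _ 0] W_P[of "replicate k 0"] k by (force simp: idx_def)
  have W_sum: "(\<Sum>i\<in>A. f i) \<in> W" if "\<And>i. i \<in> A \<Longrightarrow> f i \<in> W" for A and f :: "nat \<Rightarrow> _"
    using that by (induction A rule: infinite_finite_induct) (auto intro: W_add W0)
  have deg_W: "coeff A l = 0" if "A \<in> W" "l \<ge> n" for A l
    using that by (auto simp: W_def coeff_sum coeff_P)
  \<comment> \<open>The preimage of \<open>W\<close> under reduction modulo the left multiples of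
    \<open>L\<close>; stability of \<open>W\<close> makes it a left ideal.\<close>
  define J where "J = {A + skew_mult Q L |A Q. A \<in> W}"
  have W_J: "A \<in> J" if "A \<in> W" for A
    unfolding J_def using that by (intro CollectI exI[of _ A] exI[of _ 0]) simp
  have L_J: "skew_mult Q L \<in> J" for Q unfolding J_def using W0 by force
  have J_add: "A + B \<in> J" if "A \<in> J" "B \<in> J" for A B
  proof -
    from that obtain A1 Q1 A2 Q2 where "A = A1 + skew_mult Q1 L" "B = A2 + skew_mult Q2 L"
      "A1 \<in> W" "A2 \<in> W" by (auto simp: J_def)
    then have "A + B = (A1 + A2) + skew_mult (Q1 + Q2) L" "A1 + A2 \<in> W"
      by (auto simp: skew_mult_add_left W_add)
    then show ?thesis unfolding J_def by blast
  qed
  have J_smult: "smult r A \<in> J" if "A \<in> J" for A r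
  proof -
    from that obtain A1 Q1 where "A = A1 + skew_mult Q1 L" "A1 \<in> W" by (auto simp: J_def)
    then have "smult r A = smult r A1 + skew_mult (smult r Q1) L" "smult r A1 \<in> W"
      by (auto simp: skew_mult_smult_left smult_add_right W_smult)
    then show ?thesis unfolding J_def by blast
  qed
  have J_sum: "(\<Sum>i\<in>A. f i) \<in> J" if "\<And>i. i \<in> A \<Longrightarrow> f i \<in> J" for A and f :: "nat list \<Rightarrow> _"
    using that by (induction A rule: infinite_finite_induct) (auto intro: J_add W_J W0)
  have delta_P: "delta_left (P K) \<in> J" if K: "K \<in> idx n k" for K
  proof -
    let ?D = "to_fract (N n)" and ?s = "to_fract (S ((n - 1) # K))"
    define R where "R = (\<Sum>i<k. \<Sum>l'<n. smult (to_fract (comp_mat n N (K ! i) l')) (P (K[i := l'])))"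
    have lenK: "length K = k" using K by (simp add: idx_def)
    have "R \<in> W" unfolding R_def by (intro W_sum W_smult W_P idx_update K) auto
    \<comment> \<open>This is the tensor equation at the indices l # K. \<open>R\<close> collects
      the slots other than the first, and the multiple of \<open>L\<close> restores the term of
      order n that the companion matrix reduces away.\<close>
    have "smult ?D (delta_left (P K)) = smult (to_fract v) (P K) + smult (- 1) R + smult ?s L"
    proof (rule poly_eqI)
      fix l
      show "coeff (smult ?D (delta_left (P K))) l =
          coeff (smult (to_fract v) (P K) + smult (- 1) R + smult ?s L) l"
      proof (cases "l < n")
        case True
        then have "N n * pderiv (S (l # K)) + tact n (comp_mat n N) S (l # K) = v * S (l # K)"
          using eq K by (auto simp: tensor_eq_def)
        then have "N n * pderiv (S (l # K)) + (if l = 0 then 0 else N n * S ((l - 1) # K)) =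
           v * S (l # K) - (\<Sum>i<k. \<Sum>l'<n. comp_mat n N (K ! i) l' * S (l # K[i := l'])) + N l * S ((n - 1) # K)"
          unfolding tact_Cons sum_comp_mat[OF True] lenK by (simp add: algebra_simps)
        from arg_cong[OF this, of to_fract]
        have "?D * to_fract (pderiv (S (l # K))) + (if l = 0 then 0 else ?D * to_fract (S ((l - 1) # K))) =
           to_fract v * to_fract (S (l # K)) - (\<Sum>i<k. \<Sum>l'<n. to_fract (comp_mat n N (K ! i) l') * to_fract (S (l # K[i := l']))) + to_fract (N l) * ?s"
          by (cases "l = 0") (simp_all only: to_fract_add to_fract_mult to_fract_diff to_fract_sum if_True if_False to_fract_0 simp_thms)
        then show ?thesis using True
          by (auto simp: coeff_delta_left coeff_P R_def coeff_sum L_def coeff_op_of algebra_simps sum_negf)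
      next
        case False
        have "coeff R l = 0" using deg_W[OF \<open>R \<in> W\<close>] False by simp
        with False k show ?thesis
          by (cases "l = n") (auto simp: coeff_delta_left coeff_P L_def coeff_op_of)
      qed
    qed
    also have "\<dots> \<in> J"
      using J_smult[OF L_J[of 1], of ?s] W_J[OF W_smult[OF W_P[OF K]]] W_J[OF W_smult[OF \<open>R \<in> W\<close>]]
      by (auto simp: skew_mult_1_left intro!: J_add simp del: smult_minus_left)
    finally have "smult (inverse ?D) (smult ?D (delta_left (P K))) \<in> J" by (rule J_smult)
    then show ?thesis using N by simp
  qed
  have J_delta: "delta_left A \<in> J" if "A \<in> J" for A
  proof -
    from that obtain A1 Q where A: "A = A1 + skew_mult Q L" "A1 \<in> W" by (auto simp: J_def)
    then obtain y where A1: "A1 = (\<Sum>K\<in>idx n k. smult (y K) (P K))" by (auto simp: W_def)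
    have ds: "delta_left (\<Sum>i\<in>A. f i) = (\<Sum>i\<in>A. delta_left (f i))" for A and f :: "nat list \<Rightarrow> 'a poly fract poly"
      by (induction A rule: infinite_finite_induct) (simp_all add: delta_left_add)
    have "delta_left A1 \<in> J" unfolding A1 ds delta_left_smult
      by (intro J_sum J_add J_smult delta_P W_J W_P) auto
    then show ?thesis unfolding A(1) delta_left_add skew_mult_delta_left[symmetric]
      by (intro J_add L_J)
  qed
  \<comment> \<open>Vanishing of the wedge product with \<open>S\<close> is a linear condition on
    the vector, so that the Pluecker relations, which give it for the generators, give it on all of
    \<open>W\<close>.\<close>
  have pl_W: "plsum (Suc k) (coeff A) (\<lambda>I. to_fract (S I)) I = 0"
    if A: "A \<in> W" and I: "I \<in> idx n (Suc (Suc k))" for A I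
  proof -
    let ?S = "\<lambda>I. to_fract (S I)"
    from A obtain y where A: "A = (\<Sum>K\<in>idx n k. smult (y K) (P K))" by (auto simp: W_def)
    have K0: "plsum (Suc k) (coeff (P K)) ?S I = 0" if K: "K \<in> idx n k" for K
    proof -
      have "plsum (Suc k) (\<lambda>l. S (l # K)) S I = 0" using pl I K by (auto simp: pluecker_def)
      from arg_cong[OF this, of to_fract]
      have "plsum (Suc k) (\<lambda>l. ?S (l # K)) ?S I = 0"
        unfolding plsum_def
        by (simp only: to_fract_sum to_fract_mult to_fract_power to_fract_uminus to_fract_1 to_fract_0)
      moreover have "I ! i < n" if "i \<le> Suc k" for i using idx_nth[OF I, of i] that by simp
      ultimately show ?thesis by (simp add: plsum_def coeff_P cong: sum.cong_simp del: sum.atMost_Suc)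
    qed
    have "plsum (Suc k) (coeff A) ?S I = (\<Sum>K\<in>idx n k. y K * plsum (Suc k) (coeff (P K)) ?S I)"
      unfolding A coeff_sum plsum_def sum_distrib_left sum_distrib_right
      by (subst sum.swap) (simp add: mult_ac del: sum.atMost_Suc)
    also have "\<dots> = 0" by (intro sum.neutral ballI) (simp only: K0 mult_zero_right)
    finally show ?thesis .
  qed
  have one: "1 \<notin> J"
  proof
    assume one: "1 \<in> J"
    have "card (set I0) \<le> Suc k" using card_length[of I0] I0 by (simp add: idx_def)
    then obtain l where l: "l < n" "l \<notin> set I0"
      using k by (metis card_lessThan card_mono finite_set lessThan_iff not_less subsetI leD le_less_trans)
    have "(delta_left ^^ i) 1 \<in> J" for i using one by (induction i) (auto intro: J_delta)
    then have "monom 1 l \<in> J" by (metis delta_left_pow_one)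
    then obtain A Q where AQ: "monom 1 l = A + skew_mult Q L" "A \<in> W" by (auto simp: J_def)
    \<comment> \<open>Elements of \<open>W\<close> and the monomial have order less than n, whereas
      a nonzero left multiple of \<open>L\<close> has order at least n.\<close>
    have "Q = 0"
    proof (rule ccontr)
      assume Q: "Q \<noteq> 0"
      have "lead_coeff (skew_mult Q L) \<noteq> 0" "degree (skew_mult Q L) \<ge> n"
        using skew_mult_degree[OF Q L(1)] L by auto
      moreover have "coeff (skew_mult Q L) i = 0" if "i \<ge> n" for i
      proof -
        have "coeff (skew_mult Q L) i = coeff (monom 1 l) i - coeff A i" using AQ(1) by simp
        then show ?thesis using deg_W[OF AQ(2) that] that l by simp
      qed
      ultimately show False by blast
    qed
    with AQ have "monom 1 l \<in> W" by simp
    from pl_W[OF this, of "l # I0"] I0 l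
    have "plsum (Suc k) (coeff (monom 1 l)) (\<lambda>I. to_fract (S I)) (l # I0) = 0" by simp
    also have "plsum (Suc k) (coeff (monom 1 l)) (\<lambda>I. to_fract (S I)) (l # I0) =
      (\<Sum>i\<le>Suc k. if i = 0 then to_fract (S I0) else 0)"
      unfolding plsum_def
    proof (rule sum.cong)
      fix i assume "i \<in> {..Suc k}"
      then have "i = 0 \<or> (l # I0) ! i \<noteq> l" using l I0 by (cases i) (auto simp: idx_def)
      then show "(-1) ^ i * coeff (monom 1 l) ((l # I0) ! i) * to_fract (S (omit i (l # I0))) =
        (if i = 0 then to_fract (S I0) else 0)" by (auto simp: omit_def)
    qed simp
    finally show False using I0 by simp
  qed
  obtain l K where lK: "I0 = l # K" "l < n" "K \<in> idx n k"
    using I0 by (cases I0) (auto simp: idx_def)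
  have "coeff (P K) l \<noteq> 0" using lK I0 by (simp add: coeff_P)
  then have "P K \<noteq> 0" by auto
  moreover have "degree (P K) < degree L"
    using k L deg_W[OF W_P[OF lK(3)]] by (metis calculation leading_coeff_0_iff not_less)
  ultimately have "reducible_skew L"
    using L_J[of 1] W_J[OF W_P[OF lK(3)]] one
    by (intro left_ideal_imp_reducible[of J L "P K"] J_add J_smult J_delta) (auto simp: skew_mult_1_left)
  then show ?thesis by (simp add: L_def)
qed

section \<open>Pluecker coordinates as minors\<close>

lemma det_replace_row:
  fixes a :: "nat \<Rightarrow> nat \<Rightarrow> 'a::comm_ring_1"
  assumes "i0 < k"
  shows "det (mat k k (\<lambda>(i, j). if i = i0 then r j else a i j)) =
    (\<Sum>j<k. r j * cofactor (mat k k (\<lambda>(i, j). a i j)) i0 j)"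
proof -
  let ?B = "mat k k (\<lambda>(i, j). if i = i0 then r j else a i j)" and ?A = "mat k k (\<lambda>(i, j). a i j)"
  have "mat_delete ?B i0 j = mat_delete ?A i0 j" if "j < k" for j
    by (rule eq_matI) (use that assms in \<open>auto simp: mat_delete_def\<close>)
  then have "cofactor ?B i0 j = cofactor ?A i0 j" if "j < k" for j
    using that by (simp add: cofactor_def)
  moreover have "det ?B = (\<Sum>j<k. ?B $$ (i0, j) * cofactor ?B i0 j)"
    by (rule laplace_expansion_row) (use assms in auto)
  ultimately show ?thesis using assms by simp
qed

lemma rat_deriv_prod:
  "finite A \<Longrightarrow> rat_deriv (\<Prod>i\<in>A. f i) = (\<Sum>i0\<in>A. \<Prod>i\<in>A. if i = i0 then rat_deriv (f i) else f i)"
proof (induction A rule: finite_induct)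
  case (insert x A)
  have "(\<Prod>i\<in>A. if i = x then rat_deriv (f i) else f i) = (\<Prod>i\<in>A. f i)"
    by (rule prod.cong) (use insert in auto)
  moreover have "(\<Prod>i\<in>insert x A. if i = i0 then rat_deriv (f i) else f i) =
      f x * (\<Prod>i\<in>A. if i = i0 then rat_deriv (f i) else f i)" if "i0 \<in> A" for i0
    using insert that by auto
  ultimately show ?case
    unfolding sum.insert[OF insert(1,2)] sum_distrib_left
    using insert by (simp add: rat_deriv_mult del: prod.insert)
      (simp add: insert rat_deriv_mult sum_distrib_left)
qed simp

text \<open>Jacobi's formula: the Leibniz rule differentiates one row at a time, and the determinant
  with row i differentiated is expanded along that row.\<close>

lemma rat_deriv_det:
  fixes a :: "nat \<Rightarrow> nat \<Rightarrow> 'a::field poly fract"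
  shows "rat_deriv (det (mat k k (\<lambda>(i, j). a i j))) =
    (\<Sum>i<k. \<Sum>j<k. rat_deriv (a i j) * cofactor (mat k k (\<lambda>(i, j). a i j)) i j)"
proof -
  have sg: "rat_deriv (signof p * x) = signof p * rat_deriv x" for p and x :: "'a poly fract"
    by (cases "sign p = 1") (auto simp: sign_def rat_deriv_minus)
  have dt: "det (mat k k (\<lambda>(i, j). b i j)) =
      (\<Sum>p\<in>{p. p permutes {..<k}}. signof p * (\<Prod>i<k. b i (p i)))" for b :: "nat \<Rightarrow> nat \<Rightarrow> 'a poly fract"
  proof -
    have "p i < k" if "p permutes {..<k}" "i < k" for p i
      using that permutes_in_image[of p "{..<k}" i] by auto
    then show ?thesis
      by (subst det_def'[of _ k]) (auto simp: lessThan_atLeast0 intro!: sum.cong)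
  qed
  have "rat_deriv (det (mat k k (\<lambda>(i, j). a i j))) =
      (\<Sum>i0<k. det (mat k k (\<lambda>(i, j). if i = i0 then rat_deriv (a i0 j) else a i j)))"
    unfolding dt rat_deriv_sum sg rat_deriv_prod[OF finite_lessThan] sum_distrib_left
    by (subst sum.swap) (intro sum.cong prod.cong arg_cong2[where f="(*)"] refl, auto)
  then show ?thesis by (simp add: det_replace_row)
qed

text \<open>These are the entries of the identity adj(A) A = det(A) 1.\<close>

lemma sum_cofactor_column:
  fixes a :: "nat \<Rightarrow> nat \<Rightarrow> 'a::comm_ring_1"
  assumes "h < k" "j < k"
  shows "(\<Sum>i<k. a i h * cofactor (mat k k (\<lambda>(i, j). a i j)) i j) =
    (if h = j then det (mat k k (\<lambda>(i, j). a i j)) else 0)"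
proof -
  let ?A = "mat k k (\<lambda>(i, j). a i j)"
  have "(adj_mat ?A * ?A) $$ (j, h) = (\<Sum>i<k. a i h * cofactor ?A i j)"
    using assms by (simp add: adj_mat_def scalar_prod_def lessThan_atLeast0 mult.commute)
  moreover have "adj_mat ?A * ?A = det ?A \<cdot>\<^sub>m 1\<^sub>m k" by (rule adj_mat) simp
  ultimately show ?thesis using assms by auto
qed

text \<open>The coordinate at \<open>I\<close> of the wedge product of the vectors w_0, ...,
  w_(k-1), seen as a tensor: \<open>I\<close> is any list, and antisymmetry in it is that of the
  determinant in its rows.\<close>

definition minor :: "nat \<Rightarrow> (nat \<Rightarrow> nat \<Rightarrow> 'a) \<Rightarrow> nat list \<Rightarrow> 'a::comm_ring_1" where
  "minor k w I = det (mat k k (\<lambda>(i, j). w j (I ! i)))"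

lemma minor_update:
  assumes "length I = k" "i < k"
  shows "minor k w (I[i := l]) = (\<Sum>j<k. w j l * cofactor (mat k k (\<lambda>(i, j). w j (I ! i))) i j)"
proof -
  have "minor k w (I[i := l]) = det (mat k k (\<lambda>(i', j). if i' = i then w j l else w j (I ! i')))"
    unfolding minor_def by (intro arg_cong[of _ _ det] eq_matI) (use assms in \<open>auto simp: nth_list_update\<close>)
  then show ?thesis by (simp add: det_replace_row[OF assms(2)])
qed

text \<open>A connection that maps the span of the w_j to itself by the matrix \<open>T\<close> acts
  on their wedge product by the trace of \<open>T\<close>. The derivative of the minor and the
  action on tensors combine slot by slot; after inserting \<open>T\<close>, only its diagonal
  survives by \<open>sum_cofactor_column\<close>.\<close>

lemma minor_tensor:
  fixes w :: "nat \<Rightarrow> nat \<Rightarrow> 'a::field poly fract"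
  assumes w: "\<And>j l. j < k \<Longrightarrow> l < n \<Longrightarrow>
      rat_deriv (w j l) + (\<Sum>l'<n. \<alpha> l l' * w j l') = (\<Sum>h<k. T h j * w h l)"
    and I: "I \<in> idx n k"
  shows "rat_deriv (minor k w I) + tact n \<alpha> (minor k w) I = (\<Sum>j<k. T j j) * minor k w I"
proof -
  have len: "length I = k" using I by (simp add: idx_def)
  let ?C = "cofactor (mat k k (\<lambda>(i, j). w j (I ! i)))"
  have "rat_deriv (minor k w I) + tact n \<alpha> (minor k w) I =
      (\<Sum>i<k. \<Sum>j<k. rat_deriv (w j (I ! i)) * ?C i j) +
      (\<Sum>i<k. \<Sum>l'<n. \<alpha> (I ! i) l' * (\<Sum>j<k. w j l' * ?C i j))"
    unfolding tact_def len using len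
    by (simp add: minor_update) (simp add: minor_def rat_deriv_det)
  also have "(\<Sum>i<k. \<Sum>l'<n. \<alpha> (I ! i) l' * (\<Sum>j<k. w j l' * ?C i j)) =
      (\<Sum>i<k. \<Sum>j<k. (\<Sum>l'<n. \<alpha> (I ! i) l' * w j l') * ?C i j)"
    unfolding sum_distrib_left sum_distrib_right
    by (rule sum.cong[OF refl], subst sum.swap) (simp add: mult.assoc)
  also have "(\<Sum>i<k. \<Sum>j<k. rat_deriv (w j (I ! i)) * ?C i j) + \<dots> =
      (\<Sum>i<k. \<Sum>j<k. (\<Sum>h<k. T h j * w h (I ! i)) * ?C i j)"
    unfolding sum.distrib[symmetric]
    by (intro sum.cong refl) (simp flip: w add: idx_nth[OF I] distrib_right)
  also have "\<dots> = (\<Sum>j<k. \<Sum>h<k. T h j * (\<Sum>i<k. w h (I ! i) * ?C i j))"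
    unfolding sum_distrib_left sum_distrib_right
    by (subst sum.swap, rule sum.cong[OF refl], subst sum.swap) (simp add: mult.assoc)
  also have "\<dots> = (\<Sum>j<k. \<Sum>h<k. if h = j then T h j * minor k w I else 0)"
    by (intro sum.cong refl) (simp add: sum_cofactor_column[where a="\<lambda>i j. w j (I ! i)"] minor_def)
  finally show ?thesis by (simp add: sum_distrib_right)
qed

text \<open>Expansion along the first row writes the contraction with \<open>J\<close> as a
  combination of the w_j, so that it suffices to wedge with a single w_j. The sum is then a
  determinant with a repeated column.\<close>

lemma minor_pluecker:
  fixes w :: "nat \<Rightarrow> nat \<Rightarrow> 'a::comm_ring_1"
  shows "pluecker n (Suc k) (minor (Suc k) w)"
  unfolding pluecker_def
proof (intro ballI)
  fix I J assume I: "I \<in> idx n (Suc (Suc k))" and J: "J \<in> idx n (Suc k - 1)"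
  let ?k = "Suc k"
  let ?C = "cofactor (mat ?k ?k (\<lambda>(i, j). w j ((0 # J) ! i))) 0"
  have m1: "minor ?k w (l # J) = (\<Sum>j<?k. w j l * ?C j)" for l
    using minor_update[of "0 # J" ?k 0 w l] J by (simp add: idx_def)
  have m2: "(\<Sum>i\<le>?k. (-1) ^ i * w j (I ! i) * minor ?k w (omit i I)) = 0"
    if j: "j < ?k" for j
  proof -
    let ?n = "Suc ?k"
    \<comment> \<open>The column w_j stands twice, at 0 and at Suc j; expansion along column 0
      produces the Pluecker sum.\<close>
    define B where "B = mat ?n ?n (\<lambda>(i, h). w (if h = 0 then j else h - 1) (I ! i))"
    have "det B = 0"
      by (rule det_identical_columns[of _ ?n 0 "Suc j"]) (use j in \<open>auto simp: B_def\<close>)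
    moreover have "det B = (\<Sum>i<?n. B $$ (i, 0) * cofactor B i 0)"
      by (rule laplace_expansion_column) (auto simp: B_def)
    moreover have "cofactor B i 0 = (-1) ^ i * minor ?k w (omit i I)" if i: "i < ?n" for i
    proof -
      have "mat_delete B i 0 = mat ?k ?k (\<lambda>(i', j). w j (omit i I ! i'))"
        by (rule eq_matI) (use i I in \<open>auto simp: B_def mat_delete_def nth_append idx_def omit_def\<close>)
      then show ?thesis by (simp add: cofactor_def minor_def)
    qed
    ultimately show ?thesis
      by (simp add: B_def lessThan_Suc_atMost mult_ac del: sum.lessThan_Suc sum.atMost_Suc)
  qed
  have "plsum ?k (\<lambda>l. minor ?k w (l # J)) (minor ?k w) I =
    (\<Sum>j<?k. ?C j * (\<Sum>i\<le>?k. (-1) ^ i * w j (I ! i) * minor ?k w (omit i I)))"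
    unfolding m1 plsum_def sum_distrib_left sum_distrib_right by (subst sum.swap) (simp only: mult_ac)
  then show "plsum ?k (\<lambda>l. minor ?k w (l # J)) (minor ?k w) I = 0"
    using m2 by simp
qed

lemma tact_cong:
  assumes "I \<in> idx n k" "\<And>I. I \<in> idx n k \<Longrightarrow> Y I = Z I"
    "\<And>l l'. l < n \<Longrightarrow> l' < n \<Longrightarrow> a l l' = b l l'"
  shows "tact n a Y I = tact n b Z I"
  unfolding tact_def
  by (intro sum.cong refl) (use assms idx_nth[OF assms(1)] idx_update[OF assms(1)] in \<open>auto simp: idx_def\<close>)

lemma tact_smult_right: "tact n a (\<lambda>I. g * Y I) I = g * tact n a Y I"
  by (simp add: tact_def sum_distrib_left mult_ac)

lemma tact_smult_left: "tact n (\<lambda>l l'. g * a l l') Y I = g * tact n a Y I"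
  by (simp add: tact_def sum_distrib_left mult_ac)

lemma tact_to_fract:
  "tact n (\<lambda>l l'. to_fract (a l l')) (\<lambda>I. to_fract (Y I)) I = to_fract (tact n a Y I)"
  by (simp add: tact_def to_fract_sum to_fract_mult)

lemma common_denominator:
  assumes "finite A"
  shows "\<exists>q. q \<noteq> 0 \<and> (\<forall>i\<in>A. \<exists>p. to_fract q * f i = to_fract (p :: 'a::idom))"
  using assms
proof (induction A rule: finite_induct)
  case (insert x A)
  then obtain q where q: "q \<noteq> 0" "\<And>i. i \<in> A \<Longrightarrow> \<exists>p. to_fract q * f i = to_fract p" by blast
  obtain a b where ab: "f x = Fract a b" "b \<noteq> 0" by (cases "f x")
  have "to_fract (q * b) * f x = to_fract (q * a)"
    using ab by (simp add: to_fract_def eq_fract)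
  then have "\<exists>p. to_fract (q * b) * f x = to_fract p" ..
  moreover have "\<exists>p. to_fract (q * b) * f i = to_fract p" if i: "i \<in> A" for i
  proof -
    obtain p where "to_fract q * f i = to_fract p" using q(2)[OF i] by blast
    then have "to_fract (q * b) * f i = to_fract (b * p)" by (simp add: to_fract_mult mult_ac)
    then show ?thesis by blast
  qed
  ultimately show ?case using q(1) ab(2) by (intro exI[of _ "q * b"]) (auto simp del: to_fract_mult)
qed (auto intro: exI[of _ 1])

text \<open>At a pole of \<open>v\<close> the polynomial vector \<open>S\<close> would have to vanish. Hence \<open>v\<close> has no poles, also not at
  the apparent singularities of the factor.\<close>

lemma primitive_tensor:
  fixes R :: "nat list \<Rightarrow> 'c::alg_closed_field poly fract"
  assumes N: "N n \<noteq> 0"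
    and eq: "\<And>I. I \<in> idx n k \<Longrightarrow> rat_deriv (R I) +
        tact n (\<lambda>l l'. to_fract (comp_mat n N l l') / to_fract (N n)) R I = \<tau> * R I"
    and pl: "pluecker n k R" and k: "0 < k"
    and nz: "I0 \<in> idx n k" "R I0 \<noteq> 0"
  shows "\<exists>v S. tensor_eq n k N v S \<and> pluecker n k S \<and> (\<forall>x. \<exists>I\<in>idx n k. poly (S I) x \<noteq> 0)"
proof -
  define adm where "adm = (\<lambda>S. \<exists>g. g \<noteq> 0 \<and> (\<forall>I\<in>idx n k. to_fract (S I) = g * R I))"
  define deg where "deg = (\<lambda>S. \<Sum>I\<in>idx n k. degree (S I :: 'c poly))"
  obtain q where q: "q \<noteq> 0" "\<And>I. I \<in> idx n k \<Longrightarrow> \<exists>p. to_fract q * R I = to_fract p"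
    using common_denominator[OF finite_idx, of n k R] by blast
  then obtain S0 where "\<And>I. I \<in> idx n k \<Longrightarrow> to_fract (S0 I) = to_fract q * R I" by metis
  with q(1) have S0: "adm S0" unfolding adm_def by (intro exI[of _ "to_fract q"]) auto
  \<comment> \<open>Among the polynomial multiples of \<open>R\<close>, one of least total degree
    has no common zero, since a common linear factor could be cancelled.\<close>
  define S where "S = arg_min deg adm"
  have S: "adm S" and min: "\<And>S'. adm S' \<Longrightarrow> deg S \<le> deg S'"
    unfolding S_def using arg_min_natI[of adm S0 deg] arg_min_nat_le[of adm _ deg] S0 by auto
  obtain g where g: "g \<noteq> 0" "\<And>I. I \<in> idx n k \<Longrightarrow> to_fract (S I) = g * R I"
    using S by (auto simp: adm_def)
  have S_nz: "S I0 \<noteq> 0" using g(2)[OF nz(1)] g(1) nz(2) by auto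
  have prim: "\<exists>I\<in>idx n k. poly (S I) x \<noteq> 0" for x
  proof (rule ccontr)
    assume "\<not> ?thesis"
    then have "\<forall>I\<in>idx n k. [:-x, 1:] dvd S I" by (auto simp: poly_eq_0_iff_dvd)
    then obtain S' where S': "\<And>I. I \<in> idx n k \<Longrightarrow> S I = [:-x, 1:] * S' I" unfolding dvd_def by metis
    have "adm S'" unfolding adm_def
    proof (intro exI[of _ "g / to_fract [:-x, 1:]"] conjI ballI)
      fix I assume "I \<in> idx n k"
      with S' g(2) have "to_fract [:-x, 1:] * to_fract (S' I) = g * R I"
        by (metis to_fract_mult)
      then show "to_fract (S' I) = g / to_fract [:-x, 1:] * R I"
        by (simp add: field_simps)
    qed (use g in auto)
    moreover have "degree (S I) = degree (S' I) + (if S' I = 0 then 0 else 1)" if "I \<in> idx n k" for I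
      using S'[OF that] by (auto simp: degree_mult_eq simp del: mult_pCons_left)
    then have "deg S' < deg S" unfolding deg_def
      by (intro sum_strict_mono_ex1) (use nz S_nz S'[OF nz(1)] in \<open>auto intro!: bexI[of _ I0]\<close>)
    ultimately show False using min by fastforce
  qed
  have pl': "pluecker n k S" unfolding pluecker_def
  proof (intro ballI)
    fix I J assume I: "I \<in> idx n (Suc k)" and J: "J \<in> idx n (k - 1)"
    note i1 = idx_nth_Cons[OF I J _ k] and i2 = idx_omit[OF I]
    have "to_fract (plsum k (\<lambda>l. S (l # J)) S I) =
       (\<Sum>i\<le>k. (-1) ^ i * to_fract (S (I ! i # J)) * to_fract (S (omit i I)))"
      unfolding plsum_def
      by (simp only: to_fract_sum to_fract_mult to_fract_power to_fract_uminus to_fract_1)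
    also have "\<dots> = g * g * plsum k (\<lambda>l. R (l # J)) R I"
      unfolding plsum_def sum_distrib_left by (intro sum.cong) (auto simp: g(2) i1 i2 mult_ac)
    also have "\<dots> = 0" using pl I J by (auto simp: pluecker_def)
    finally show "plsum k (\<lambda>l. S (l # J)) S I = 0" by (simp only: to_fract_eq_0_iff)
  qed
  define Z where "Z = (\<lambda>I. N n * pderiv (S I) + tact n (comp_mat n N) S I)"
  \<comment> \<open>Replacing \<open>R\<close> by g R adds g'/g to \<tau>, so that the equation
    persists with some rational factor \<nu>.\<close>
  have Z: "\<exists>\<nu>. \<forall>I\<in>idx n k. to_fract (Z I) = \<nu> * to_fract (S I)"
  proof (intro exI ballI)
    fix I assume I: "I \<in> idx n k"
    let ?D = "to_fract (N n)" and ?a = "\<lambda>l l'. to_fract (comp_mat n N l l') / to_fract (N n)"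
    have "tact n ?a (\<lambda>I. to_fract (S I)) I = tact n ?a (\<lambda>I. g * R I) I"
      by (rule tact_cong[OF I]) (auto simp: g(2))
    also have "\<dots> = g * (\<tau> * R I - rat_deriv (R I))"
      unfolding tact_smult_right by (simp flip: eq[OF I])
    finally have 1: "tact n ?a (\<lambda>I. to_fract (S I)) I = g * (\<tau> * R I - rat_deriv (R I))" .
    have 2: "to_fract (pderiv (S I)) = rat_deriv g * R I + g * rat_deriv (R I)"
      using rat_deriv_to_fract[of "S I"] g(2)[OF I] by (simp add: rat_deriv_mult)
    have "to_fract (tact n (comp_mat n N) S I) =
        tact n (\<lambda>l l'. ?D * ?a l l') (\<lambda>I. to_fract (S I)) I"
      using N by (simp add: tact_to_fract[symmetric])
    also have "\<dots> = ?D * (g * (\<tau> * R I - rat_deriv (R I)))"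
      unfolding tact_smult_left 1 ..
    finally have "to_fract (Z I) = ?D * (rat_deriv g * R I + g * \<tau> * R I)"
      unfolding Z_def to_fract_add to_fract_mult 2 by (simp add: algebra_simps)
    also have "\<dots> = (?D * (rat_deriv g / g + \<tau>)) * to_fract (S I)"
      unfolding g(2)[OF I] using g(1) by (simp add: field_simps)
    finally show "to_fract (Z I) = (?D * (rat_deriv g / g + \<tau>)) * to_fract (S I)" .
  qed
  \<comment> \<open>\<open>quo (a, b)\<close> says that the factor is a/b. A denominator of least
    degree plays the role of lowest terms.\<close>
  define quo where "quo = (\<lambda>ab :: 'c poly \<times> 'c poly. snd ab \<noteq> 0 \<and> (\<forall>I\<in>idx n k. fst ab * S I = snd ab * Z I))"
  obtain \<nu> where \<nu>: "\<And>I. I \<in> idx n k \<Longrightarrow> to_fract (Z I) = \<nu> * to_fract (S I)" using Z by blast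
  obtain a0 b0 where ab0: "\<nu> = Fract a0 b0" "b0 \<noteq> 0" by (cases \<nu>)
  have "quo (a0, b0)" unfolding quo_def
    using \<nu> ab0 by (auto simp: to_fract_def eq_fract mult_ac)
  then obtain a b where ab: "quo (a, b)" and minb: "\<And>a' b'. quo (a', b') \<Longrightarrow> degree b \<le> degree b'"
    using ex_has_least_nat[of quo "(a0, b0)" "\<lambda>ab. degree (snd ab)"] by auto
  have "degree b = 0"
  proof (rule ccontr)
    assume "degree b \<noteq> 0"
    then obtain x where x: "poly b x = 0" using alg_closed_imp_poly_has_root[of b] by auto
    obtain I where I: "I \<in> idx n k" "poly (S I) x \<noteq> 0" using prim by blast
    have "poly (a * S I) x = poly (b * Z I) x" using ab I by (simp add: quo_def)
    then have "poly a x = 0" using x I by simp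
    then obtain a' b' where a': "a = [:-x, 1:] * a'" "b = [:-x, 1:] * b'"
      using x by (metis dvdE poly_eq_0_iff_dvd)
    have "b' \<noteq> 0" using a' ab by (auto simp: quo_def)
    have "quo (a', b')" unfolding quo_def
    proof (intro conjI ballI)
      fix I assume "I \<in> idx n k"
      then have "[:-x, 1:] * (a' * S I) = [:-x, 1:] * (b' * Z I)"
        using ab a' by (simp add: quo_def mult.assoc del: mult_pCons_left)
      then show "fst (a', b') * S I = snd (a', b') * Z I" by (simp del: mult_pCons_left)
    qed (use \<open>b' \<noteq> 0\<close> in simp)
    from minb[OF this] a'(2) \<open>b' \<noteq> 0\<close> show False
      by (simp add: degree_mult_eq del: mult_pCons_left)
  qed
  then obtain \<beta> where \<beta>: "b = [:\<beta>:]" by (auto elim: degree_eq_zeroE)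
  have "\<beta> \<noteq> 0" using ab \<beta> by (auto simp: quo_def)
  have "tensor_eq n k N (smult (inverse \<beta>) a) S" unfolding tensor_eq_def Z_def[symmetric]
  proof
    fix I assume "I \<in> idx n k"
    then have "a * S I = smult \<beta> (Z I)" using ab \<beta> by (simp add: quo_def)
    then have "smult (inverse \<beta>) (a * S I) = Z I" using \<open>\<beta> \<noteq> 0\<close> by simp
    then show "N n * pderiv (S I) + tact n (comp_mat n N) S I = smult (inverse \<beta>) a * S I"
      by (simp add: Z_def)
  qed
  with pl' prim show ?thesis by blast
qed

text \<open>Modulo the left multiples of AB, those of \<open>B\<close> have the basis B, \<delta>B,
  ..., \<delta>^(k-1) B, with k the order of \<open>A\<close>. Their span is stable under \<delta>,
  and its Pluecker vector, scaled by \<open>primitive_tensor\<close>, is the solution.\<close>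

lemma reducible_imp_tensor_eq:
  fixes N :: "nat \<Rightarrow> 'c::alg_closed_field poly"
  assumes N: "N n \<noteq> 0" and red: "reducible_skew (op_of n N)"
  shows "\<exists>k v S. Suc k < n \<and> tensor_eq n (Suc k) N v S \<and> pluecker n (Suc k) S \<and>
    (\<forall>x. \<exists>I\<in>idx n (Suc k). poly (S I) x \<noteq> 0)"
proof -
  obtain A B where AB: "op_of n N = skew_mult A B" "degree A > 0" "degree B > 0"
    using red by (auto simp: reducible_skew_def)
  then have nz: "A \<noteq> 0" "B \<noteq> 0" by auto
  define k m where "k = degree A" and "m = degree B"
  have km: "n = k + m" "0 < k" "0 < m"
    using skew_mult_degree(1)[OF nz] AB degree_op_of[of N n] N by (auto simp: k_def m_def)
  let ?L = "op_of n N" and ?D = "to_fract (N n)"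
  define E where "E = (\<lambda>j. (delta_left ^^ j) B)"
  have E: "E j \<noteq> 0" "degree (E j) = j + m" for j
    using delta_left_pow_degree[OF nz(2), of j] by (auto simp: E_def m_def)
  define w where "w = (\<lambda>j l. coeff (E j) l)"
  let ?a = "\<lambda>l l'. to_fract (comp_mat n N l l') / ?D"
  have "\<exists>T. \<forall>l<n. rat_deriv (w j l) + (\<Sum>l'<n. ?a l l' * w j l') = (\<Sum>h<k. T h * w h l)"
    if j: "j < k" for j
  proof -
    \<comment> \<open>Reduces \<delta>^(j+1) B modulo the operator: \<open>c\<close> is zero unless
      j = k - 1, and in that case cancels the term of order n. What remains is QB with
      \<open>Q\<close> of order less than k.\<close>
    define c where "c = coeff (E j) (n - 1) / ?D"
    define Q where "Q = monom 1 (Suc j) - smult c A"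
    define Z where "Z = delta_left (E j) - smult c ?L"
    have Z: "Z = skew_mult Q B"
      by (simp add: Z_def Q_def skew_mult_diff_left skew_mult_monom skew_mult_smult_left AB(1) E_def)
    have cZ: "coeff Z l = 0" if "l \<ge> n" for l
    proof (cases "l = n")
      case True
      then show ?thesis using j km N E[of j]
        by (auto simp: Z_def coeff_delta_left coeff_op_of c_def coeff_eq_0)
    next
      case False
      with that j km E[of j] show ?thesis
        by (auto simp: Z_def coeff_delta_left coeff_op_of coeff_eq_0)
    qed
    have dQ: "coeff Q h = 0" if "h \<ge> k" for h
    proof (rule ccontr)
      assume "coeff Q h \<noteq> 0"
      then have "Q \<noteq> 0" "degree Q \<ge> k" using le_degree[of Q h] that by auto
      then show False using skew_mult_degree[OF _ nz(2), of Q] Z cZ[of "degree Z"] km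
        by (auto simp: m_def)
    qed
    have ZQ: "Z = (\<Sum>h<k. smult (coeff Q h) (E h))"
    proof -
      have "Z = (\<Sum>h\<le>k. smult (coeff Q h) (E h))" unfolding Z E_def
        by (rule skew_mult_bound) (rule degree_le, use dQ in auto)
      then show ?thesis using dQ[of k] by (simp flip: lessThan_Suc_atMost)
    qed
    show ?thesis
    proof (intro exI[of _ "coeff Q"] allI impI)
      fix l assume l: "l < n"
      have "(\<Sum>l'<n. ?a l l' * w j l') = (\<Sum>l'<n. comp_mat n (\<lambda>i. to_fract (N i)) l l' * w j l') / ?D"
        by (auto simp: comp_mat_def sum_divide_distrib intro!: sum.cong)
      also have "\<dots> = (if l = 0 then 0 else w j (l - 1)) - c * to_fract (N l)"
        unfolding sum_comp_mat[OF l] using N by (auto simp: field_simps c_def w_def)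
      finally have "rat_deriv (w j l) + (\<Sum>l'<n. ?a l l' * w j l') = coeff Z l"
        using l by (simp add: Z_def w_def coeff_delta_left coeff_op_of)
      then show "rat_deriv (w j l) + (\<Sum>l'<n. ?a l l' * w j l') = (\<Sum>h<k. coeff Q h * w h l)"
        by (simp add: ZQ coeff_sum w_def)
    qed
  qed
  then have "\<forall>j\<in>{..<k}. \<exists>T. \<forall>l<n. rat_deriv (w j l) + (\<Sum>l'<n. ?a l l' * w j l') = (\<Sum>h<k. T h * w h l)"
    unfolding Ball_def lessThan_iff by blast
  from bchoice[OF this] obtain T where T: "\<And>j l. j < k \<Longrightarrow> l < n \<Longrightarrow>
      rat_deriv (w j l) + (\<Sum>l'<n. ?a l l' * w j l') = (\<Sum>h<k. T j h * w h l)"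
    unfolding Ball_def lessThan_iff by blast
  obtain k' where k': "k = Suc k'" using km by (cases k) auto
  \<comment> \<open>The top k coefficients: \<delta>^j B has order m + j, so this minor is
    triangular with leading coefficients on the diagonal.\<close>
  define I0 where "I0 = [m..<n]"
  have I0: "I0 \<in> idx n k" using km by (auto simp: I0_def idx_def)
  let ?M = "mat k k (\<lambda>(i, j). w j (I0 ! i))"
  have M: "w j (I0 ! i) = (if j < i then 0 else if i = j then lead_coeff (E j) else w j (m + i))" if "i < k" for i j
    using that km E[of j] by (auto simp: I0_def w_def coeff_eq_0 add.commute)
  have "upper_triangular ?M" by (auto simp: upper_triangular_def M)
  moreover have "0 \<notin> set (diag_mat ?M)" using E by (auto simp: diag_mat_def M simp flip: leading_coeff_0_iff)
  ultimately have "minor k w I0 \<noteq> 0"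
    unfolding minor_def using upper_triangular_imp_det_eq_0_iff[of ?M k] by auto
  from primitive_tensor[of N n k "minor k w", OF N minor_tensor[OF T] _ km(2) I0 this]
  show ?thesis using minor_pluecker[of n k' w] km k' by (intro exI[of _ k']) auto
qed

section \<open>Extension of homomorphisms: places and derivations\<close>

lemma poly_eq_sum:
  fixes p :: "'a::comm_semiring_1 poly"
  assumes "degree p \<le> n"
  shows "poly p x = (\<Sum>i\<le>n. coeff p i * x ^ i)"
  unfolding poly_altdef by (rule sum.mono_neutral_left) (use assms in \<open>auto simp: coeff_eq_0\<close>)

text \<open>The domain is kept apart from a total function, so that homomorphisms on growing
  subrings of one type can be ordered by extension; values outside \<open>E\<close> are
  arbitrary.\<close>

definition hom_on :: "'a::comm_ring_1 set \<Rightarrow> ('a \<Rightarrow> 'b::comm_ring_1) \<Rightarrow> bool" where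
  "hom_on E \<phi> \<longleftrightarrow> 1 \<in> E \<and> \<phi> 1 = 1 \<and> (\<forall>x\<in>E. - x \<in> E) \<and>
    (\<forall>x\<in>E. \<forall>y\<in>E. x + y \<in> E \<and> x * y \<in> E \<and> \<phi> (x + y) = \<phi> x + \<phi> y \<and> \<phi> (x * y) = \<phi> x * \<phi> y)"

definition polys_over :: "'a::zero set \<Rightarrow> 'a poly set" where
  "polys_over E = {p. \<forall>i. coeff p i \<in> E}"

context
  fixes E :: "'a::comm_ring_1 set" and \<phi> :: "'a \<Rightarrow> 'b::comm_ring_1"
  assumes hom: "hom_on E \<phi>"
begin

lemma hom_on_1: "1 \<in> E" "\<phi> 1 = 1"
  using hom by (auto simp: hom_on_def)

lemma hom_on_add: "x \<in> E \<Longrightarrow> y \<in> E \<Longrightarrow> x + y \<in> E" "x \<in> E \<Longrightarrow> y \<in> E \<Longrightarrow> \<phi> (x + y) = \<phi> x + \<phi> y"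
  using hom by (auto simp: hom_on_def)

lemma hom_on_mult: "x \<in> E \<Longrightarrow> y \<in> E \<Longrightarrow> x * y \<in> E" "x \<in> E \<Longrightarrow> y \<in> E \<Longrightarrow> \<phi> (x * y) = \<phi> x * \<phi> y"
  using hom by (auto simp: hom_on_def)

lemma hom_on_0: "0 \<in> E" "\<phi> 0 = 0"
proof -
  show 0: "0 \<in> E" using hom hom_on_add(1)[of 1 "- 1"] by (auto simp: hom_on_def)
  show "\<phi> 0 = 0" using hom_on_add(2)[OF 0 0] by simp
qed

lemma hom_on_minus: "x \<in> E \<Longrightarrow> - x \<in> E" "x \<in> E \<Longrightarrow> \<phi> (- x) = - \<phi> x"
proof -
  show *: "- x \<in> E" if "x \<in> E" for x using hom that by (auto simp: hom_on_def)
  assume "x \<in> E"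
  then show "\<phi> (- x) = - \<phi> x"
    using hom_on_add(2)[of x "- x"] * hom_on_0 by (simp add: eq_neg_iff_add_eq_0 add.commute)
qed

lemma hom_on_power: "x \<in> E \<Longrightarrow> x ^ n \<in> E" "x \<in> E \<Longrightarrow> \<phi> (x ^ n) = \<phi> x ^ n"
proof -
  show *: "x ^ n \<in> E" if "x \<in> E" for x n
    using that by (induction n) (auto simp: hom_on_1 hom_on_mult)
  show "\<phi> (x ^ n) = \<phi> x ^ n" if "x \<in> E"
    using that by (induction n) (auto simp: hom_on_1 hom_on_mult *)
qed

lemma hom_on_sum:
  "(\<And>i. i \<in> A \<Longrightarrow> f i \<in> E) \<Longrightarrow> (\<Sum>i\<in>A. f i) \<in> E"
  "(\<And>i. i \<in> A \<Longrightarrow> f i \<in> E) \<Longrightarrow> \<phi> (\<Sum>i\<in>A. f i) = (\<Sum>i\<in>A. \<phi> (f i))"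
proof -
  have "(\<forall>i\<in>A. f i \<in> E) \<longrightarrow> (\<Sum>i\<in>A. f i) \<in> E \<and> \<phi> (\<Sum>i\<in>A. f i) = (\<Sum>i\<in>A. \<phi> (f i))"
    by (induction A rule: infinite_finite_induct) (auto simp: hom_on_0 hom_on_add)
  then show "(\<And>i. i \<in> A \<Longrightarrow> f i \<in> E) \<Longrightarrow> (\<Sum>i\<in>A. f i) \<in> E"
    "(\<And>i. i \<in> A \<Longrightarrow> f i \<in> E) \<Longrightarrow> \<phi> (\<Sum>i\<in>A. f i) = (\<Sum>i\<in>A. \<phi> (f i))" by auto
qed

lemma hom_on_of_nat: "of_nat n \<in> E" "\<phi> (of_nat n) = of_nat n"
  by (induction n) (auto simp: hom_on_0 hom_on_1 hom_on_add)

lemma polys_over_0: "0 \<in> polys_over E"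
  by (simp add: polys_over_def hom_on_0)

lemma polys_over_pCons: "a \<in> E \<Longrightarrow> p \<in> polys_over E \<Longrightarrow> pCons a p \<in> polys_over E"
  by (auto simp: polys_over_def coeff_pCons split: nat.splits)

lemma polys_over_add: "p \<in> polys_over E \<Longrightarrow> q \<in> polys_over E \<Longrightarrow> p + q \<in> polys_over E"
  by (auto simp: polys_over_def hom_on_add)

lemma polys_over_minus: "p \<in> polys_over E \<Longrightarrow> - p \<in> polys_over E"
  by (auto simp: polys_over_def hom_on_minus)

lemma polys_over_diff: "p \<in> polys_over E \<Longrightarrow> q \<in> polys_over E \<Longrightarrow> p - q \<in> polys_over E"
  using polys_over_add[of p "- q"] polys_over_minus[of q] by simp

lemma polys_over_mult: "p \<in> polys_over E \<Longrightarrow> q \<in> polys_over E \<Longrightarrow> p * q \<in> polys_over E"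
  by (auto simp: polys_over_def coeff_mult intro!: hom_on_sum hom_on_mult)

lemma polys_over_monom: "a \<in> E \<Longrightarrow> monom a k \<in> polys_over E"
  by (auto simp: polys_over_def hom_on_0)

lemma polys_over_smult: "a \<in> E \<Longrightarrow> p \<in> polys_over E \<Longrightarrow> smult a p \<in> polys_over E"
  by (auto simp: polys_over_def hom_on_mult)

lemma polys_over_power: "p \<in> polys_over E \<Longrightarrow> p ^ k \<in> polys_over E"
  using polys_over_pCons[OF hom_on_1(1) polys_over_0]
  by (induction k) (simp_all add: polys_over_mult one_pCons)

lemma polys_over_sum: "(\<And>i. i \<in> A \<Longrightarrow> f i \<in> polys_over E) \<Longrightarrow> (\<Sum>i\<in>A. f i) \<in> polys_over E"
  by (induction A rule: infinite_finite_induct) (auto simp: polys_over_add polys_over_0)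

lemma coeff_map_hom: "coeff (map_poly \<phi> p) i = \<phi> (coeff p i)"
  by (simp add: coeff_map_poly hom_on_0)

lemma map_poly_hom_add:
  "p \<in> polys_over E \<Longrightarrow> q \<in> polys_over E \<Longrightarrow> map_poly \<phi> (p + q) = map_poly \<phi> p + map_poly \<phi> q"
  by (rule poly_eqI) (simp add: coeff_map_hom hom_on_add polys_over_def)

lemma map_poly_hom_minus: "p \<in> polys_over E \<Longrightarrow> map_poly \<phi> (- p) = - map_poly \<phi> p"
  by (rule poly_eqI) (simp add: coeff_map_hom hom_on_minus polys_over_def)

lemma map_poly_hom_diff:
  "p \<in> polys_over E \<Longrightarrow> q \<in> polys_over E \<Longrightarrow> map_poly \<phi> (p - q) = map_poly \<phi> p - map_poly \<phi> q"
  using map_poly_hom_add[of p "- q"] by (simp add: polys_over_minus map_poly_hom_minus)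

lemma map_poly_hom_mult:
  assumes "p \<in> polys_over E" "q \<in> polys_over E"
  shows "map_poly \<phi> (p * q) = map_poly \<phi> p * map_poly \<phi> q"
proof (rule poly_eqI)
  fix i
  have "\<phi> (\<Sum>j\<le>i. coeff p j * coeff q (i - j)) = (\<Sum>j\<le>i. \<phi> (coeff p j * coeff q (i - j)))"
    by (rule hom_on_sum(2)) (use assms in \<open>auto simp: polys_over_def intro: hom_on_mult\<close>)
  then show "coeff (map_poly \<phi> (p * q)) i = coeff (map_poly \<phi> p * map_poly \<phi> q) i"
    using assms by (simp add: coeff_map_hom coeff_mult hom_on_mult polys_over_def)
qed

lemma map_poly_hom_monom: "map_poly \<phi> (monom a k) = monom (\<phi> a) k"
  by (rule poly_eqI) (simp add: coeff_map_hom hom_on_0)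

lemma map_poly_hom_const: "map_poly \<phi> [:a:] = [:\<phi> a:]"
  by (simp add: map_poly_pCons hom_on_0)

lemma map_poly_hom_1: "map_poly \<phi> 1 = 1"
  by (rule poly_eqI) (simp add: coeff_map_hom hom_on_0 hom_on_1)

lemma map_poly_hom_power: "p \<in> polys_over E \<Longrightarrow> map_poly \<phi> (p ^ k) = map_poly \<phi> p ^ k"
  by (induction k) (auto simp: map_poly_hom_1 map_poly_hom_mult polys_over_power)

lemma map_poly_hom_sum:
  "(\<And>i. i \<in> A \<Longrightarrow> f i \<in> polys_over E) \<Longrightarrow> map_poly \<phi> (\<Sum>i\<in>A. f i) = (\<Sum>i\<in>A. map_poly \<phi> (f i))"
  by (induction A rule: infinite_finite_induct)
    (auto simp: map_poly_hom_add polys_over_sum)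

end

lemma polys_over_pderiv:
  fixes \<phi> :: "'a::idom \<Rightarrow> 'b::comm_ring_1"
  assumes "hom_on E \<phi>" "p \<in> polys_over E"
  shows "pderiv p \<in> polys_over E"
  using assms(2) unfolding polys_over_def mem_Collect_eq coeff_pderiv
  by (intro allI hom_on_mult[OF assms(1)] hom_on_of_nat[OF assms(1)]) auto

lemma map_poly_hom_pderiv:
  fixes \<phi> :: "'a::idom \<Rightarrow> 'b::idom"
  assumes hom: "hom_on E \<phi>" and "p \<in> polys_over E"
  shows "map_poly \<phi> (pderiv p) = pderiv (map_poly \<phi> p)"
proof (rule poly_eqI)
  fix i
  have "\<phi> (of_nat (Suc i) * coeff p (Suc i)) = of_nat (Suc i) * \<phi> (coeff p (Suc i))"
    using assms hom_on_mult(2)[OF hom hom_on_of_nat(1)[OF hom]] hom_on_of_nat(2)[OF hom]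
    by (simp add: polys_over_def del: of_nat_Suc)
  then show "coeff (map_poly \<phi> (pderiv p)) i = coeff (pderiv (map_poly \<phi> p)) i"
    by (simp add: coeff_map_hom[OF hom] coeff_pderiv del: of_nat_Suc)
qed

text \<open>The value of p at a is sent to the value at b of the image of p. By
  \<open>compat\<close>, b satisfies the image of every relation of a, which makes this independent
  of the chosen p.\<close>

lemma hom_on_adjoin:
  fixes E :: "'a::comm_ring_1 set" and \<phi> :: "'a \<Rightarrow> 'b::comm_ring_1"
  assumes hom: "hom_on E \<phi>"
    and compat: "\<And>p. p \<in> polys_over E \<Longrightarrow> poly p a = 0 \<Longrightarrow> poly (map_poly \<phi> p) b = 0"
  obtains E' \<psi> where "hom_on E' \<psi>" "E \<subseteq> E'" "\<And>x. x \<in> E \<Longrightarrow> \<psi> x = \<phi> x" "a \<in> E'" "\<psi> a = b"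
    "E' = {poly p a |p. p \<in> polys_over E}"
    "\<And>p. p \<in> polys_over E \<Longrightarrow> \<psi> (poly p a) = poly (map_poly \<phi> p) b"
proof -
  define E' where "E' = {poly p a |p. p \<in> polys_over E}"
  define \<psi> where "\<psi> = (\<lambda>y. poly (map_poly \<phi> (SOME p. p \<in> polys_over E \<and> poly p a = y)) b)"
  have \<psi>: "\<psi> (poly p a) = poly (map_poly \<phi> p) b" if p: "p \<in> polys_over E" for p
  proof -
    define q where "q = (SOME q. q \<in> polys_over E \<and> poly q a = poly p a)"
    have q: "q \<in> polys_over E" "poly q a = poly p a"
      unfolding q_def using someI[of "\<lambda>q. q \<in> polys_over E \<and> poly q a = poly p a" p] p by auto
    have "poly (map_poly \<phi> (q - p)) b = 0"
      by (rule compat) (use p q polys_over_diff[OF hom] in auto)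
    then show ?thesis using p q map_poly_hom_diff[OF hom] by (simp add: \<psi>_def flip: q_def)
  qed
  note P = polys_over_0[OF hom] polys_over_add[OF hom] polys_over_mult[OF hom] polys_over_minus[OF hom]
    polys_over_monom[OF hom] polys_over_pCons[OF hom]
  have E'I: "poly p a \<in> E'" if "p \<in> polys_over E" for p using that by (auto simp: E'_def)
  show ?thesis
  proof
    show "hom_on E' \<psi>" unfolding hom_on_def
    proof (intro conjI ballI)
      show "1 \<in> E'" using E'I[of "[:1:]"] P hom_on_1[OF hom] by auto
      show "\<psi> 1 = 1" using \<psi>[of "[:1:]"] P hom_on_1[OF hom] by (simp add: map_poly_hom_const[OF hom])
      fix x assume "x \<in> E'"
      then obtain p where p: "x = poly p a" "p \<in> polys_over E" by (auto simp: E'_def)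
      show "- x \<in> E'" using E'I[of "- p"] P p by auto
      fix y assume "y \<in> E'"
      then obtain q where q: "y = poly q a" "q \<in> polys_over E" by (auto simp: E'_def)
      show "x + y \<in> E'" using E'I[of "p + q"] P p q by auto
      show "x * y \<in> E'" using E'I[of "p * q"] P p q by auto
      show "\<psi> (x + y) = \<psi> x + \<psi> y" using \<psi>[of "p + q"] \<psi>[of p] \<psi>[of q] P p q map_poly_hom_add[OF hom] by auto
      show "\<psi> (x * y) = \<psi> x * \<psi> y" using \<psi>[of "p * q"] \<psi>[of p] \<psi>[of q] P p q map_poly_hom_mult[OF hom] by auto
    qed
    show "E \<subseteq> E'"
    proof
      fix x assume "x \<in> E" then show "x \<in> E'" using E'I[of "[:x:]"] P by auto
    qed
    show "\<psi> x = \<phi> x" if "x \<in> E" for x using \<psi>[of "[:x:]"] P that by (simp add: map_poly_hom_const[OF hom])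
    have X: "[:0, 1:] \<in> polys_over E" using P hom_on_0[OF hom] hom_on_1[OF hom] by auto
    show "a \<in> E'" using E'I[OF X] by simp
    show "\<psi> a = b" using \<psi>[OF X] hom_on_0[OF hom] hom_on_1[OF hom] by (simp add: map_poly_pCons)
    show "E' = {poly p a |p. p \<in> polys_over E}" by (rule E'_def)
  qed (rule \<psi>)
qed

text \<open>Zorn's lemma for properties that speak of at most two elements at a time: any two
  elements of the union of a chain lie in one member. It serves for graphs of partial homomorphisms
  and for filters.\<close>

lemma Zorn_two_element_closed:
  assumes "good G0"
    and Union: "\<And>C. C \<noteq> {} \<Longrightarrow> (\<And>G. G \<in> C \<Longrightarrow> good G) \<Longrightarrow>
      (\<And>x y. x \<in> \<Union>C \<Longrightarrow> y \<in> \<Union>C \<Longrightarrow> \<exists>G\<in>C. x \<in> G \<and> y \<in> G) \<Longrightarrow> good (\<Union>C)"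
  obtains M where "G0 \<subseteq> M" "good M" "\<And>G. good G \<Longrightarrow> M \<subseteq> G \<Longrightarrow> G = M"
proof -
  let ?A = "{G. G0 \<subseteq> G \<and> good G}"
  have "\<exists>M\<in>?A. \<forall>G\<in>?A. M \<subseteq> G \<longrightarrow> G = M"
  proof (rule subset_Zorn_nonempty)
    show "?A \<noteq> {}" using assms(1) by auto
    fix C assume C: "C \<noteq> {}" "subset.chain ?A C"
    then have C1: "good G" "G0 \<subseteq> G" if "G \<in> C" for G using that by (auto simp: subset_chain_def)
    have C2: "\<exists>G\<in>C. x \<in> G \<and> y \<in> G" if "x \<in> \<Union>C" "y \<in> \<Union>C" for x y
    proof -
      from that obtain G H where GH: "G \<in> C" "x \<in> G" "H \<in> C" "y \<in> H" by blast
      then have "G \<subseteq> H \<or> H \<subseteq> G" using C(2) unfolding subset_chain_def by blast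
      then show ?thesis using GH by blast
    qed
    have "good (\<Union>C)" by (rule Union[OF C(1) C1(1) C2])
    then show "\<Union>C \<in> ?A" using C(1) C1(2) by blast
  qed
  then obtain M where MA: "M \<in> ?A" and maxA: "\<And>G. G \<in> ?A \<Longrightarrow> M \<subseteq> G \<Longrightarrow> G = M" by (elim bexE) simp
  show ?thesis
  proof
    show M: "G0 \<subseteq> M" "good M" using MA by simp_all
    show "G = M" if "good G" "M \<subseteq> G" for G using maxA[of G] order_trans[OF M(1) that(2)] that by simp
  qed
qed

text \<open>Zorn's lemma on graphs, which are subrings of the product of the two rings.
  \<open>Q\<close> is a constraint on single pairs that extensions have to respect: trivial for
  places, and equality of the \<open>re\<close> component with the argument for derivations.\<close>

lemma hom_on_maximal:
  fixes E0 :: "'a::comm_ring_1 set" and \<phi>0 :: "'a \<Rightarrow> 'b::comm_ring_1"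
  assumes hom0: "hom_on E0 \<phi>0" and Q0: "\<And>x. x \<in> E0 \<Longrightarrow> Q x (\<phi>0 x)"
  obtains E \<phi> where "hom_on E \<phi>" "E0 \<subseteq> E" "\<And>x. x \<in> E0 \<Longrightarrow> \<phi> x = \<phi>0 x" "\<And>x. x \<in> E \<Longrightarrow> Q x (\<phi> x)"
    "\<forall>E' \<psi>. hom_on E' \<psi> \<and> E \<subseteq> E' \<and> (\<forall>x\<in>E. \<psi> x = \<phi> x) \<and> (\<forall>x\<in>E'. Q x (\<psi> x)) \<longrightarrow> E' = E"
proof -
  define gr where "gr = (\<lambda>(E::'a set) (\<phi>::'a \<Rightarrow> 'b). (\<lambda>x. (x, \<phi> x)) ` E)"
  define good where "good = (\<lambda>G. (1, 1) \<in> G \<and> (\<forall>x u. (x, u) \<in> G \<longrightarrow> (- x, - u) \<in> G \<and> Q x u) \<and>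
    (\<forall>x u y v. (x, u) \<in> G \<longrightarrow> (y, v) \<in> G \<longrightarrow> (x + y, u + v) \<in> G \<and> (x * y, u * v) \<in> G \<and> (x = y \<longrightarrow> u = v)))"
  have good_gr: "good (gr E \<phi>)" if "hom_on E \<phi>" "\<And>x. x \<in> E \<Longrightarrow> Q x (\<phi> x)" for E \<phi>
    unfolding good_def
  proof (intro conjI allI impI)
    have gr_iff: "(x, u) \<in> gr E \<phi> \<longleftrightarrow> x \<in> E \<and> u = \<phi> x" for x u by (auto simp: gr_def)
    note hom = that(1)
    show "(1, 1) \<in> gr E \<phi>" using hom_on_1[OF hom] by (simp add: gr_iff)
    fix x u assume xu: "(x, u) \<in> gr E \<phi>"
    then show "(- x, - u) \<in> gr E \<phi>" "Q x u" using hom_on_minus[OF hom] that(2) by (auto simp: gr_iff)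
    fix y v assume "(y, v) \<in> gr E \<phi>"
    then show "(x + y, u + v) \<in> gr E \<phi>" "(x * y, u * v) \<in> gr E \<phi>" "x = y \<Longrightarrow> u = v"
      using xu hom_on_add[OF hom] hom_on_mult[OF hom] by (auto simp: gr_iff)
  qed
  have good_Union: "good (\<Union>C)"
    if C: "C \<noteq> {}" and C1: "\<And>G. G \<in> C \<Longrightarrow> good G"
      and C2: "\<And>x y. x \<in> \<Union>C \<Longrightarrow> y \<in> \<Union>C \<Longrightarrow> \<exists>G\<in>C. x \<in> G \<and> y \<in> G" for C
    unfolding good_def
  proof (intro conjI allI impI)
    show "(1, 1) \<in> \<Union>C" using C C1 by (auto simp: good_def)
    fix x u assume xu: "(x, u) \<in> \<Union>C"
    then show "(- x, - u) \<in> \<Union>C" "Q x u" using C1 by (auto simp: good_def)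
    fix y v assume "(y, v) \<in> \<Union>C"
    from C2[OF xu this] obtain G where "G \<in> C" "(x, u) \<in> G" "(y, v) \<in> G" by blast
    with C1[of G] show "(x + y, u + v) \<in> \<Union>C" "(x * y, u * v) \<in> \<Union>C" "x = y \<Longrightarrow> u = v"
      unfolding good_def Union_iff by blast+
  qed
  obtain M where M: "gr E0 \<phi>0 \<subseteq> M" "good M" and max: "\<And>G. good G \<Longrightarrow> M \<subseteq> G \<Longrightarrow> G = M"
    by (rule Zorn_two_element_closed[of good, OF good_gr[OF hom0 Q0] good_Union]) (assumption | rule that)+
  define E where "E = fst ` M"
  define \<phi> where "\<phi> = (\<lambda>x. SOME u. (x, u) \<in> M)"
  have \<phi>: "\<phi> x = u" if "(x, u) \<in> M" for x u
    using someI[of "\<lambda>u. (x, u) \<in> M", OF that] M(2) that by (auto simp: \<phi>_def good_def)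
  have ME: "M = gr E \<phi>"
  proof (intro subset_antisym subsetI)
    fix z assume "z \<in> M"
    then have "\<phi> (fst z) = snd z" by (intro \<phi>) simp
    with \<open>z \<in> M\<close> show "z \<in> gr E \<phi>" unfolding gr_def E_def
      by (intro image_eqI[of _ _ "fst z"] imageI) simp_all
  next
    fix z assume "z \<in> gr E \<phi>"
    then obtain x u where "z = (x, \<phi> x)" "(x, u) \<in> M" by (auto simp: gr_def E_def)
    then show "z \<in> M" using \<phi> by simp
  qed
  have EI: "x \<in> E \<and> \<phi> x = u" if "(x, u) \<in> M" for x u
    using \<phi>[OF that] image_eqI[of x fst "(x, u)" M] that by (auto simp: E_def)
  show ?thesis
  proof
    show "hom_on E \<phi>" unfolding hom_on_def
    proof (intro conjI ballI)
      show "1 \<in> E" "\<phi> 1 = 1" using M(2) EI[of 1 1] by (auto simp: good_def)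
      fix x assume "x \<in> E"
      then obtain u where u: "(x, u) \<in> M" by (auto simp: E_def)
      then have "(- x, - u) \<in> M" using M(2) by (auto simp: good_def)
      then show "- x \<in> E" using EI by blast
      fix y assume "y \<in> E"
      then obtain v where v: "(y, v) \<in> M" by (auto simp: E_def)
      have "(x + y, u + v) \<in> M" "(x * y, u * v) \<in> M" using M(2) u v by (auto simp: good_def)
      then show "x + y \<in> E" "x * y \<in> E" "\<phi> (x + y) = \<phi> x + \<phi> y" "\<phi> (x * y) = \<phi> x * \<phi> y"
        using EI[OF u] EI[OF v] EI[of "x + y" "u + v"] EI[of "x * y" "u * v"] by auto
    qed
    show "E0 \<subseteq> E" using M(1) EI by (auto simp: gr_def)
    show "\<phi> x = \<phi>0 x" if "x \<in> E0" for x using M(1) that by (intro \<phi>) (auto simp: gr_def)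
    show "Q x (\<phi> x)" if "x \<in> E" for x using that M(2) \<phi> by (auto simp: good_def E_def)
    show "\<forall>E' \<psi>. hom_on E' \<psi> \<and> E \<subseteq> E' \<and> (\<forall>x\<in>E. \<psi> x = \<phi> x) \<and> (\<forall>x\<in>E'. Q x (\<psi> x)) \<longrightarrow> E' = E"
    proof (intro allI impI)
      fix E' \<psi> assume "hom_on E' \<psi> \<and> E \<subseteq> E' \<and> (\<forall>x\<in>E. \<psi> x = \<phi> x) \<and> (\<forall>x\<in>E'. Q x (\<psi> x))"
      then have "gr E' \<psi> = M" by (intro max good_gr) (auto simp: ME gr_def)
      then have "fst ` gr E' \<psi> = E" by (simp add: E_def)
      then show "E' = E" by (simp add: gr_def image_image)
    qed
  qed
qed

section \<open>Adjoining inverses; places\<close>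

lemma poly_reflect_sum:
  fixes a :: "'a::field"
  assumes "a \<noteq> 0" "poly p (inverse a) = 0"
  shows "(\<Sum>i\<le>degree p. coeff p i * a ^ (degree p - i)) = 0"
proof -
  have "(\<Sum>i\<le>degree p. coeff p i * a ^ (degree p - i)) = a ^ degree p * poly p (inverse a)"
    unfolding poly_altdef sum_distrib_left
    by (intro sum.cong) (use assms in \<open>auto simp: power_diff power_inverse field_simps\<close>)
  then show ?thesis using assms by simp
qed

lemma hom_on_compat_inverse:
  fixes E :: "'a::field set" and \<phi> :: "'a \<Rightarrow> 'b::comm_ring_1"
  assumes hom: "hom_on E \<phi>" and a: "a \<in> E" and u: "\<phi> a * u = 1"
    and p: "p \<in> polys_over E" "poly p (inverse a) = 0"
  shows "poly (map_poly \<phi> p) u = 0"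
proof -
  let ?d = "degree p"
  have a0: "a \<noteq> 0" using u hom_on_0[OF hom] by auto
  have pE: "coeff p i \<in> E" for i using p by (auto simp: polys_over_def)
  have "(\<Sum>i\<le>?d. \<phi> (coeff p i) * \<phi> a ^ (?d - i)) = \<phi> (\<Sum>i\<le>?d. coeff p i * a ^ (?d - i))"
    by (subst hom_on_sum(2)[OF hom])
      (auto simp: hom_on_mult[OF hom] hom_on_power[OF hom] a pE)
  also have "\<dots> = 0" using poly_reflect_sum[OF a0 p(2)] hom_on_0[OF hom] by simp
  finally have 0: "(\<Sum>i\<le>?d. \<phi> (coeff p i) * \<phi> a ^ (?d - i)) = 0" .
  have "poly (map_poly \<phi> p) u = (\<Sum>i\<le>?d. \<phi> (coeff p i) * u ^ i)"
    using poly_eq_sum[of "map_poly \<phi> p" ?d u]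
    by (simp add: coeff_map_hom[OF hom] degree_le coeff_eq_0 hom_on_0[OF hom])
  also have "\<dots> = (\<Sum>i\<le>?d. \<phi> (coeff p i) * \<phi> a ^ (?d - i)) * u ^ ?d"
    unfolding sum_distrib_right
  proof (intro sum.cong refl)
    fix i assume "i \<in> {..?d}"
    then have "u ^ ?d = u ^ (?d - i) * u ^ i" by (simp flip: power_add)
    then have "\<phi> a ^ (?d - i) * u ^ ?d = (\<phi> a * u) ^ (?d - i) * u ^ i"
      by (simp add: power_mult_distrib mult.assoc)
    then show "\<phi> (coeff p i) * u ^ i = \<phi> (coeff p i) * \<phi> a ^ (?d - i) * u ^ ?d"
      by (simp add: u mult.assoc)
  qed
  finally show ?thesis using 0 by simp
qed

lemma degree_cancel_less:
  fixes f g :: "'a::field poly"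
  assumes "f \<noteq> 0" "g \<noteq> 0" "degree g \<le> degree f" "c = lead_coeff f / lead_coeff g"
  shows "f - monom c (degree f - degree g) * g = 0 \<or>
    degree (f - monom c (degree f - degree g) * g) < degree f"
proof -
  let ?h = "monom c (degree f - degree g) * g"
  have c: "c \<noteq> 0" using assms by auto
  have "degree ?h = degree f" "lead_coeff ?h = lead_coeff f"
    using assms c lead_coeff_mult[of "monom c (degree f - degree g)" g]
    by (auto simp: degree_mult_eq degree_monom_eq)
  then show ?thesis
    by (metis cancel_comm_monoid_add_class.diff_cancel coeff_diff degree_diff_le leading_coeff_0_iff le_neq_implies_less order_refl)
qed

text \<open>Chevalley: a maximal partial homomorphism into an algebraically closed field is a place. If
  neither $x$ nor $x^{-1}$ can be adjoined, both satisfy an equation whose image is $1 = 0$, and two such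
  equations of minimal degree reduce each other.\<close>

lemma place_exists:
  fixes E0 :: "'a::field set" and \<phi>0 :: "'a \<Rightarrow> 'b::alg_closed_field"
  assumes hom0: "hom_on E0 \<phi>0"
  obtains E \<phi> where "hom_on E \<phi>" "E0 \<subseteq> E" "\<And>x. x \<in> E0 \<Longrightarrow> \<phi> x = \<phi>0 x"
    "\<And>x. x \<notin> E \<Longrightarrow> inverse x \<in> E \<and> \<phi> (inverse x) = 0"
proof -
  obtain E \<phi> where hom: "hom_on E \<phi>" and ext: "E0 \<subseteq> E" "\<And>x. x \<in> E0 \<Longrightarrow> \<phi> x = \<phi>0 x"
    and max: "\<forall>E' \<psi>. hom_on E' \<psi> \<and> E \<subseteq> E' \<and> (\<forall>x\<in>E. \<psi> x = \<phi> x) \<and> (\<forall>x\<in>E'. True) \<longrightarrow> E' = E"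
    by (rule hom_on_maximal[OF hom0, of "\<lambda>_ _. True"]) (assumption | rule that TrueI)+
  have adj: "a \<in> E" if compat: "\<And>p. p \<in> polys_over E \<Longrightarrow> poly p a = 0 \<Longrightarrow> poly (map_poly \<phi> p) b = 0" for a b
  proof -
    obtain E' \<psi> where *: "hom_on E' \<psi>" "E \<subseteq> E'" "\<And>x. x \<in> E \<Longrightarrow> \<psi> x = \<phi> x" "a \<in> E'"
      by (rule hom_on_adjoin[OF hom compat]) blast+
    with max show ?thesis by auto
  qed
  \<comment> \<open>\<open>E\<close> is a local ring: elements with nonzero image are units in
    it.\<close>
  have inv: "inverse a \<in> E" "\<phi> (inverse a) = inverse (\<phi> a)" if "a \<in> E" "\<phi> a \<noteq> 0" for a
  proof -
    show 1: "inverse a \<in> E"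
      by (rule adj[of _ "inverse (\<phi> a)"], rule hom_on_compat_inverse[OF hom that(1)]) (use that in auto)
    have "a \<noteq> 0" using that hom_on_0[OF hom] by auto
    then have "\<phi> a * \<phi> (inverse a) = 1"
      using hom_on_mult(2)[OF hom that(1) 1] hom_on_1[OF hom] by simp
    then show "\<phi> (inverse a) = inverse (\<phi> a)" using that by (simp add: field_simps)
  qed
  \<comment> \<open>Relations of x whose image is the constant 1. Such a relation excludes every
    value for x.\<close>
  define V where "V = (\<lambda>x. {q \<in> polys_over E. poly q x = 0 \<and> map_poly \<phi> q = 1})"
  have V: "\<exists>q. q \<in> V x" if x: "x \<notin> E" for x
  proof -
    define I where "I = {p \<in> polys_over E. poly p x = 0}"
    have no_root: "\<exists>p\<in>I. poly (map_poly \<phi> p) b \<noteq> 0" for b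
      using adj[of x b] x by (auto simp: I_def)
    then obtain p0 where p0: "p0 \<in> I" "map_poly \<phi> p0 \<noteq> 0" by (metis poly_0)
    obtain q where q: "q \<in> I" "map_poly \<phi> q \<noteq> 0"
      and min: "\<And>p. p \<in> I \<Longrightarrow> map_poly \<phi> p \<noteq> 0 \<Longrightarrow> degree (map_poly \<phi> q) \<le> degree (map_poly \<phi> p)"
      using ex_has_least_nat[of "\<lambda>p. p \<in> I \<and> map_poly \<phi> p \<noteq> 0" p0 "\<lambda>p. degree (map_poly \<phi> p)"] p0 by auto
    let ?g = "map_poly \<phi> q" let ?d = "degree ?g"
    have qE: "coeff q i \<in> E" for i using q by (auto simp: I_def polys_over_def)
    have lq: "\<phi> (coeff q ?d) \<noteq> 0"
      using q(2) coeff_map_hom[OF hom, of q] by (metis leading_coeff_0_iff)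
    \<comment> \<open>Division by \<open>q\<close> can be carried out over \<open>E\<close>, since
      the coefficient of \<open>q\<close> at the degree of its image is a unit. Hence a root of the
      image of \<open>q\<close> would be an admissible value for x, and none exists; so the image of
      \<open>q\<close> is constant.\<close>
    have dvd: "?g dvd map_poly \<phi> p" if "p \<in> I" for p
      using that
    proof (induction "degree (map_poly \<phi> p)" arbitrary: p rule: less_induct)
      case less
      let ?f = "map_poly \<phi> p" let ?m = "degree (map_poly \<phi> p)"
      show ?case
      proof (cases "?f = 0")
        case False
        have pE: "coeff p i \<in> E" for i using less.prems by (auto simp: I_def polys_over_def)
        define c where "c = coeff p ?m * inverse (coeff q ?d)"
        have cE: "c \<in> E" unfolding c_def by (intro hom_on_mult[OF hom] pE inv qE lq)
        have \<phi>c: "\<phi> c = lead_coeff ?f / lead_coeff ?g"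
          unfolding c_def using hom_on_mult(2)[OF hom pE inv(1)[OF qE lq]] inv(2)[OF qE lq]
          by (simp add: coeff_map_hom[OF hom] divide_inverse)
        define p' where "p' = p - monom c (?m - ?d) * q"
        have mE: "monom c (?m - ?d) * q \<in> polys_over E"
          using q cE by (auto simp: I_def intro!: polys_over_mult[OF hom] polys_over_monom[OF hom])
        have p': "p' \<in> I" using less.prems q mE by (auto simp: p'_def I_def intro!: polys_over_diff[OF hom])
        have f': "map_poly \<phi> p' = ?f - monom (\<phi> c) (?m - ?d) * ?g"
          unfolding p'_def using less.prems q mE cE
          by (simp add: map_poly_hom_diff[OF hom] map_poly_hom_mult[OF hom] map_poly_hom_monom[OF hom]
              polys_over_monom[OF hom] I_def)
        have "map_poly \<phi> p' = 0 \<or> degree (map_poly \<phi> p') < ?m"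
          unfolding f' by (rule degree_cancel_less[OF False q(2) min[OF less.prems False] \<phi>c])
        then have "?g dvd map_poly \<phi> p'" using less.hyps p' by auto
        then have "?g dvd map_poly \<phi> p' + monom (\<phi> c) (?m - ?d) * ?g" by simp
        then show ?thesis unfolding f' by simp
      qed simp
    qed
    have "?d = 0"
    proof (rule ccontr)
      assume "?d \<noteq> 0"
      then obtain b where "poly ?g b = 0" using alg_closed_imp_poly_has_root[of ?g] by auto
      then have "poly (map_poly \<phi> p) b = 0" if "p \<in> I" for p
        using dvd[OF that] by (auto elim!: dvdE)
      then show False using no_root by blast
    qed
    then have c: "coeff q 0 \<in> E" "\<phi> (coeff q 0) \<noteq> 0" using qE lq by auto
    let ?q = "smult (inverse (coeff q 0)) q"
    have "map_poly \<phi> ?q = 1"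
    proof (rule poly_eqI)
      fix i
      have "\<phi> (coeff q i) = 0" if "i > 0"
        using \<open>?d = 0\<close> that coeff_eq_0[of ?g i] by (simp add: coeff_map_hom[OF hom])
      then show "coeff (map_poly \<phi> ?q) i = coeff 1 i"
        using hom_on_mult(2)[OF hom inv(1)[OF c] qE] inv(2)[OF c] c(2)
        by (cases "i = 0") (auto simp: coeff_map_hom[OF hom])
    qed
    moreover have "?q \<in> polys_over E" "poly ?q x = 0"
      using q inv(1)[OF c] by (auto simp: I_def polys_over_smult[OF hom])
    ultimately show ?thesis unfolding V_def by blast
  qed
  have descent: "\<exists>q'\<in>V x. degree q' < degree q"
    if q: "q \<in> V x" and r: "r \<in> V (inverse x)" and le: "degree r \<le> degree q" and x0: "x \<noteq> 0" for x q r
  proof -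
    let ?m = "degree q" and ?s = "degree r"
    have qE: "coeff q i \<in> E" and rE: "coeff r i \<in> E" for i using q r by (auto simp: V_def polys_over_def)
    have \<phi>q: "\<phi> (coeff q i) = (if i = 0 then 1 else 0)" for i
      using q coeff_map_hom[OF hom, of q i] by (auto simp: V_def)
    have \<phi>r: "\<phi> (coeff r i) = (if i = 0 then 1 else 0)" for i
      using r coeff_map_hom[OF hom, of r i] by (auto simp: V_def)
    have m: "?m > 0"
    proof (rule ccontr)
      assume "\<not> ?m > 0"
      then have "q = [:coeff q 0:]" by (auto elim: degree_eq_zeroE)
      then have "coeff q 0 = 0" using q by (auto simp: V_def) (metis add.right_neutral mult_zero_right poly_0 poly_pCons)
      then show False using \<phi>q[of 0] hom_on_0[OF hom] by simp
    qed
    have r0: "coeff r 0 \<noteq> 0" using \<phi>r[of 0] hom_on_0[OF hom] by auto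
    define c where "c = coeff q ?m * inverse (coeff r 0)"
    have ir: "inverse (coeff r 0) \<in> E" by (rule inv) (auto simp: rE \<phi>r)
    have cE: "c \<in> E" unfolding c_def by (intro hom_on_mult[OF hom] qE ir)
    have \<phi>c: "\<phi> c = 0" unfolding c_def using hom_on_mult(2)[OF hom qE ir] \<phi>q m by simp
    \<comment> \<open>A shifted reversal of \<open>r\<close>, which vanishes at x as
      \<open>r\<close> vanishes at 1/x. Its top coefficient cancels that of \<open>q\<close> because
      \<open>coeff r 0\<close> is a unit, and as \<phi> c = 0 the image of q - h is still 1.\<close>
    define h where "h = monom c (?m - ?s) * reflect_poly r"
    have rrE: "reflect_poly r \<in> polys_over E"
      by (auto simp: polys_over_def coeff_reflect_poly rE hom_on_0[OF hom])
    have hE: "h \<in> polys_over E" unfolding h_def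
      by (intro polys_over_mult[OF hom] polys_over_monom[OF hom] cE rrE)
    have h0: "poly h x = 0" using r x0 by (simp add: h_def poly_reflect_poly_nz V_def)
    have \<phi>h: "map_poly \<phi> h = 0"
      by (simp add: h_def map_poly_hom_mult[OF hom polys_over_monom[OF hom cE] rrE] map_poly_hom_monom[OF hom] \<phi>c)
    have qh: "q - h \<in> V x"
      using q h0 \<phi>h hE map_poly_hom_diff[OF hom _ hE, of q] by (auto simp: V_def polys_over_diff[OF hom])
    have cm: "coeff h ?m = coeff q ?m"
      using le r0 coeff_monom_mult[of c "?m - ?s" "reflect_poly r" ?m]
      by (simp add: h_def coeff_reflect_poly c_def)
    have dh: "coeff h i = 0" if "i > ?m" for i
      using le that coeff_monom_mult[of c "?m - ?s" "reflect_poly r" i]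
      by (simp add: h_def coeff_reflect_poly)
    have "degree (q - h) \<le> ?m - 1"
    proof (rule degree_le, intro allI impI)
      fix i assume "?m - 1 < i"
      then show "coeff (q - h) i = 0" using cm dh by (cases "i = ?m") (auto simp: coeff_eq_0)
    qed
    then show ?thesis using qh m by (intro bexI[of _ "q - h"]) auto
  qed
  show ?thesis
  proof (rule that[OF hom ext])
    fix x assume x: "x \<notin> E"
    have x0: "x \<noteq> 0" using x hom_on_0[OF hom] by auto
    have "inverse x \<in> E"
    proof (rule ccontr)
      assume nx: "inverse x \<notin> E"
      obtain q where q: "q \<in> V x" "\<And>q'. q' \<in> V x \<Longrightarrow> degree q \<le> degree q'"
        using V[OF x] ex_has_least_nat[of "\<lambda>q. q \<in> V x" _ degree] by blast
      obtain r where r: "r \<in> V (inverse x)" "\<And>q'. q' \<in> V (inverse x) \<Longrightarrow> degree r \<le> degree q'"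
        using V[OF nx] ex_has_least_nat[of "\<lambda>q. q \<in> V (inverse x)" _ degree] by blast
      show False
      proof (cases "degree r \<le> degree q")
        case True
        from descent[OF q(1) r(1) True x0] q(2) show False by force
      next
        case False
        then have "degree q \<le> degree r" "q \<in> V (inverse (inverse x))" using q by auto
        from descent[OF r(1) this(2,1)] x0 r(2) show False by force
      qed
    qed
    moreover have "\<phi> (inverse x) = 0" using inv(1)[OF calculation] x by auto
    ultimately show "inverse x \<in> E \<and> \<phi> (inverse x) = 0" ..
  qed
qed

text \<open>A derivation \<open>d\<close> is the same as the homomorphism $x \mapsto x + \varepsilon\, d(x)$ into the dual
  numbers.\<close>

datatype 'a dual_number = Dual (re: 'a) (du: 'a)

instantiation dual_number :: (comm_ring_1) comm_ring_1
begin

definition "0 = Dual 0 0"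
definition "1 = Dual 1 0"
definition "x + y = Dual (re x + re y) (du x + du y)"
definition "x - y = Dual (re x - re y) (du x - du y)"
definition "- x = Dual (- re x) (- du x)"
definition "x * y = Dual (re x * re y) (re x * du y + du x * re y)"

instance
  by standard
    (auto simp: zero_dual_number_def one_dual_number_def plus_dual_number_def minus_dual_number_def
      uminus_dual_number_def times_dual_number_def algebra_simps)

end

lemma dual_number_simps [simp]:
  "re 0 = 0" "re 1 = 1" "re (x + y) = re x + re y" "re (- x) = - re x" "re (x - y) = re x - re y"
  "re (x * y) = re x * re y" "du 0 = 0" "du 1 = 0" "du (x + y) = du x + du y" "du (- x) = - du x"
  "du (x - y) = du x - du y" "du (x * y) = re x * du y + du x * re y"
  for x y :: "'a::comm_ring_1 dual_number"
  by (auto simp: zero_dual_number_def one_dual_number_def plus_dual_number_def minus_dual_number_def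
      uminus_dual_number_def times_dual_number_def)

lemma re_poly: "re (poly P y) = poly (map_poly re P) (re y)"
  by (induction P) (auto simp: map_poly_pCons)

text \<open>First-order Taylor expansion: the derivative assigned to a enters linearly, with the
  value of the formal derivative at a as its coefficient.\<close>

lemma du_poly_Dual:
  "du (poly P (Dual a b)) = du (poly P (Dual a 0)) + b * poly (pderiv (map_poly re P)) a"
  by (induction P) (auto simp: map_poly_pCons pderiv_pCons re_poly algebra_simps)

text \<open>A transcendental N may be given any derivative, here 1. The homomorphism into the dual
  numbers is then extended maximally. In characteristic zero nothing remains outside its domain: an
  element can be given derivative 0 if it is transcendental, and otherwise the derivative forced by
  its minimal polynomial.\<close>

lemma derivation_exists:
  fixes e :: "'r::idom \<Rightarrow> 'a::field_char_0"
  assumes e: "e 1 = 1" "\<And>x y. e (x + y) = e x + e y" "\<And>x y. e (x * y) = e x * e y"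
    and tr: "\<And>p. p \<noteq> 0 \<Longrightarrow> poly (map_poly e p) N \<noteq> 0"
  obtains d where "\<And>x y. d (x + y) = d x + d y" "\<And>x y. d (x * y) = d x * y + x * d y"
    "\<And>r. d (e r) = 0" "d N = 1"
proof -
  let ?Q = "\<lambda>x y. re y = (x :: 'a)"
  have e0: "e 0 = 0" using e(2)[of 0 0] by simp
  have em: "e (- x) = - e x" for x using e(2)[of x "- x"] e0 by (simp add: eq_neg_iff_add_eq_0 add.commute)
  define \<phi>0 where "\<phi>0 = (\<lambda>x::'a. Dual x 0)"
  have hom0: "hom_on (range e) \<phi>0" unfolding hom_on_def
  proof (intro conjI ballI)
    fix x y assume "x \<in> range e" "y \<in> range e"
    then obtain x' y' where "x = e x'" "y = e y'" by auto
    then show "x + y \<in> range e" "x * y \<in> range e" by (auto simp flip: e)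
  qed (auto simp: \<phi>0_def plus_dual_number_def times_dual_number_def one_dual_number_def
      intro: range_eqI[of _ e, OF e(1)[symmetric]] range_eqI[of _ e, OF em[symmetric]])
  have Q_adj: "?Q x (\<psi> x)"
    if "hom_on E \<phi>" "\<And>x. x \<in> E \<Longrightarrow> ?Q x (\<phi> x)" "re b = a"
      "x \<in> {poly p a |p. p \<in> polys_over E}" "\<And>p. p \<in> polys_over E \<Longrightarrow> \<psi> (poly p a) = poly (map_poly \<phi> p) b"
    for E \<phi> \<psi> a b x
  proof -
    from that(4) obtain p where p: "p \<in> polys_over E" "x = poly p a" by blast
    have "map_poly re (map_poly \<phi> p) = p"
      by (rule poly_eqI) (use p that(2) hom_on_0[OF that(1)] in \<open>auto simp: coeff_map_poly polys_over_def\<close>)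
    then show ?thesis using that p by (simp add: re_poly)
  qed
  have compat: "poly (map_poly \<phi>0 p) (Dual N 1) = 0" if p: "p \<in> polys_over (range e)" "poly p N = 0" for p
  proof -
    define p' where "p' = map_poly (\<lambda>x. if x = 0 then 0 else SOME r. e r = x) p"
    have "map_poly e p' = p"
    proof (rule poly_eqI)
      fix i
      have "coeff p i \<in> range e" using p by (simp add: polys_over_def)
      then obtain r where "e r = coeff p i" by (metis rangeE)
      then have "e (SOME r. e r = coeff p i) = coeff p i" by (rule someI)
      then show "coeff (map_poly e p') i = coeff p i" by (simp add: p'_def coeff_map_poly e0)
    qed
    with tr[of p'] p have "p' = 0" by auto
    with \<open>map_poly e p' = p\<close> show ?thesis by simp
  qed
  obtain E1 \<phi>1 where 1: "hom_on E1 \<phi>1" "range e \<subseteq> E1" "\<And>x. x \<in> range e \<Longrightarrow> \<phi>1 x = \<phi>0 x" "N \<in> E1"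
      "\<phi>1 N = Dual N 1" "E1 = {poly p N |p. p \<in> polys_over (range e)}"
      "\<And>p. p \<in> polys_over (range e) \<Longrightarrow> \<phi>1 (poly p N) = poly (map_poly \<phi>0 p) (Dual N 1)"
    by (rule hom_on_adjoin[OF hom0 compat]) (assumption | rule that)+
  have Q1: "?Q x (\<phi>1 x)" if "x \<in> E1" for x
    by (rule Q_adj[OF hom0, where b="Dual N 1"]) (use 1 that in \<open>auto simp: \<phi>0_def\<close>)
  obtain E \<phi> where hom: "hom_on E \<phi>" and ext: "E1 \<subseteq> E" "\<And>x. x \<in> E1 \<Longrightarrow> \<phi> x = \<phi>1 x"
    and Q: "\<And>x. x \<in> E \<Longrightarrow> ?Q x (\<phi> x)"
    and max: "\<forall>E' \<psi>. hom_on E' \<psi> \<and> E \<subseteq> E' \<and> (\<forall>x\<in>E. \<psi> x = \<phi> x) \<and> (\<forall>x\<in>E'. ?Q x (\<psi> x)) \<longrightarrow> E' = E"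
    by (rule hom_on_maximal[OF 1(1), of ?Q, OF Q1]) (assumption | rule that)+
  have adj: "a \<in> E" if c: "\<And>p. p \<in> polys_over E \<Longrightarrow> poly p a = 0 \<Longrightarrow> poly (map_poly \<phi> p) b = 0" and b: "re b = a" for a b
  proof -
    obtain E' \<psi> where *: "hom_on E' \<psi>" "E \<subseteq> E'" "\<And>x. x \<in> E \<Longrightarrow> \<psi> x = \<phi> x" "a \<in> E'" "\<psi> a = b"
      "E' = {poly p a |p. p \<in> polys_over E}"
      "\<And>p. p \<in> polys_over E \<Longrightarrow> \<psi> (poly p a) = poly (map_poly \<phi> p) b"
      by (rule hom_on_adjoin[OF hom c]) blast+
    have "E' = E"
      by (rule max[rule_format]) (use Q_adj[OF hom Q b _ *(7)] *(1-3,6) in auto)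
    with *(4) show ?thesis by simp
  qed
  \<comment> \<open>The second component is the quotient rule d(1/x) = - d(x) / x^2.\<close>
  have inv: "inverse x \<in> E" if x: "x \<in> E" "x \<noteq> 0" for x
  proof (rule adj[of _ "Dual (inverse x) (- du (\<phi> x) / (x * x))"])
    fix p assume "p \<in> polys_over E" "poly p (inverse x) = 0"
    then show "poly (map_poly \<phi> p) (Dual (inverse x) (- du (\<phi> x) / (x * x))) = 0"
      by (rule hom_on_compat_inverse[OF hom x(1), rotated])
        (use x Q[OF x(1)] in \<open>simp add: times_dual_number_def one_dual_number_def field_simps\<close>)
  qed simp
  have all: "a \<in> E" for a
  proof -
    define I where "I = {p \<in> polys_over E. poly p a = 0}"
    show ?thesis
    proof (cases "I \<subseteq> {0}")
      case True
      then show ?thesis by (intro adj[of a "Dual a 0"]) (auto simp: I_def)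
    next
      case False
      then obtain p0 where "p0 \<in> I" "p0 \<noteq> 0" by auto
      then obtain q where q: "q \<in> I" "q \<noteq> 0" and min: "\<And>p. p \<in> I \<Longrightarrow> p \<noteq> 0 \<Longrightarrow> degree q \<le> degree p"
        using ex_has_least_nat[of "\<lambda>p. p \<in> I \<and> p \<noteq> 0" p0 degree] by auto
      have qE: "coeff q i \<in> E" for i using q by (auto simp: I_def polys_over_def)
      have "degree q \<noteq> 0"
      proof
        assume "degree q = 0"
        then obtain c where "q = [:c:]" by (auto elim: degree_eq_zeroE)
        then show False using q by (auto simp: I_def)
      qed
      then have "pderiv q \<noteq> 0" "degree (pderiv q) < degree q" by (auto simp: pderiv_eq_0_iff degree_pderiv)
      then have d0: "poly (pderiv q) a \<noteq> 0"
        using min[of "pderiv q"] q polys_over_pderiv[OF hom, of q] by (auto simp: I_def)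
      let ?P = "map_poly \<phi> q"
      \<comment> \<open>The derivative of a obtained by differentiating q(a) = 0, where
        \<open>q\<close> is a relation of least degree. The denominator q'(a) is nonzero, since q'
        is nonzero and of smaller degree.\<close>
      define b where "b = Dual a (- du (poly ?P (Dual a 0)) / poly (pderiv q) a)"
      have reP: "map_poly re ?P = q"
        by (rule poly_eqI) (use Q qE hom_on_0[OF hom] in \<open>auto simp: coeff_map_poly\<close>)
      have "re (poly ?P b) = 0" using q by (simp add: re_poly reP b_def I_def)
      moreover have "du (poly ?P b) = 0"
        unfolding b_def by (subst du_poly_Dual) (simp add: reP d0)
      ultimately have Pb: "poly ?P b = 0" by (simp add: dual_number.expand)
      have "poly (map_poly \<phi> p) b = 0" if "p \<in> I" for p
        using that
      proof (induction "degree p" arbitrary: p rule: less_induct)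
        case less
        show ?case
        proof (cases "p = 0")
          case False
          have pE: "coeff p i \<in> E" for i using less.prems by (auto simp: I_def polys_over_def)
          define c where "c = lead_coeff p / lead_coeff q"
          have cE: "c \<in> E" unfolding c_def divide_inverse
            by (intro hom_on_mult[OF hom] pE inv qE) (use q in auto)
          define h where "h = monom c (degree p - degree q)"
          have hE: "h \<in> polys_over E" unfolding h_def by (rule polys_over_monom[OF hom cE])
          have hq: "h * q \<in> polys_over E" using hE q by (auto simp: I_def intro: polys_over_mult[OF hom])
          have "p - h * q = 0 \<or> degree (p - h * q) < degree p"
            unfolding h_def by (rule degree_cancel_less[OF False q(2) min[OF less.prems False] c_def])
          moreover have "p - h * q \<in> I"
            using less.prems q hq by (auto simp: I_def intro: polys_over_diff[OF hom])
          ultimately have "poly (map_poly \<phi> (p - h * q)) b = 0" using less.hyps by auto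
          moreover have "map_poly \<phi> (p - h * q) = map_poly \<phi> p - map_poly \<phi> h * ?P"
            using less.prems q hq hE by (simp add: I_def map_poly_hom_diff[OF hom] map_poly_hom_mult[OF hom])
          ultimately show ?thesis using Pb by simp
        qed simp
      qed
      then show ?thesis by (intro adj[of a b]) (auto simp: I_def b_def)
    qed
  qed
  show ?thesis
  proof (rule that[of "\<lambda>x. du (\<phi> x)"])
    show "du (\<phi> (x + y)) = du (\<phi> x) + du (\<phi> y)" for x y using hom_on_add[OF hom all all] by simp
    show "du (\<phi> (x * y)) = du (\<phi> x) * y + x * du (\<phi> y)" for x y
      using hom_on_mult(2)[OF hom all all, of x y] Q[OF all] by simp
    show "du (\<phi> (e r)) = 0" for r
      using ext(2)[of "e r"] 1(3)[of "e r"] subsetD[OF 1(2), of "e r"] by (simp add: \<phi>0_def)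
    show "du (\<phi> N) = 1" using ext(2)[OF 1(4)] 1(5) by simp
  qed
qed

section \<open>Residues of formal solutions\<close>

no_notation index_mat (infixl \<open>$$\<close> 100)
no_notation vec_index (infixl \<open>$\<close> 100)
unbundle fps_syntax

text \<open>Gaussian elimination: a vector \<open>Z k\<close> that is nonzero at the coordinate
  \<open>x\<close> clears this coordinate from the other vectors.\<close>

lemma linear_dependence:
  fixes Z :: "'j \<Rightarrow> 'i \<Rightarrow> 'a::field"
  assumes "finite A" "finite B" "card A < card B"
  shows "\<exists>c. (\<exists>j\<in>B. c j \<noteq> 0) \<and> (\<forall>x\<in>A. (\<Sum>j\<in>B. c j * Z j x) = 0)"
  using assms
proof (induction A arbitrary: B Z rule: finite_induct)
  case empty
  then show ?case by (intro exI[of _ "\<lambda>_. 1"]) (auto simp: card_gt_0_iff)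
next
  case (insert x A)
  show ?case
  proof (cases "\<forall>j\<in>B. Z j x = 0")
    case True
    obtain c where "\<exists>j\<in>B. c j \<noteq> 0" "\<forall>x\<in>A. (\<Sum>j\<in>B. c j * Z j x) = 0"
      using insert.IH[of B Z] insert.prems insert.hyps by auto
    with True show ?thesis by (intro exI[of _ c]) auto
  next
    case False
    then obtain k where k: "k \<in> B" "Z k x \<noteq> 0" by auto
    define C where "C = B - {k}"
    have C: "finite C" "card A < card C" "B = insert k C" "k \<notin> C"
      using insert.prems insert.hyps k by (auto simp: C_def)
    obtain c where c: "\<exists>j\<in>C. c j \<noteq> 0"
      "\<And>y. y \<in> A \<Longrightarrow> (\<Sum>j\<in>C. c j * (Z j y - Z j x / Z k x * Z k y)) = 0"
      using insert.IH[of C "\<lambda>j y. Z j y - Z j x / Z k x * Z k y"] C by blast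
    define s where "s = (\<Sum>j\<in>C. c j * Z j x)"
    define c' where "c' = (\<lambda>j. if j = k then - s / Z k x else c j)"
    have c'C: "(\<Sum>j\<in>C. c' j * Z j y) = (\<Sum>j\<in>C. c j * Z j y)" for y
      by (rule sum.cong) (use C in \<open>auto simp: c'_def\<close>)
    have eq: "(\<Sum>j\<in>B. c' j * Z j y) = (\<Sum>j\<in>C. c j * Z j y) - s / Z k x * Z k y" for y
      unfolding C(3) using C c'C by (simp add: c'_def)
    have "(\<Sum>j\<in>C. c j * (Z j y - Z j x / Z k x * Z k y)) = (\<Sum>j\<in>C. c j * Z j y) - s / Z k x * Z k y" for y
      unfolding s_def sum_divide_distrib sum_distrib_right sum_subtractf[symmetric]
      by (rule sum.cong) (simp_all add: algebra_simps)
    with c(2) eq have "(\<Sum>j\<in>B. c' j * Z j y) = 0" if "y \<in> A" for y using that by simp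
    moreover have "(\<Sum>j\<in>B. c' j * Z j x) = 0" using eq[of x] k by (simp add: s_def)
    moreover have "\<exists>j\<in>B. c' j \<noteq> 0" using c(1) C by (auto simp: c'_def)
    ultimately show ?thesis by (intro exI[of _ c']) auto
  qed
qed

text \<open>The range need not start at the exact subdegrees: a derivation may kill leading
  coefficients, and the products in the Leibniz rule are to be compared term by term.\<close>

lemma fls_times_nth_bounds:
  fixes f g :: "'a::comm_ring_1 fls"
  assumes "\<And>i. i < a \<Longrightarrow> f $$ i = 0" "\<And>i. i < b \<Longrightarrow> g $$ i = 0"
  shows "(f * g) $$ n = (\<Sum>i=a..n - b. f $$ i * g $$ (n - i))"
proof (cases "f = 0 \<or> g = 0")
  case False
  then have *: "a \<le> fls_subdegree f" "b \<le> fls_subdegree g"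
    using assms by (auto intro!: fls_subdegree_geI)
  let ?I = "{fls_subdegree f..n - fls_subdegree g}"
  have "f $$ i * g $$ (n - i) = 0" if "i \<notin> ?I" for i
  proof -
    from that have "i < fls_subdegree f \<or> n - i < fls_subdegree g" by auto
    then show ?thesis by auto
  qed
  moreover have "?I \<subseteq> {a..n - b}" using * by auto
  ultimately show ?thesis unfolding fls_times_nth(2)[of f g] by (intro sum.mono_neutral_left) auto
qed auto

definition fls_map :: "('a \<Rightarrow> 'b) \<Rightarrow> 'a::zero fls \<Rightarrow> 'b::zero fls" where
  "fls_map h f = Abs_fls (\<lambda>n. h (f $$ n))"

lemma fls_map_nth: "h 0 = 0 \<Longrightarrow> fls_map h f $$ n = h (f $$ n)"
proof -
  assume h: "h 0 = 0"
  obtain N where "\<forall>n<N. f $$ n = 0" by (elim fls_nth_vanishes_belowE)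
  then have "\<forall>n<N. h (f $$ n) = 0" using h by simp
  then show ?thesis unfolding fls_map_def by (rule nth_Abs_fls_lower_bound)
qed

section \<open>A derivation of the coefficient field, extended to Laurent series\<close>

locale field_derivation =
  fixes d :: "'a::field_char_0 \<Rightarrow> 'a"
  assumes d_add: "d (x + y) = d x + d y"
    and d_mult: "d (x * y) = d x * y + x * d y"
begin

lemma d_0 [simp]: "d 0 = 0"
  using d_add[of 0 0] by simp

lemma d_1 [simp]: "d 1 = 0"
  using d_mult[of 1 1] by simp

lemma d_minus: "d (- x) = - d x"
  using d_add[of x "- x"] by (simp add: eq_neg_iff_add_eq_0 add.commute)

lemma d_diff: "d (x - y) = d x - d y"
  using d_add[of x "- y"] by (simp add: d_minus)

lemma d_of_nat [simp]: "d (of_nat n) = 0"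
  by (induction n) (simp_all add: d_add)

lemma d_of_int [simp]: "d (of_int n) = 0"
  by (cases n) (simp_all add: d_minus d_diff)

lemma d_sum: "d (\<Sum>i\<in>A. f i) = (\<Sum>i\<in>A. d (f i))"
  by (induction A rule: infinite_finite_induct) (simp_all add: d_add)

abbreviation (input) dfls :: "'a fls \<Rightarrow> 'a fls" where "dfls \<equiv> fls_map d"

lemma dfls_nth [simp]: "dfls f $$ n = d (f $$ n)"
  by (simp add: fls_map_nth)

lemma dfls_0 [simp]: "dfls 0 = 0"
  by (rule fls_eqI) simp

lemma dfls_1 [simp]: "dfls 1 = 0"
  by (rule fls_eqI) simp

lemma dfls_add: "dfls (f + g) = dfls f + dfls g"
  by (rule fls_eqI) (simp add: d_add)

lemma dfls_diff: "dfls (f - g) = dfls f - dfls g"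
  by (rule fls_eqI) (simp add: d_diff)

lemma dfls_sum: "dfls (\<Sum>i\<in>A. f i) = (\<Sum>i\<in>A. dfls (f i))"
  by (induction A rule: infinite_finite_induct) (simp_all add: dfls_add)

lemma dfls_mult: "dfls (f * g) = dfls f * g + f * dfls g"
proof (rule fls_eqI)
  fix n
  let ?a = "fls_subdegree f" and ?b = "fls_subdegree g"
  have "(f * g) $$ n = (\<Sum>i=?a..n - ?b. f $$ i * g $$ (n - i))"
    "(dfls f * g) $$ n = (\<Sum>i=?a..n - ?b. d (f $$ i) * g $$ (n - i))"
    "(f * dfls g) $$ n = (\<Sum>i=?a..n - ?b. f $$ i * d (g $$ (n - i)))"
    by (subst fls_times_nth_bounds[of ?a _ ?b], auto)+
  then show "dfls (f * g) $$ n = (dfls f * g + f * dfls g) $$ n"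
    by (simp add: d_sum d_mult sum.distrib)
qed

lemma dfls_deriv: "dfls (fls_deriv f) = fls_deriv (dfls f)"
  by (rule fls_eqI) (simp add: d_mult d_add)

lemma dfls_of_nat [simp]: "dfls (of_nat n) = 0"
  by (induction n) (simp_all add: dfls_add)

lemma dfls_divide:
  assumes "dfls g = 0"
  shows "dfls (f / g) = dfls f / g"
proof (cases "g = 0")
  case False
  then have "dfls f = dfls (f / g * g)" by simp
  also have "\<dots> = dfls (f / g) * g" using assms by (simp only: dfls_mult mult_zero_right add_0_right)
  finally show ?thesis using False by simp
qed simp

text \<open>If the coefficients of \<open>A\<close> are killed by \<open>d\<close>, apply \<open>d\<close> repeatedly to a solution \<open>Y\<close> and take
  the first linear relation $d^jY = \sum_{i<j} f_i\, d^iY$. Applying the connection to it and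
  comparing the coefficients of $d^{j-1}Y$ gives $j\,d(u) = f_{j-1}'$.\<close>

lemma residue_d_eq_0:
  fixes A :: "'i \<Rightarrow> 'i \<Rightarrow> 'a fls" and Y :: "'i \<Rightarrow> 'a fls"
  assumes fin: "finite S" and A: "\<And>i j. dfls (A i j) = 0"
    and eq: "\<And>i. i \<in> S \<Longrightarrow> fls_deriv (Y i) + (\<Sum>j\<in>S. A i j * Y j) = u * Y i"
    and nz: "i0 \<in> S" "Y i0 \<noteq> 0"
  shows "d (u $$ (-1)) = 0"
proof -
  define Z where "Z = (\<lambda>m i. (dfls ^^ m) (Y i))"
  \<comment> \<open>The connection twisted by -u, for which \<open>Y\<close> is horizontal.\<close>
  define nab where "nab = (\<lambda>W i. fls_deriv (W i) + (\<Sum>j\<in>S. A i j * W j) - u * W i)"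
  have Z0: "Z 0 = Y" by (simp add: Z_def)
  have ZS: "Z (Suc m) i = dfls (Z m i)" for m i by (simp add: Z_def)
  have nab_d: "nab (\<lambda>i. dfls (W i)) i = dfls (nab W i) + dfls u * W i" if "i \<in> S" for W i
    using that by (simp add: nab_def dfls_diff dfls_add dfls_sum dfls_mult A dfls_deriv)
  \<comment> \<open>The commutator of \<open>nab\<close> with \<open>d\<close> is multiplication by
    d(u). The m applications of \<open>d\<close> contribute one d(u) each, and the remaining terms
    involve only d^l Y with l < m - 1.\<close>
  have nab_Z: "\<exists>b. \<forall>i\<in>S. nab (Z m) i = of_nat m * dfls u * Z (m - 1) i + (\<Sum>l<m - 1. b l * Z l i)" for m
  proof (induction m)
    case 0
    show ?case using eq by (auto simp: nab_def Z0)
  next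
    case (Suc m)
    then obtain b where b: "\<And>i. i \<in> S \<Longrightarrow> nab (Z m) i = of_nat m * dfls u * Z (m - 1) i + (\<Sum>l<m - 1. b l * Z l i)" by blast
    show ?case
    proof (cases m)
      case 0
      have "nab (Z (Suc 0)) i = dfls u * Z 0 i" if "i \<in> S" for i
        using nab_d[OF that, of "Z 0"] b[OF that] 0 by (simp add: ZS[symmetric])
      then show ?thesis using 0 by auto
    next
      case (Suc m')
      define b' where "b' = (\<lambda>l. (if l < m' then dfls (b l) else 0) +
        (if l = m' then of_nat m * dfls (dfls u) else 0) + (if l = 0 then 0 else b (l - 1)))"
      have "nab (Z (Suc m)) i = of_nat (Suc m) * dfls u * Z m i + (\<Sum>l<m. b' l * Z l i)" if "i \<in> S" for i
      proof -
        have "nab (Z (Suc m)) i = dfls (nab (Z m) i) + dfls u * Z m i"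
          using nab_d[OF that, of "Z m"] by (simp add: ZS[symmetric])
        also have "dfls (nab (Z m) i) = of_nat m * dfls (dfls u) * Z m' i + of_nat m * dfls u * Z m i +
            ((\<Sum>l<m'. dfls (b l) * Z l i) + (\<Sum>l<m'. b l * Z (Suc l) i))"
          unfolding b[OF that] dfls_add dfls_sum dfls_mult by (simp add: Suc ZS sum.distrib dfls_mult dfls_add)
        also have "(\<Sum>l<m'. b l * Z (Suc l) i) = (\<Sum>l<m. (if l = 0 then 0 else b (l - 1)) * Z l i)"
          unfolding Suc sum.lessThan_Suc_shift by simp
        also have "(\<Sum>l<m'. dfls (b l) * Z l i) = (\<Sum>l<m. (if l < m' then dfls (b l) else 0) * Z l i)"
          unfolding Suc by simp
        also have "of_nat m * dfls (dfls u) * Z m' i = (\<Sum>l<m. (if l = m' then of_nat m * dfls (dfls u) else 0) * Z l i)"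
          unfolding Suc by simp
        finally show ?thesis
          by (simp add: b'_def sum.distrib distrib_right algebra_simps)
      qed
      then show ?thesis by (intro exI[of _ b']) simp
    qed
  qed
  define dep where "dep = (\<lambda>m. \<exists>f. \<forall>i\<in>S. Z m i = (\<Sum>l<m. f l * Z l i))"
  \<comment> \<open>As long as no d^l Y depends on the earlier ones they are linearly independent
    over Laurent series, so that coefficients may be compared.\<close>
  have indep: "c m = 0"
    if least: "\<And>l. l < j \<Longrightarrow> \<not> dep l" and rel: "\<And>i. i \<in> S \<Longrightarrow> (\<Sum>l<j. c l * Z l i) = 0" and m: "m < j"
    for c j m
  proof (rule ccontr)
    assume "c m \<noteq> 0"
    define M where "M = Max {l. l < j \<and> c l \<noteq> 0}"
    have M: "M < j" "c M \<noteq> 0" and mx: "\<And>l. l < j \<Longrightarrow> c l \<noteq> 0 \<Longrightarrow> l \<le> M"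
    proof -
      have "M \<in> {l. l < j \<and> c l \<noteq> 0}"
        unfolding M_def by (rule Max_in) (use \<open>c m \<noteq> 0\<close> m in auto)
      then show "M < j" "c M \<noteq> 0" by auto
      show "l \<le> M" if "l < j" "c l \<noteq> 0" for l
        unfolding M_def by (rule Max_ge) (use that in auto)
    qed
    have "Z M i = (\<Sum>l<M. (- c l / c M) * Z l i)" if "i \<in> S" for i
    proof -
      have "(\<Sum>l<j. c l * Z l i) = (\<Sum>l<Suc M. c l * Z l i)"
        by (rule sum.mono_neutral_right) (use M mx in \<open>fastforce+\<close>)
      then have "(\<Sum>l<M. c l * Z l i) + c M * Z M i = 0" using rel[OF that] by simp
      then have "c M * Z M i = - (\<Sum>l<M. c l * Z l i)" by (simp add: add_eq_0_iff)
      then have "Z M i = - (\<Sum>l<M. c l * Z l i) / c M" using M by (simp add: field_simps)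
      also have "\<dots> = (\<Sum>l<M. (- c l / c M) * Z l i)"
        by (simp add: sum_divide_distrib sum_negf)
      finally show ?thesis .
    qed
    then have "dep M" unfolding dep_def by (intro exI[of _ "\<lambda>l. - c l / c M"] ballI)
    with least[OF M(1)] show False by simp
  qed
  have "\<exists>m. dep m"
  proof (rule ccontr)
    assume *: "\<nexists>m. dep m"
    obtain c where c: "\<exists>j<Suc (card S). c j \<noteq> 0" "\<forall>x\<in>S. (\<Sum>j<Suc (card S). c j * Z j x) = 0"
      using linear_dependence[OF fin, of "{..<Suc (card S)}" Z] by auto
    then have "c m = 0" if "m < Suc (card S)" for m
      using indep[of "Suc (card S)" c m] * that by simp
    with c(1) show False by blast
  qed
  then obtain j where j: "dep j" "\<And>l. l < j \<Longrightarrow> \<not> dep l" by (metis LeastI not_less_Least)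
  have "j \<noteq> 0"
  proof
    assume "j = 0"
    then have "Y i = 0" if "i \<in> S" for i using j(1) that by (auto simp: dep_def Z0)
    with nz show False by blast
  qed
  obtain f where f: "\<And>i. i \<in> S \<Longrightarrow> Z j i = (\<Sum>l<j. f l * Z l i)" using j(1) by (auto simp: dep_def)
  obtain b where b: "\<And>m i. i \<in> S \<Longrightarrow> nab (Z m) i = of_nat m * dfls u * Z (m - 1) i + (\<Sum>l<m - 1. b m l * Z l i)"
    using nab_Z by metis
  have "\<exists>e. \<forall>i\<in>S. nab (Z j) i = (\<Sum>l<j. fls_deriv (f l) * Z l i) + (\<Sum>l<j - 1. e l * Z l i)"
  proof -
    have "nab (Z j) i = (\<Sum>l<j. fls_deriv (f l) * Z l i) + (\<Sum>m<j. f m * nab (Z m) i)" if i: "i \<in> S" for i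
    proof -
      have "(\<Sum>k\<in>S. A i k * Z j k) = (\<Sum>k\<in>S. \<Sum>l<j. f l * (A i k * Z l k))"
        by (intro sum.cong refl) (simp add: f sum_distrib_left mult_ac)
      also have "\<dots> = (\<Sum>l<j. f l * (\<Sum>k\<in>S. A i k * Z l k))"
        by (subst sum.swap) (simp add: sum_distrib_left)
      finally have "nab (Z j) i = fls_deriv (\<Sum>l<j. f l * Z l i) + (\<Sum>l<j. f l * (\<Sum>k\<in>S. A i k * Z l k)) - u * (\<Sum>l<j. f l * Z l i)"
        unfolding nab_def using f[OF i] by simp
      also have "\<dots> = (\<Sum>l<j. fls_deriv (f l) * Z l i) + (\<Sum>m<j. f m * nab (Z m) i)"
        unfolding nab_def fls_deriv_sum fls_deriv_mult sum_distrib_left[of u]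
        by (simp add: sum.distrib[symmetric] sum_subtractf[symmetric] algebra_simps)
      finally show ?thesis .
    qed
    note split = this
    have "\<exists>e. \<forall>i\<in>S. (\<Sum>m<n. f m * nab (Z m) i) = (\<Sum>l<n - 1. e l * Z l i)" for n
    proof (induction n)
      case (Suc n)
      then obtain e where e: "\<And>i. i \<in> S \<Longrightarrow> (\<Sum>m<n. f m * nab (Z m) i) = (\<Sum>l<n - 1. e l * Z l i)" by blast
      show ?case
      proof (cases n)
        case 0
        then show ?thesis using b[of _ 0] by auto
      next
        case (Suc n')
        define e' where "e' = (\<lambda>l. if l = n' then f n * (of_nat n * dfls u) else e l + f n * b n l)"
        have "(\<Sum>m<Suc n. f m * nab (Z m) i) = (\<Sum>l<n. e' l * Z l i)" if "i \<in> S" for i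
        proof -
          have "(\<Sum>l<n. e' l * Z l i) = (\<Sum>l<n'. e l * Z l i + f n * b n l * Z l i) + f n * (of_nat n * dfls u) * Z n' i"
            unfolding Suc by (simp add: e'_def distrib_right Suc)
          then show ?thesis using e[OF that] b[OF that, of n] Suc
            by (simp add: sum.distrib sum_distrib_left algebra_simps)
        qed
        then show ?thesis by (intro exI[of _ e']) simp
      qed
    qed auto
    then obtain e where "\<forall>i\<in>S. (\<Sum>m<j. f m * nab (Z m) i) = (\<Sum>l<j - 1. e l * Z l i)" by blast
    then show ?thesis by (intro exI[of _ e]) (simp add: split)
  qed
  then obtain e where e: "\<And>i. i \<in> S \<Longrightarrow> nab (Z j) i = (\<Sum>l<j. fls_deriv (f l) * Z l i) + (\<Sum>l<j - 1. e l * Z l i)" by blast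
  obtain j' where j': "j = Suc j'" using \<open>j \<noteq> 0\<close> by (cases j) auto
  \<comment> \<open>The difference of the two expressions for \<open>nab (Z j)\<close>, one from the
    general formula and one from applying \<open>nab\<close> to the relation. Its top coefficient is
    the one that matters.\<close>
  define c where "c = (\<lambda>l. if l = j' then of_nat j * dfls u - fls_deriv (f j') else b j l - fls_deriv (f l) - e l)"
  have "(\<Sum>l<j. c l * Z l i) = 0" if "i \<in> S" for i
  proof -
    have "(\<Sum>l<j. c l * Z l i) = (\<Sum>l<j'. (b j l - fls_deriv (f l) - e l) * Z l i) + (of_nat j * dfls u - fls_deriv (f j')) * Z j' i"
      unfolding j' by (simp add: c_def j')
    also have "\<dots> = of_nat j * dfls u * Z j' i + (\<Sum>l<j'. b j l * Z l i) -
       ((\<Sum>l<j'. fls_deriv (f l) * Z l i) + fls_deriv (f j') * Z j' i + (\<Sum>l<j'. e l * Z l i))"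
      by (simp add: left_diff_distrib sum_subtractf)
    also have "\<dots> = nab (Z j) i - nab (Z j) i"
      using b[OF that, of j] e[OF that] by (simp add: j')
    finally show ?thesis by simp
  qed
  from indep[OF j(2) this, of j'] have "of_nat j * dfls u = fls_deriv (f j')" by (simp add: c_def j')
  then have "(of_nat j * dfls u) $$ (-1) = 0" by simp
  moreover have "(of_nat j * dfls u) $$ (-1) = of_nat j * d (u $$ (-1))"
    by simp
  ultimately show ?thesis using \<open>j \<noteq> 0\<close> by simp
qed

text \<open>Elements algebraic over the constants are constant: differentiating q(p) = 0 leaves
  q'(p) d(p) = 0, and if q'(p) = 0 the argument is repeated with q'.\<close>

lemma d_root:
  fixes q :: "'a poly"
  assumes "\<And>i. d (coeff q i) = 0" "q \<noteq> 0" "poly q p = 0"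
  shows "d p = 0"
  using assms
proof (induction "degree q" arbitrary: q rule: less_induct)
  case less
  have dp: "d (poly q p) = poly (map_poly d q) p + poly (pderiv q) p * d p" for q
    by (induction q) (auto simp: map_poly_pCons pderiv_pCons d_add d_mult algebra_simps)
  have "map_poly d q = 0" using less.prems by (intro poly_eqI) (simp add: coeff_map_poly)
  with dp[of q] less.prems have *: "poly (pderiv q) p * d p = 0" by simp
  show ?case
  proof (cases "poly (pderiv q) p = 0")
    case True
    have "degree q \<noteq> 0"
    proof
      assume "degree q = 0"
      then obtain c where "q = [:c:]" by (auto elim: degree_eq_zeroE)
      then show False using less.prems by auto
    qed
    then have "pderiv q \<noteq> 0" "degree (pderiv q) < degree q" by (auto simp: pderiv_eq_0_iff degree_pderiv)
    moreover have "d (coeff (pderiv q) i) = 0" for i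
      using less.prems(1) by (simp add: coeff_pderiv d_mult d_add)
    ultimately show ?thesis using less.hyps True by blast
  qed (use * in auto)
qed

end

section \<open>Expansion of polynomials and the residue theorem\<close>

definition fls_eval :: "'a::field fls \<Rightarrow> 'a poly \<Rightarrow> 'a fls" where
  "fls_eval \<xi> q = poly (map_poly fls_const q) \<xi>"

lemma fls_eval_simps [simp]:
  "fls_eval \<xi> 0 = 0" "fls_eval \<xi> 1 = 1" "fls_eval \<xi> (pCons a q) = fls_const a + \<xi> * fls_eval \<xi> q"
  by (auto simp: fls_eval_def map_poly_pCons one_pCons)

lemma fls_eval_add: "fls_eval \<xi> (p + q) = fls_eval \<xi> p + fls_eval \<xi> q"
proof -
  have "map_poly fls_const (p + q) = map_poly fls_const p + map_poly fls_const q"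
    by (rule poly_eqI) (simp add: coeff_map_poly fls_plus_const)
  then show ?thesis by (simp add: fls_eval_def)
qed

lemma fls_eval_smult: "fls_eval \<xi> (smult a p) = fls_const a * fls_eval \<xi> p"
  by (induction p) (auto simp: fls_const_mult_const algebra_simps)

lemma fls_eval_mult: "fls_eval \<xi> (p * q) = fls_eval \<xi> p * fls_eval \<xi> q"
  by (induction p) (auto simp: fls_eval_add fls_eval_smult algebra_simps)

lemma fls_eval_power: "fls_eval \<xi> (p ^ n) = fls_eval \<xi> p ^ n"
  by (induction n) (auto simp: fls_eval_mult)

lemma fls_deriv_eval: "fls_deriv (fls_eval \<xi> q) = fls_eval \<xi> (pderiv q) * fls_deriv \<xi>"
  by (induction q) (auto simp: pderiv_pCons fls_eval_add algebra_simps)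

definition taylor :: "'a::field \<Rightarrow> 'a poly \<Rightarrow> 'a fps" where
  "taylor p q = poly (map_poly fps_const q) (fps_const p + fps_X)"

lemma taylor_pCons [simp]: "taylor p 0 = 0" "taylor p (pCons a q) = fps_const a + (fps_const p + fps_X) * taylor p q"
  by (simp_all add: taylor_def map_poly_pCons)

lemma taylor_fls: "fps_to_fls (taylor p q) = fls_eval (fls_const p + fls_X) q"
  by (induction q) (auto simp: fls_times_fps_to_fls)

lemma taylor_nth_0: "taylor p q $ 0 = poly q p"
  by (induction q) auto

lemma fls_eval_shift_nonzero:
  fixes q :: "'a::field poly"
  assumes "q \<noteq> 0"
  shows "fls_eval (fls_const p + fls_X) q \<noteq> 0"
  using assms
proof (induction "degree q" arbitrary: q rule: less_induct)
  case less
  show ?case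
  proof (cases "poly q p = 0")
    case True
    then obtain r where r: "q = [:-p, 1:] * r" by (auto simp: poly_eq_0_iff_dvd)
    with less.prems have "r \<noteq> 0" "degree r < degree q" by (auto simp: degree_mult_eq simp del: mult_pCons_left)
    with less.hyps show ?thesis unfolding r fls_eval_mult by auto
  next
    case False
    then have "taylor p q $ 0 \<noteq> 0" by (simp add: taylor_nth_0)
    then have "fps_to_fls (taylor p q) \<noteq> 0" by auto
    then show ?thesis by (simp add: taylor_fls)
  qed
qed

text \<open>Evaluation at p + X is expansion at p; \<xi> will be 1/X, the expansion of x at
  infinity. The induction on the degree of \<open>D\<close> splits off the leading polar part
  \<alpha>/(x - p)^k at a zero p of \<open>D\<close>. For k > 1 this is exact and has no residue
  anywhere; for k = 1 its coefficient is the residue at p, hence zero.\<close>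

lemma residue_theorem:
  fixes D v :: "'a::{alg_closed_field, field_char_0} poly" and \<xi> :: "'a fls"
  assumes \<xi>: "\<And>q. q \<noteq> 0 \<Longrightarrow> fls_eval \<xi> q \<noteq> 0"
    and pol: "\<And>q. (fls_deriv \<xi> * fls_eval \<xi> q) $$ (-1) = 0"
    and D: "D \<noteq> 0"
    and res: "\<And>p. poly D p = 0 \<Longrightarrow>
      (fls_eval (fls_const p + fls_X) v / fls_eval (fls_const p + fls_X) D) $$ (-1) = 0"
  shows "(fls_deriv \<xi> * (fls_eval \<xi> v / fls_eval \<xi> D)) $$ (-1) = 0"
  using D res
proof (induction "degree D" arbitrary: D v rule: less_induct)
  case less
  note t = fls_eval_shift_nonzero
  show ?case
  proof (cases "degree D = 0")
    case True
    then obtain c where c: "D = [:c:]" "c \<noteq> 0" using less.prems by (auto elim: degree_eq_zeroE)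
    then have "fls_eval \<xi> v / fls_eval \<xi> D = fls_eval \<xi> (smult (inverse c) v)"
      by (simp add: fls_eval_smult divide_inverse fls_inverse_const mult.commute)
    then show ?thesis using pol by simp
  next
    case False
    then obtain p where p: "poly D p = 0" using alg_closed_imp_poly_has_root[of D] by auto
    define k where "k = order p D"
    obtain E where E: "D = [:-p, 1:] ^ k * E" "\<not> [:-p, 1:] dvd E"
      using order_decomp[OF less.prems(1), of p] by (auto simp: k_def)
    have k: "k > 0" using p less.prems(1) by (simp add: k_def order_gt_0_iff)
    then obtain k' where k': "k = Suc k'" by (cases k) auto
    have Ep: "poly E p \<noteq> 0" using E(2) by (simp add: poly_eq_0_iff_dvd)
    \<comment> \<open>Chosen so that v - \<alpha> E vanishes at p, which allows one factor x - p to
      be cancelled.\<close>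
    define \<alpha> where "\<alpha> = poly v p / poly E p"
    have "poly (v - smult \<alpha> E) p = 0" using Ep by (simp add: \<alpha>_def)
    then obtain v2 where v2: "v - smult \<alpha> E = [:-p, 1:] * v2" by (metis poly_eq_0_iff_dvd dvdE)
    define D2 where "D2 = [:-p, 1:] ^ k' * E"
    have DD2: "D = [:-p, 1:] * D2" by (simp only: E(1) k' D2_def mult.assoc power_Suc)
    have D2: "D2 \<noteq> 0" "degree D2 < degree D"
      using less.prems(1) unfolding DD2 by (auto simp: degree_mult_eq simp del: mult_pCons_left)
    have split: "fls_eval \<eta> v / fls_eval \<eta> D = fls_const \<alpha> / (\<eta> - fls_const p) ^ k + fls_eval \<eta> v2 / fls_eval \<eta> D2"
      if nz: "\<And>q. q \<noteq> 0 \<Longrightarrow> fls_eval \<eta> q \<noteq> 0" for \<eta>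
    proof -
      have l: "fls_eval \<eta> [:-p, 1:] = \<eta> - fls_const p" by simp
      have "v = smult \<alpha> E + [:-p, 1:] * v2" using v2 by (simp add: algebra_simps)
      then have v: "fls_eval \<eta> v = fls_const \<alpha> * fls_eval \<eta> E + (\<eta> - fls_const p) * fls_eval \<eta> v2"
        by (simp only: fls_eval_add fls_eval_smult fls_eval_mult l)
      have "E \<noteq> 0" using Ep by auto
      then have E0: "fls_eval \<eta> E \<noteq> 0" by (rule nz)
      have l0: "\<eta> - fls_const p \<noteq> 0" using nz[of "[:-p, 1:]"] l by auto
      have D: "fls_eval \<eta> D = (\<eta> - fls_const p) ^ k * fls_eval \<eta> E"
        "fls_eval \<eta> D2 = (\<eta> - fls_const p) ^ k' * fls_eval \<eta> E"
        unfolding E(1) D2_def by (simp_all only: fls_eval_mult fls_eval_power l)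
      show ?thesis unfolding v D using E0 l0 by (simp add: k' field_simps)
    qed
    \<comment> \<open>Up to a constant, \<eta>' (\<eta> - p)^(-k) is the derivative of (\<eta> -
      p)^(-k'), where k' = k - 1 is positive.\<close>
    have exact: "(fls_deriv \<eta> * (fls_const \<alpha> / (\<eta> - fls_const p) ^ k)) $$ (-1) = 0"
      if pos: "k' > 0" "\<eta> - fls_const p \<noteq> 0" for \<eta> :: "'a fls"
    proof -
      obtain k'' where k'': "k' = Suc k''" using pos by (cases k') auto
      let ?z = "\<eta> - fls_const p"
      let ?y = "inverse ?z"
      have "fls_deriv (?y * ?z) = 0" using pos(2) by simp
      then have "fls_deriv ?y * ?z = - (?y * fls_deriv \<eta>)"
        unfolding fls_deriv_mult by (simp add: eq_neg_iff_add_eq_0 add.commute)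
      then have "fls_deriv ?y * ?z * ?y = - (?y * fls_deriv \<eta>) * ?y" by simp
      then have y: "fls_deriv ?y = - (?y * ?y) * fls_deriv \<eta>"
        using pos(2) by (simp add: mult.assoc)
      have "fls_deriv (?y ^ Suc n) = of_nat (Suc n) * ?y ^ n * fls_deriv ?y" for n
        by (induction n) (simp_all add: algebra_simps)
      then have "fls_deriv (?y ^ k') = of_nat k' * ?y ^ k'' * (- (?y * ?y) * fls_deriv \<eta>)"
        unfolding k'' y .
      also have "\<dots> = - of_nat k' * fls_deriv \<eta> * ?y ^ k"
        by (simp add: k'' k' mult_ac del: of_nat_Suc)
      finally have "fls_deriv (?y ^ k') = - of_nat k' * fls_deriv \<eta> * ?y ^ k" .
      then have "fls_deriv (fls_const (- \<alpha> / of_nat k') * ?y ^ k') =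
          (fls_const (- \<alpha> / of_nat k') * of_nat k') * (- (fls_deriv \<eta> * ?y ^ k))"
        by simp
      also have "fls_const (- \<alpha> / of_nat k') * of_nat k' = - fls_const \<alpha>"
        using pos by (simp add: fls_of_nat)
      finally have "fls_deriv (fls_const (- \<alpha> / of_nat k') * ?y ^ k') = fls_deriv \<eta> * (fls_const \<alpha> / ?z ^ k)"
        by (simp add: divide_inverse power_inverse mult_ac)
      then show ?thesis by (metis fls_deriv_residue)
    qed
    \<comment> \<open>At a simple zero the remainder v2/D2 has no pole at p, so that \<alpha> is the
      residue there.\<close>
    have \<alpha>0: "\<alpha> = 0" if k0: "k' = 0"
    proof -
      let ?t = "fls_const p + fls_X"
      let ?T = "taylor p"
      have "subdegree (?T E) = 0" using Ep by (simp add: subdegree_eq_0 taylor_nth_0)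
      moreover have "D2 = E" using k0 by (simp add: D2_def)
      ultimately have g: "fls_eval ?t v2 / fls_eval ?t D2 = fps_to_fls (?T v2 * inverse (?T E))"
        by (simp add: taylor_fls[symmetric] divide_inverse fls_times_fps_to_fls fls_inverse_fps_to_fls)
      have "0 = (fls_eval ?t v / fls_eval ?t D) $$ (-1)" using less.prems(2)[OF p] by simp
      also have "fls_eval ?t v / fls_eval ?t D =
          fls_const \<alpha> / (?t - fls_const p) ^ k + fls_eval ?t v2 / fls_eval ?t D2"
        by (rule split) (rule t)
      also have "\<dots> = fls_const \<alpha> / fls_X + fps_to_fls (?T v2 * inverse (?T E))"
        unfolding g by (simp add: k' k0)
      also have "\<dots> $$ (-1) = \<alpha>" by (simp add: divide_inverse fls_inverse_X fls_X_inv_times_conv_shift)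
      finally show ?thesis by simp
    qed
    have pole: "(fls_deriv \<eta> * (fls_const \<alpha> / (\<eta> - fls_const p) ^ k)) $$ (-1) = 0"
      if "\<eta> - fls_const p \<noteq> 0" for \<eta> :: "'a fls"
      using exact[OF _ that] \<alpha>0 by (cases "k' = 0") auto
    have nzl: "\<eta> - fls_const p \<noteq> 0" if "\<And>q. q \<noteq> 0 \<Longrightarrow> fls_eval \<eta> q \<noteq> 0" for \<eta>
      using that[of "[:-p, 1:]"] by auto
    \<comment> \<open>The polar part has no residue along any \<eta>, so that the hypothesis on
      finite residues passes from v/D to v2/D2.\<close>
    have red: "(fls_deriv \<eta> * (fls_eval \<eta> v / fls_eval \<eta> D)) $$ (-1) = (fls_deriv \<eta> * (fls_eval \<eta> v2 / fls_eval \<eta> D2)) $$ (-1)"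
      if nz: "\<And>q. q \<noteq> 0 \<Longrightarrow> fls_eval \<eta> q \<noteq> 0" for \<eta>
    proof -
      have "fls_eval \<eta> v / fls_eval \<eta> D =
          fls_const \<alpha> / (\<eta> - fls_const p) ^ k + fls_eval \<eta> v2 / fls_eval \<eta> D2"
        by (rule split) (rule nz)
      moreover have "\<eta> - fls_const p \<noteq> 0" by (rule nzl) (rule nz)
      note pole[OF this]
      ultimately show ?thesis by (simp only: distrib_left fls_plus_nth add_0_left)
    qed
    have "(fls_deriv \<xi> * (fls_eval \<xi> v2 / fls_eval \<xi> D2)) $$ (-1) = 0"
    proof (rule less.hyps[OF D2(2) D2(1)])
      fix p' assume "poly D2 p' = 0"
      then have "poly D p' = 0" by (simp add: DD2 del: mult_pCons_left)
      then show "(fls_eval (fls_const p' + fls_X) v2 / fls_eval (fls_const p' + fls_X) D2) $$ (-1) = 0"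
        using less.prems(2)[of p'] red[OF t, of p'] by simp
    qed
    then show ?thesis using red[OF \<xi>] by simp
  qed
qed

section \<open>The ultrapower\<close>

definition ultrafilter :: "'i filter \<Rightarrow> bool" where
  "ultrafilter U \<longleftrightarrow> U \<noteq> bot \<and> (\<forall>P. eventually P U \<or> eventually (\<lambda>x. \<not> P x) U)"

text \<open>Filters are handled as sets of predicates, to which Zorn's lemma applies. A maximal one
  decides every \<open>P\<close>, since otherwise \<open>P\<close> could be adjoined, giving the
  larger filter \<open>G\<close>.\<close>

lemma ultrafilter_exists:
  fixes F :: "'i filter"
  assumes "F \<noteq> bot"
  obtains U where "U \<le> F" "ultrafilter U"
proof -
  define ft where "ft = (\<lambda>G. (\<lambda>_. True) \<in> G \<and> (\<lambda>_. False) \<notin> G \<and>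
    (\<forall>P Q. P \<in> G \<longrightarrow> Q \<in> G \<longrightarrow> (\<lambda>x. P x \<and> Q x) \<in> G) \<and> (\<forall>P Q. P \<in> G \<longrightarrow> (\<forall>x::'i. P x \<longrightarrow> Q x) \<longrightarrow> Q \<in> G))"
  let ?F = "{P. eventually P F}"
  have "ft ?F" using assms unfolding ft_def
    by (auto simp: eventually_conj trivial_limit_def elim: eventually_mono)
  have ft_Union: "ft (\<Union>C)"
    if C: "C \<noteq> {}" and C1: "\<And>G. G \<in> C \<Longrightarrow> ft G"
      and C2: "\<And>P Q. P \<in> \<Union>C \<Longrightarrow> Q \<in> \<Union>C \<Longrightarrow> \<exists>G\<in>C. P \<in> G \<and> Q \<in> G" for C
    unfolding ft_def
  proof (intro conjI allI impI)
    show "(\<lambda>_. True) \<in> \<Union>C" using C C1 by (auto simp: ft_def)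
    show "(\<lambda>_. False) \<notin> \<Union>C" using C1 by (auto simp: ft_def)
    fix P Q assume P: "P \<in> \<Union>C"
    show "(\<lambda>x. P x \<and> Q x) \<in> \<Union>C" if "Q \<in> \<Union>C"
    proof -
      from C2[OF P that] obtain G where G: "G \<in> C" "P \<in> G" "Q \<in> G" by blast
      with C1[of G] have "(\<lambda>x. P x \<and> Q x) \<in> G" unfolding ft_def by blast
      with G show ?thesis by blast
    qed
    show "Q \<in> \<Union>C" if Q: "\<forall>x. P x \<longrightarrow> Q x"
    proof -
      from P obtain G where G: "G \<in> C" "P \<in> G" by blast
      with C1[of G] Q have "Q \<in> G" unfolding ft_def by blast
      with G show ?thesis by blast
    qed
  qed
  obtain M where M: "?F \<subseteq> M" "ft M" and maxft: "\<And>G. ft G \<Longrightarrow> M \<subseteq> G \<Longrightarrow> G = M"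
    by (rule Zorn_two_element_closed[of ft, OF \<open>ft ?F\<close> ft_Union]) (assumption | rule that)+
  have M1: "(\<lambda>_. True) \<in> M" "(\<lambda>_. False) \<notin> M" using M(2) by (simp_all add: ft_def)
  have M2: "(\<lambda>x. P x \<and> Q x) \<in> M" if "P \<in> M" "Q \<in> M" for P Q
    using M(2) that unfolding ft_def by blast
  have M3: "Q \<in> M" if "P \<in> M" "\<forall>x. P x \<longrightarrow> Q x" for P Q
    using M(2) that unfolding ft_def by blast
  have max: "P \<in> M \<or> (\<lambda>x. \<not> P x) \<in> M" for P
  proof (rule ccontr)
    assume neg: "\<not> ?thesis"
    define G where "G = {Q. \<exists>R\<in>M. \<forall>x. R x \<and> P x \<longrightarrow> Q x}"
    have "(\<lambda>_. False) \<notin> G"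
    proof
      assume "(\<lambda>_. False) \<in> G"
      then obtain R where R: "R \<in> M" "\<forall>x. R x \<longrightarrow> \<not> P x" unfolding G_def by auto
      have "(\<lambda>x. \<not> P x) \<in> M" by (rule M3[OF R])
      with neg show False by simp
    qed
    moreover have "(\<lambda>_. True) \<in> G" unfolding G_def mem_Collect_eq by (rule bexI[OF _ M1(1)]) simp
    moreover have "(\<lambda>x. Q x \<and> Q' x) \<in> G" if "Q \<in> G" "Q' \<in> G" for Q Q'
    proof -
      from that obtain R R' where R: "R \<in> M" "\<forall>x. R x \<and> P x \<longrightarrow> Q x" "R' \<in> M" "\<forall>x. R' x \<and> P x \<longrightarrow> Q' x"
        unfolding G_def by blast
      then show ?thesis unfolding G_def mem_Collect_eq by (intro bexI[OF _ M2[OF R(1,3)]]) auto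
    qed
    moreover have "Q' \<in> G" if Q: "Q \<in> G" "\<forall>x. Q x \<longrightarrow> Q' x" for Q Q'
    proof -
      from Q(1) obtain R where R: "R \<in> M" "\<forall>x. R x \<and> P x \<longrightarrow> Q x" unfolding G_def by auto
      then show ?thesis unfolding G_def mem_Collect_eq by (intro bexI[OF _ R(1)]) (use Q(2) in auto)
    qed
    ultimately have "ft G" unfolding ft_def by auto
    moreover have "M \<subseteq> G"
    proof
      fix R assume "R \<in> M"
      then show "R \<in> G" unfolding G_def mem_Collect_eq by (rule bexI[rotated]) simp
    qed
    ultimately have "G = M" using maxft[of G] by simp
    moreover have "P \<in> G" unfolding G_def mem_Collect_eq by (rule bexI[OF _ M1(1)]) simp
    ultimately show False using neg by simp
  qed
  define U where "U = Abs_filter (\<lambda>P. P \<in> M)"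
  have "is_filter (\<lambda>P. P \<in> M)"
  proof
    show "(\<lambda>x. True) \<in> M" by (rule M1)
    show "(\<lambda>x. P x \<and> Q x) \<in> M" if "P \<in> M" "Q \<in> M" for P Q using that by (rule M2)
    show "Q \<in> M" if "\<forall>x. P x \<longrightarrow> Q x" "P \<in> M" for P Q using that(2,1) by (rule M3)
  qed
  then have U: "eventually P U \<longleftrightarrow> P \<in> M" for P unfolding U_def by (rule eventually_Abs_filter)
  show ?thesis
  proof
    show "U \<le> F" using M(1) by (auto simp: le_filter_def U)
    show "ultrafilter U" unfolding ultrafilter_def trivial_limit_def U using max M1 by simp
  qed
qed

lemma ultrafilter_not:
  "ultrafilter U \<Longrightarrow> eventually (\<lambda>x. \<not> P x) U \<longleftrightarrow> \<not> eventually P U"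
  using eventually_conj[of P U "\<lambda>x. \<not> P x"] by (auto simp: ultrafilter_def trivial_limit_def)

text \<open>Of finitely many cases one holds almost everywhere. This fixes the order of the factor
  and, at each point of expansion, the index of a coordinate that does not vanish.\<close>

lemma ultrafilter_bex:
  assumes "ultrafilter U" "finite A" "eventually (\<lambda>x. \<exists>a\<in>A. P a x) U"
  shows "\<exists>a\<in>A. eventually (P a) U"
proof (rule ccontr)
  assume "\<not> ?thesis"
  then have "eventually (\<lambda>x. \<forall>a\<in>A. \<not> P a x) U"
    using assms(1,2) by (intro eventually_ball_finite) (auto simp: ultrafilter_not)
  with assms(3) ultrafilter_not[OF assms(1), of "\<lambda>x. \<exists>a\<in>A. P a x"] show False by simp
qed

text \<open>An ultrapower along an ultrafilter that depends on the data of the theorem is not a type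
  in HOL. Instead the type is formed once and for all from an ultrafilter that witnesses the
  failure of the theorem, if there is one.\<close>

definition counterexample :: "('r::idom \<Rightarrow> 'c::{alg_closed_field, field_char_0}) filter \<Rightarrow> bool" where
  "counterexample U \<longleftrightarrow> (\<exists>(\<iota> :: 'c \<Rightarrow> 'r) n a num den.
    irreducible_affine_variety \<iota> \<and> a n \<noteq> 0 \<and> (\<forall>i\<le>n. den i \<noteq> 0) \<and>
    (\<forall>i\<le>n. a i = Fract (fract_poly (num i)) (fract_poly (den i))) \<and>
    irreducible_op (op_to_ac (\<Sum>i\<le>n. rat_op (a i) * delta ^ i)) \<and>
    (\<forall>V. ad_open \<iota> V \<longrightarrow> eventually (\<lambda>c. c \<in> V) U) \<and>
    eventually (\<lambda>c. \<not> (specialization_defined c n num den \<and> irreducible_op (specialized_op c n num den))) U)"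

text \<open>The choice depends on the types alone, since \<open>counterexample\<close> quantifies
  over \<iota> and all other data. It is an ultrafilter unconditionally, so that the quotient below
  is a field in every instance.\<close>

definition bad_ultrafilter :: "('r::idom \<Rightarrow> 'c::{alg_closed_field, field_char_0}) filter" where
  "bad_ultrafilter = (SOME U. ultrafilter U \<and>
    ((\<exists>V::('r \<Rightarrow> 'c) filter. ultrafilter V \<and> counterexample V) \<longrightarrow> counterexample U))"

lemma bad_ultrafilter:
  "ultrafilter (bad_ultrafilter :: ('r::idom \<Rightarrow> 'c::{alg_closed_field, field_char_0}) filter)"
  "ultrafilter V \<Longrightarrow> counterexample (V :: ('r \<Rightarrow> 'c) filter) \<Longrightarrow>
    counterexample (bad_ultrafilter :: ('r \<Rightarrow> 'c) filter)"
proof -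
  have "\<exists>U::('r \<Rightarrow> 'c) filter. ultrafilter U \<and> ((\<exists>V::('r \<Rightarrow> 'c) filter. ultrafilter V \<and> counterexample V) \<longrightarrow> counterexample U)"
  proof (cases "\<exists>V::('r \<Rightarrow> 'c) filter. ultrafilter V \<and> counterexample V")
    case False
    have "(top_class.top :: ('r \<Rightarrow> 'c) filter) \<noteq> bot"
      by (auto simp: filter_eq_iff dest: spec[of _ "\<lambda>_. False"])
    then obtain U :: "('r \<Rightarrow> 'c) filter" where "ultrafilter U" by (rule ultrafilter_exists) (rule that)
    with False show ?thesis by (intro exI[of _ U]) simp
  next
    case True
    then obtain V :: "('r \<Rightarrow> 'c) filter" where "ultrafilter V" "counterexample V" by (elim exE conjE)
    then show ?thesis by (intro exI[of _ V]) simp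
  qed
  from someI_ex[OF this]
  have *: "ultrafilter (bad_ultrafilter :: ('r \<Rightarrow> 'c) filter) \<and>
    ((\<exists>V::('r \<Rightarrow> 'c) filter. ultrafilter V \<and> counterexample V) \<longrightarrow> counterexample (bad_ultrafilter :: ('r \<Rightarrow> 'c) filter))"
    unfolding bad_ultrafilter_def .
  then show "ultrafilter (bad_ultrafilter :: ('r \<Rightarrow> 'c) filter)" ..
  show "ultrafilter V \<Longrightarrow> counterexample (V :: ('r \<Rightarrow> 'c) filter) \<Longrightarrow>
    counterexample (bad_ultrafilter :: ('r \<Rightarrow> 'c) filter)" using * by blast
qed

abbreviation almost_all :: "(('r::idom \<Rightarrow> 'c::{alg_closed_field, field_char_0}) \<Rightarrow> bool) \<Rightarrow> bool" where
  "almost_all P \<equiv> eventually P bad_ultrafilter"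

\<comment> \<open>The ultrapower as an algebraically closed field of characteristic zero\<close>
quotient_type (overloaded) ('r, 'c) ultrapower =
  "('r::idom \<Rightarrow> 'c::{alg_closed_field, field_char_0}) \<Rightarrow> 'c" / "\<lambda>f g. almost_all (\<lambda>c. f c = g c)"
proof (rule equivpI)
  show "reflp (\<lambda>f g::('r \<Rightarrow> 'c) \<Rightarrow> 'c. almost_all (\<lambda>c. f c = g c))"
    by (rule reflpI) simp
  show "symp (\<lambda>f g::('r \<Rightarrow> 'c) \<Rightarrow> 'c. almost_all (\<lambda>c. f c = g c))"
    by (rule sympI) (simp add: eq_commute)
  show "transp (\<lambda>f g::('r \<Rightarrow> 'c) \<Rightarrow> 'c. almost_all (\<lambda>c. f c = g c))"
    by (rule transpI) (auto elim: eventually_elim2)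
qed

instantiation ultrapower :: (idom, "{alg_closed_field, field_char_0}") field
begin

lift_definition zero_ultrapower :: "('a, 'b) ultrapower" is "\<lambda>_. 0" .
lift_definition one_ultrapower :: "('a, 'b) ultrapower" is "\<lambda>_. 1" .
lift_definition plus_ultrapower :: "('a, 'b) ultrapower \<Rightarrow> ('a, 'b) ultrapower \<Rightarrow> ('a, 'b) ultrapower"
  is "\<lambda>f g c. f c + g c" by (auto elim: eventually_elim2)
lift_definition minus_ultrapower :: "('a, 'b) ultrapower \<Rightarrow> ('a, 'b) ultrapower \<Rightarrow> ('a, 'b) ultrapower"
  is "\<lambda>f g c. f c - g c" by (auto elim: eventually_elim2)
lift_definition uminus_ultrapower :: "('a, 'b) ultrapower \<Rightarrow> ('a, 'b) ultrapower"
  is "\<lambda>f c. - f c" by (auto elim: eventually_mono)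
lift_definition times_ultrapower :: "('a, 'b) ultrapower \<Rightarrow> ('a, 'b) ultrapower \<Rightarrow> ('a, 'b) ultrapower"
  is "\<lambda>f g c. f c * g c" by (auto elim: eventually_elim2)
lift_definition inverse_ultrapower :: "('a, 'b) ultrapower \<Rightarrow> ('a, 'b) ultrapower"
  is "\<lambda>f c. inverse (f c)" by (auto elim: eventually_mono)
definition divide_ultrapower :: "('a, 'b) ultrapower \<Rightarrow> ('a, 'b) ultrapower \<Rightarrow> ('a, 'b) ultrapower"
  where "divide_ultrapower x y = x * inverse y"

instance
proof
  fix a b c :: "('a, 'b) ultrapower"
  show "(0::('a, 'b) ultrapower) \<noteq> 1"
    by transfer (use bad_ultrafilter(1) in \<open>auto simp: ultrafilter_def eventually_False\<close>)
  show "inverse a * a = 1" if "a \<noteq> 0"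
    using that
    by transfer (auto simp: ultrafilter_not[OF bad_ultrafilter(1), symmetric] elim: eventually_mono)
  show "a div b = a * inverse b" by (rule divide_ultrapower_def)
qed (transfer; simp add: algebra_simps)+

end

definition ult :: "(('r \<Rightarrow> 'c) \<Rightarrow> 'c) \<Rightarrow> ('r::idom, 'c::{alg_closed_field, field_char_0}) ultrapower" where
  "ult = abs_ultrapower"

lemma ult_eq_iff: "ult f = ult g \<longleftrightarrow> almost_all (\<lambda>c. f c = g c)"
  by (simp add: ult_def ultrapower.abs_eq_iff)

lemma ult_add: "ult (\<lambda>c. f c + g c) = ult f + ult g"
  by (simp add: ult_def plus_ultrapower.abs_eq)

lemma ult_mult: "ult (\<lambda>c. f c * g c) = ult f * ult g"
  by (simp add: ult_def times_ultrapower.abs_eq)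

lemma ult_0: "ult (\<lambda>c. 0) = 0"
  by (simp add: ult_def zero_ultrapower_def)

lemma ult_1: "ult (\<lambda>c. 1) = 1"
  by (simp add: ult_def one_ultrapower_def)

lemma ult_uminus: "ult (\<lambda>c. - f c) = - ult f"
  by (simp add: ult_def uminus_ultrapower.abs_eq)

lemma ult_sum: "ult (\<lambda>c. \<Sum>i\<in>A. f i c) = (\<Sum>i\<in>A. ult (f i))"
  by (induction A rule: infinite_finite_induct) (simp_all add: ult_0 ult_add)

lemma ult_power: "ult (\<lambda>c. f c ^ n) = ult f ^ n"
  by (induction n) (simp_all add: ult_1 ult_mult)

lemma ult_of_nat: "ult (\<lambda>c. of_nat n) = of_nat n"
  by (induction n) (simp_all add: ult_0 ult_1 ult_add)

lemma ult_eq_0_iff: "ult f = 0 \<longleftrightarrow> almost_all (\<lambda>c. f c = 0)"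
  using ult_eq_iff[of f "\<lambda>_. 0"] by (simp add: ult_0)

lemma ult_surj: obtains f where "x = ult f"
  using Quotient3_abs_rep[OF Quotient3_ultrapower, of x] unfolding ult_def by metis

instance ultrapower :: (idom, "{alg_closed_field, field_char_0}") field_char_0
proof
  show "inj (of_nat :: nat \<Rightarrow> ('a, 'b) ultrapower)"
  proof (rule injI)
    fix m n assume "(of_nat m :: ('a, 'b) ultrapower) = of_nat n"
    then have "almost_all (\<lambda>c::'a \<Rightarrow> 'b. (of_nat m :: 'b) = of_nat n)"
      by (simp flip: ult_of_nat add: ult_eq_iff)
    then show "m = n" using bad_ultrafilter(1) by (cases "m = n") (auto simp: ultrafilter_def eventually_False)
  qed
qed

text \<open>Roots are chosen pointwise where the leading coefficient does not vanish, which is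
  almost everywhere.\<close>

lemma ultrapower_root:
  fixes f :: "nat \<Rightarrow> ('r::idom, 'c::{alg_closed_field, field_char_0}) ultrapower"
  assumes n: "n > 0" and f: "f n \<noteq> 0"
  shows "\<exists>x. (\<Sum>k\<le>n. f k * x ^ k) = 0"
proof -
  define g where "g = (\<lambda>k. SOME g. f k = ult g)"
  have g: "f k = ult (g k)" for k
  proof -
    obtain h where "f k = ult h" by (rule ult_surj)
    then show ?thesis unfolding g_def by (rule someI[of "\<lambda>g. f k = ult g"])
  qed
  have "\<exists>x. g n c \<noteq> 0 \<longrightarrow> (\<Sum>k\<le>n. g k c * x ^ k) = 0" for c
    using alg_closed[OF n, of "\<lambda>k. g k c"] by blast
  then obtain x where x: "\<And>c. g n c \<noteq> 0 \<Longrightarrow> (\<Sum>k\<le>n. g k c * x c ^ k) = 0" by metis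
  have "almost_all (\<lambda>c. g n c \<noteq> 0)"
    using f unfolding g ult_eq_0_iff by (simp add: ultrafilter_not[OF bad_ultrafilter(1)])
  then have "ult (\<lambda>c. \<Sum>k\<le>n. g k c * x c ^ k) = 0"
    unfolding ult_eq_0_iff by (rule eventually_mono) (rule x)
  then show "\<exists>x. (\<Sum>k\<le>n. f k * x ^ k) = 0"
    unfolding g ult_sum ult_mult ult_power by blast
qed

instance ultrapower :: (idom, "{alg_closed_field, field_char_0}") alg_closed_field
  by intro_classes (rule ultrapower_root)

lemma ult_nonzero: "almost_all (\<lambda>c. f c \<noteq> 0) \<Longrightarrow> ult f \<noteq> 0"
  by (simp add: ult_eq_0_iff ultrafilter_not[OF bad_ultrafilter(1)])

text \<open>Power series pass to the limit coefficient by coefficient without any bound on degrees;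
  this is what remains available when the degrees of \<open>S\<close> are unbounded.\<close>

definition fps_ult :: "(('r \<Rightarrow> 'c) \<Rightarrow> 'c fps) \<Rightarrow> ('r::idom, 'c::{alg_closed_field, field_char_0}) ultrapower fps" where
  "fps_ult g = Abs_fps (\<lambda>k. ult (\<lambda>c. g c $ k))"

lemma fps_ult_nth [simp]: "fps_ult g $ k = ult (\<lambda>c. g c $ k)"
  by (simp add: fps_ult_def)

lemma fps_ult_cong: "almost_all (\<lambda>c. f c = g c) \<Longrightarrow> fps_ult f = fps_ult g"
  by (rule fps_ext) (auto simp: ult_eq_iff elim: eventually_mono)

lemma fps_ult_add: "fps_ult (\<lambda>c. f c + g c) = fps_ult f + fps_ult g"
  by (rule fps_ext) (simp add: ult_add)

lemma fps_ult_uminus: "fps_ult (\<lambda>c. - f c) = - fps_ult f"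
  by (rule fps_ext) (simp add: ult_uminus)

lemma fps_ult_diff: "fps_ult (\<lambda>c. f c - g c) = fps_ult f - fps_ult g"
  using fps_ult_add[of f "\<lambda>c. - g c"] by (simp add: fps_ult_uminus)

lemma fps_ult_mult: "fps_ult (\<lambda>c. f c * g c) = fps_ult f * fps_ult g"
  by (rule fps_ext) (simp add: fps_mult_nth ult_sum ult_mult)

lemma fps_ult_deriv: "fps_ult (\<lambda>c. fps_deriv (f c)) = fps_deriv (fps_ult f)"
  by (rule fps_ext) (simp add: ult_mult ult_add ult_1 ult_of_nat algebra_simps)

lemma fps_ult_const: "fps_ult (\<lambda>c. fps_const (f c)) = fps_const (ult f)"
  by (rule fps_ext) (auto simp: ult_0)

lemma fps_ult_X: "fps_ult (\<lambda>c. fps_X) = fps_X"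
  by (rule fps_ext) (auto simp: fps_X_def ult_0 ult_1)

lemma fps_ult_0: "fps_ult (\<lambda>c. 0) = 0"
  by (rule fps_ext) (auto simp: ult_0)

lemma fps_ult_1: "fps_ult (\<lambda>c. 1) = 1"
  by (rule fps_ext) (auto simp: ult_0 ult_1)

lemma fps_ult_power: "fps_ult (\<lambda>c. f c ^ n) = fps_ult f ^ n"
  by (induction n) (simp_all add: fps_ult_1 fps_ult_mult)

lemma fps_ult_sum: "fps_ult (\<lambda>c. \<Sum>i\<in>A. f i c) = (\<Sum>i\<in>A. fps_ult (f i))"
  by (induction A rule: infinite_finite_induct) (simp_all add: fps_ult_0 fps_ult_add)

lemma fps_ult_tact:
  "fps_ult (\<lambda>c. tact n (a c) (Y c) I) = tact n (\<lambda>l l'. fps_ult (\<lambda>c. a c l l')) (\<lambda>I. fps_ult (\<lambda>c. Y c I)) I"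
  by (simp add: tact_def fps_ult_sum fps_ult_mult)

text \<open>A relation with a clause on degrees, since a family of unbounded degree has no limit
  among the polynomials over the ultrapower.\<close>

definition poly_lim :: "(('r \<Rightarrow> 'c) \<Rightarrow> 'c poly) \<Rightarrow> ('r::idom, 'c::{alg_closed_field, field_char_0}) ultrapower poly \<Rightarrow> bool" where
  "poly_lim g q \<longleftrightarrow> (\<exists>d. almost_all (\<lambda>c. degree (g c) \<le> d)) \<and> (\<forall>k. coeff q k = ult (\<lambda>c. coeff (g c) k))"

lemma poly_lim_exists:
  assumes d: "almost_all (\<lambda>c. degree (g c) \<le> d)"
  obtains q where "poly_lim g q" "degree q \<le> d"
proof
  let ?q = "\<Sum>k\<le>d. monom (ult (\<lambda>c. coeff (g c) k)) k"
  have "coeff ?q k = ult (\<lambda>c. coeff (g c) k)" for k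
  proof (cases "k \<le> d")
    case False
    have "almost_all (\<lambda>c. coeff (g c) k = 0)"
      using d by (rule eventually_mono) (use False in \<open>auto simp: coeff_eq_0\<close>)
    then show ?thesis using False by (simp add: coeff_sum ult_eq_0_iff[THEN iffD2])
  qed (simp add: coeff_sum)
  then show "poly_lim g ?q" using d by (auto simp: poly_lim_def)
  show "degree ?q \<le> d" by (rule degree_le) (auto simp: coeff_sum)
qed

lemma poly_lim_unique: "poly_lim g q \<Longrightarrow> poly_lim g q' \<Longrightarrow> q = q'"
  by (rule poly_eqI) (simp add: poly_lim_def)

lemma poly_lim_cong:
  assumes "poly_lim g q" "almost_all (\<lambda>c. g c = h c)"
  shows "poly_lim h q"
proof -
  obtain d where "almost_all (\<lambda>c. degree (g c) \<le> d)" using assms by (auto simp: poly_lim_def)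
  with assms(2) have "almost_all (\<lambda>c. degree (h c) \<le> d)" by (rule eventually_elim2) auto
  moreover have "ult (\<lambda>c. coeff (g c) k) = ult (\<lambda>c. coeff (h c) k)" for k
    unfolding ult_eq_iff using assms(2) by (rule eventually_mono) simp
  ultimately show ?thesis using assms(1) by (auto simp: poly_lim_def)
qed

lemma poly_lim_add:
  assumes "poly_lim g q" "poly_lim h r"
  shows "poly_lim (\<lambda>c. g c + h c) (q + r)"
proof -
  obtain d d' where "almost_all (\<lambda>c. degree (g c) \<le> d)" "almost_all (\<lambda>c. degree (h c) \<le> d')"
    using assms by (auto simp: poly_lim_def)
  then have "almost_all (\<lambda>c. degree (g c + h c) \<le> max d d')"
    by (rule eventually_elim2) (auto intro: degree_add_le)
  then show ?thesis using assms by (auto simp: poly_lim_def ult_add)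
qed

lemma poly_lim_uminus: "poly_lim g q \<Longrightarrow> poly_lim (\<lambda>c. - g c) (- q)"
  by (auto simp: poly_lim_def ult_uminus)

lemma poly_lim_mult:
  assumes "poly_lim g q" "poly_lim h r"
  shows "poly_lim (\<lambda>c. g c * h c) (q * r)"
proof -
  obtain d d' where "almost_all (\<lambda>c. degree (g c) \<le> d)" "almost_all (\<lambda>c. degree (h c) \<le> d')"
    using assms by (auto simp: poly_lim_def)
  then have "almost_all (\<lambda>c. degree (g c * h c) \<le> d + d')"
    by (rule eventually_elim2) (metis add_mono degree_mult_le order_trans)
  then show ?thesis using assms by (auto simp: poly_lim_def coeff_mult ult_sum ult_mult)
qed

lemma poly_lim_0: "poly_lim (\<lambda>c. 0) 0"
  by (auto simp: poly_lim_def ult_0)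

lemma poly_lim_1: "poly_lim (\<lambda>c. 1) 1"
  by (auto simp: poly_lim_def ult_0 ult_1)

lemma poly_lim_power: "poly_lim g q \<Longrightarrow> poly_lim (\<lambda>c. g c ^ n) (q ^ n)"
  by (induction n) (auto intro: poly_lim_mult poly_lim_1)

lemma poly_lim_sum:
  "(\<And>i. i \<in> A \<Longrightarrow> poly_lim (g i) (q i)) \<Longrightarrow> poly_lim (\<lambda>c. \<Sum>i\<in>A. g i c) (\<Sum>i\<in>A. q i)"
  by (induction A rule: infinite_finite_induct) (auto intro: poly_lim_add poly_lim_0)

lemma poly_lim_pderiv:
  assumes "poly_lim g q"
  shows "poly_lim (\<lambda>c. pderiv (g c)) (pderiv q)"
proof -
  obtain d where "almost_all (\<lambda>c. degree (g c) \<le> d)" using assms by (auto simp: poly_lim_def)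
  then have "almost_all (\<lambda>c. degree (pderiv (g c)) \<le> d)"
    by (rule eventually_mono) (auto simp: degree_pderiv)
  then show ?thesis using assms
    by (auto simp: poly_lim_def coeff_pderiv ult_mult ult_of_nat simp del: of_nat_Suc)
qed

lemma poly_lim_tact:
  assumes "I \<in> idx n k" "\<And>I. I \<in> idx n k \<Longrightarrow> poly_lim (\<lambda>c. Y c I) (Y' I)"
    "\<And>l l'. l < n \<Longrightarrow> l' < n \<Longrightarrow> poly_lim (\<lambda>c. a c l l') (a' l l')"
  shows "poly_lim (\<lambda>c. tact n (a c) (Y c) I) (tact n a' Y' I)"
  unfolding tact_def
  by (intro poly_lim_sum poly_lim_mult assms idx_update[OF assms(1)])
    (use idx_nth[OF assms(1)] assms(1) in \<open>auto simp: idx_def\<close>)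

lemma poly_lim_comp_mat:
  assumes "\<And>i. i \<le> n \<Longrightarrow> poly_lim (\<lambda>c. N c i) (N' i)" "l < n" "l' < n"
  shows "poly_lim (\<lambda>c. comp_mat n (N c) l l') (comp_mat n N' l l')"
proof -
  have 1: "poly_lim (\<lambda>c. if l = Suc l' then N c n else 0) (if l = Suc l' then N' n else 0)"
    using assms(1)[of n] by (simp add: poly_lim_0)
  have 2: "poly_lim (\<lambda>c. - (if Suc l' = n then N c l else 0)) (- (if Suc l' = n then N' l else 0))"
    using assms(1)[of l] assms(2) by (intro poly_lim_uminus) (simp add: poly_lim_0)
  show ?thesis
    unfolding comp_mat_def diff_conv_add_uminus by (rule poly_lim_add[OF 1 2])
qed

section \<open>Limits of expansions at finite points and at infinity\<close>

lemma taylor_add: "taylor p (q + r) = taylor p q + taylor p r"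
  using fps_to_fls_eq_iff[of "taylor p (q + r)" "taylor p q + taylor p r"] by (simp add: taylor_fls fls_eval_add)

lemma taylor_mult: "taylor p (q * r) = taylor p q * taylor p r"
  using fps_to_fls_eq_iff[of "taylor p (q * r)" "taylor p q * taylor p r"]
  by (simp add: taylor_fls fls_eval_mult fls_times_fps_to_fls)

lemma taylor_pderiv: "taylor p (pderiv q) = fps_deriv (taylor p q)"
  by (induction q) (auto simp: pderiv_pCons taylor_add algebra_simps)

lemma map_poly_fps_const_eval:
  fixes q :: "'a::field poly"
  assumes "degree q \<le> d"
  shows "taylor p q = (\<Sum>k\<le>d. fps_const (coeff q k) * (fps_const p + fps_X) ^ k)"
  unfolding taylor_def
  by (subst poly_eq_sum[of _ d]) (use assms in \<open>auto intro!: degree_le simp: coeff_map_poly coeff_eq_0\<close>)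

text \<open>With a common degree bound both sides are one finite expression in the coefficients and
  the point. As \<pi> varies with \<open>c\<close>, every element of the ultrapower is a possible
  point of expansion.\<close>

lemma fps_ult_taylor:
  assumes "poly_lim g q"
  shows "fps_ult (\<lambda>c. taylor (\<pi> c) (g c)) = taylor (ult \<pi>) q"
proof -
  obtain d where d: "almost_all (\<lambda>c. degree (g c) \<le> d)" using assms by (auto simp: poly_lim_def)
  obtain q' where q': "poly_lim g q'" "degree q' \<le> d" using poly_lim_exists[OF d] .
  have "degree q \<le> d" using q' poly_lim_unique[OF assms q'(1)] by simp
  have "fps_ult (\<lambda>c. taylor (\<pi> c) (g c)) =
      fps_ult (\<lambda>c. \<Sum>k\<le>d. fps_const (coeff (g c) k) * (fps_const (\<pi> c) + fps_X) ^ k)"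
    by (rule fps_ult_cong) (use d in eventually_elim, rule map_poly_fps_const_eval)
  also have "\<dots> = (\<Sum>k\<le>d. fps_const (coeff q k) * (fps_const (ult \<pi>) + fps_X) ^ k)"
    using assms by (simp add: fps_ult_sum fps_ult_mult fps_ult_power fps_ult_add fps_ult_const fps_ult_X poly_lim_def)
  also have "\<dots> = taylor (ult \<pi>) q" by (rule map_poly_fps_const_eval[symmetric]) fact
  finally show ?thesis .
qed

text \<open>The expansion at infinity, $t^m q(1/t)$.\<close>

definition rev_fps :: "nat \<Rightarrow> 'a::field poly \<Rightarrow> 'a fps" where
  "rev_fps m q = Abs_fps (\<lambda>j. if j \<le> m then coeff q (m - j) else 0)"

lemma fps_to_fls_sum: "fps_to_fls (\<Sum>i\<in>A. f i) = (\<Sum>i\<in>A. fps_to_fls (f i))"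
  by (induction A rule: infinite_finite_induct) simp_all

lemma rev_fps_fls:
  assumes "degree q \<le> m"
  shows "fps_to_fls (rev_fps m q) = fls_X ^ m * fls_eval fls_X_inv q"
proof -
  have "fls_eval fls_X_inv q = (\<Sum>k\<le>m. fls_const (coeff q k) * fls_X_inv ^ k)"
    unfolding fls_eval_def
    by (subst poly_eq_sum[of _ m]) (use assms in \<open>auto intro!: degree_le simp: coeff_map_poly coeff_eq_0\<close>)
  moreover have "fls_X ^ m * (fls_const (coeff q k) * fls_X_inv ^ k) = fls_const (coeff q k) * fls_X ^ (m - k)"
    if "k \<le> m" for k
  proof -
    have "fls_X ^ m = fls_X ^ (m - k) * (fls_X :: 'a fls) ^ k" using that by (simp flip: power_add)
    moreover have "(fls_X :: 'a fls) ^ k * fls_X_inv ^ k = 1"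
      by (simp flip: power_mult_distrib fls_inverse_X)
    ultimately show ?thesis by (simp add: mult_ac)
  qed
  ultimately have "fls_X ^ m * fls_eval fls_X_inv q = (\<Sum>k\<le>m. fls_const (coeff q k) * fls_X ^ (m - k))"
    unfolding sum_distrib_left by (simp only: sum_distrib_left) (intro sum.cong, simp_all)
  also have "\<dots> = fps_to_fls (\<Sum>k\<le>m. fps_const (coeff q k) * fps_X ^ (m - k))"
    by (simp add: fps_to_fls_sum fls_times_fps_to_fls fps_to_fls_power)
  also have "(\<Sum>k\<le>m. fps_const (coeff q k) * fps_X ^ (m - k)) = rev_fps m q"
  proof (rule fps_ext)
    fix j
    have "(\<Sum>k\<le>m. fps_const (coeff q k) * fps_X ^ (m - k)) $ j = (\<Sum>k\<le>m. if j = m - k then coeff q k else 0)"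
      unfolding fps_sum_nth by (rule sum.cong) auto
    also have "\<dots> = (\<Sum>k\<le>m. if j \<le> m \<and> k = m - j then coeff q k else 0)"
      by (rule sum.cong) auto
    also have "\<dots> = rev_fps m q $ j" by (simp add: rev_fps_def)
    finally show "(\<Sum>k\<le>m. fps_const (coeff q k) * fps_X ^ (m - k)) $ j = rev_fps m q $ j" .
  qed
  finally show ?thesis ..
qed

lemma fps_ult_rev_fps:
  assumes "poly_lim g q"
  shows "fps_ult (\<lambda>c. rev_fps m (g c)) = rev_fps m q"
  by (rule fps_ext) (use assms in \<open>simp add: rev_fps_def poly_lim_def ult_0\<close>)

section \<open>Reduction along a place and expansion at infinity\<close>

lemma tact_hom:
  assumes "h 0 = 0" "\<And>x y. h (x + y) = h x + h y" "\<And>x y. h (x * y) = h x * h y"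
  shows "h (tact n a Y I) = tact n (\<lambda>l l'. h (a l l')) (\<lambda>I. h (Y I)) I"
proof -
  have "h (\<Sum>i\<in>A. f i) = (\<Sum>i\<in>A. h (f i))" for A and f :: "nat \<Rightarrow> _"
    by (induction A rule: infinite_finite_induct) (simp_all add: assms)
  then show ?thesis by (simp add: tact_def assms(3))
qed

lemma degree_comp_mat:
  assumes "\<And>i. i \<le> n \<Longrightarrow> degree (N i) \<le> d" "l < n"
  shows "degree (comp_mat n N l l') \<le> d"
proof -
  have "degree (if l = Suc l' then N n else 0) \<le> d" "degree (if Suc l' = n then N l else 0) \<le> d"
    using assms(1)[of n] assms(1)[of l] assms(2) by auto
  then show ?thesis unfolding comp_mat_def by (rule degree_diff_le)
qed

lemma degree_pderiv_le: "degree (pderiv p) \<le> degree p"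
  by (rule degree_le) (auto simp: coeff_pderiv coeff_eq_0)

text \<open>At an index where \<open>S\<close> has its greatest degree M, the left side of the
  equation has degree at most d + M. The bound on \<open>v\<close> is thus independent of the degree
  of \<open>S\<close>.\<close>

lemma tensor_eq_degree:
  fixes N :: "nat \<Rightarrow> 'a::field poly"
  assumes eq: "tensor_eq n k N v S" and d: "\<And>i. i \<le> n \<Longrightarrow> degree (N i) \<le> d"
    and nz: "I0 \<in> idx n k" "S I0 \<noteq> 0"
  shows "degree v \<le> d"
proof (cases "v = 0")
  case False
  define A where "A = {I \<in> idx n k. S I \<noteq> 0}"
  define M where "M = Max ((\<lambda>I. degree (S I)) ` idx n k)"
  have M: "degree (S I) \<le> M" if "I \<in> idx n k" for I unfolding M_def using that by (intro Max_ge) auto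
  have "M \<in> (\<lambda>I. degree (S I)) ` idx n k" unfolding M_def using nz by (intro Max_in) auto
  then obtain I1 where I1: "I1 \<in> idx n k" "degree (S I1) = M" by auto
  \<comment> \<open>As the zero polynomial has degree 0, the entry of maximal degree may be zero;
    then M = 0 and \<open>I0\<close> serves instead.\<close>
  obtain I where I: "I \<in> idx n k" "degree (S I) = M" "S I \<noteq> 0"
  proof (cases "S I1 = 0")
    case True
    then have "M = 0" using I1 by simp
    then have "degree (S I0) = M" using M[OF nz(1)] by simp
    with nz that show ?thesis by blast
  qed (use I1 that in blast)
  have "degree (tact n (comp_mat n N) S I) \<le> d + M" unfolding tact_def
  proof (intro degree_sum_le order_trans[OF degree_mult_le] add_mono)
    fix i l assume il: "i \<in> {..<length I}" "l \<in> {..<n}"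
    then show "degree (comp_mat n N (I ! i) l) \<le> d"
      using I(1) idx_nth[OF I(1), of i] by (intro degree_comp_mat d) (auto simp: idx_def)
    show "degree (S (I[i := l])) \<le> M" using il I(1) by (intro M idx_update) auto
  qed auto
  moreover have "degree (N n * pderiv (S I)) \<le> d + M"
    using degree_mult_le[of "N n" "pderiv (S I)"] d[of n] I(2) degree_pderiv_le[of "S I"] by linarith
  ultimately have "degree (N n * pderiv (S I) + tact n (comp_mat n N) S I) \<le> d + M"
    by (intro degree_add_le)
  then have "degree (v * S I) \<le> d + M" using eq I(1) by (auto simp: tensor_eq_def)
  then show ?thesis using False I by (simp add: degree_mult_eq)
qed simp

text \<open>In the quotient field of a valuation ring one of any two nonzero elements divides the
  other, so that a finite set has a member of least valuation.\<close>

lemma dividing_element: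
  fixes E :: "'a::field set"
  assumes "finite A" "A \<noteq> {}" and val: "\<And>x. x \<notin> E \<Longrightarrow> inverse x \<in> E"
    and hom: "hom_on E (\<phi> :: 'a \<Rightarrow> 'b::field)" and nz: "0 \<notin> A"
  shows "\<exists>s\<in>A. \<forall>x\<in>A. x / s \<in> E"
  using assms(1,2) nz
proof (induction A rule: finite_ne_induct)
  case (singleton x)
  then show ?case using hom_on_1[OF hom] by simp
next
  case (insert x A)
  then obtain s where s: "s \<in> A" "\<And>y. y \<in> A \<Longrightarrow> y / s \<in> E" by auto
  have nz: "s \<noteq> 0" "x \<noteq> 0" using insert.prems s by auto
  show ?case
  proof (cases "x / s \<in> E")
    case True
    with s show ?thesis by auto
  next
    case False
    then have sx: "s / x \<in> E" using val[of "x / s"] by simp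
    have "y / x \<in> E" if "y \<in> A" for y
      using hom_on_mult(1)[OF hom s(2)[OF that] sx] nz by simp
    moreover have "x / x \<in> E" using nz hom_on_1[OF hom] by simp
    ultimately show ?thesis by auto
  qed
qed

text \<open>The entries of \<open>S\<close> matter only up to a common scalar and therefore reduce
  like a point of projective space; the Pluecker relations are homogeneous and survive the
  rescaling. The equation itself forces \<open>v\<close> to be integral.\<close>

lemma place_reduction:
  fixes e :: "'r::idom \<Rightarrow> 'f::field" and \<kappa> :: "'r \<Rightarrow> 'k::alg_closed_field"
  assumes e: "e 1 = 1" "\<And>x y. e (x + y) = e x + e y" "\<And>x y. e (x * y) = e x * e y" "inj e"
    and \<kappa>: "\<kappa> 1 = 1" "\<And>x y. \<kappa> (x + y) = \<kappa> x + \<kappa> y" "\<And>x y. \<kappa> (x * y) = \<kappa> x * \<kappa> y"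
    and eq: "tensor_eq n (Suc k) (\<lambda>i. map_poly e (N i)) v S" and pl: "pluecker n (Suc k) S"
    and nz: "I0 \<in> idx n (Suc k)" "S I0 \<noteq> 0"
  shows "\<exists>v' S'. tensor_eq n (Suc k) (\<lambda>i. map_poly \<kappa> (N i)) v' S' \<and> pluecker n (Suc k) S' \<and>
    (\<exists>I\<in>idx n (Suc k). S' I \<noteq> 0)"
proof -
  let ?X = "idx n (Suc k)"
  define \<phi>0 where "\<phi>0 = (\<lambda>x. \<kappa> (inv_into UNIV e x))"
  have \<phi>0: "\<phi>0 (e r) = \<kappa> r" for r using e(4) by (simp add: \<phi>0_def)
  have e0: "e 0 = 0" using e(2)[of 0 0] by (metis add.right_neutral add_left_cancel)
  have \<kappa>0: "\<kappa> 0 = 0" using \<kappa>(2)[of 0 0] by (metis add.right_neutral add_left_cancel)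
  have em: "e (- x) = - e x" for x using e(2)[of x "- x"] e0 by (simp add: eq_neg_iff_add_eq_0 add.commute)
  have hom0: "hom_on (range e) \<phi>0" unfolding hom_on_def
  proof (intro conjI ballI)
    show "1 \<in> range e" "\<phi>0 1 = 1" using e(1) \<kappa>(1) \<phi>0[of 1] by (auto intro: range_eqI[of _ e 1])
    fix x assume "x \<in> range e"
    then obtain x' where x: "x = e x'" by auto
    show "- x \<in> range e" unfolding x em[symmetric] by simp
    fix y assume "y \<in> range e"
    then obtain y' where y: "y = e y'" by auto
    show "x + y \<in> range e" "x * y \<in> range e" "\<phi>0 (x + y) = \<phi>0 x + \<phi>0 y" "\<phi>0 (x * y) = \<phi>0 x * \<phi>0 y"
      unfolding x y e(2,3)[symmetric] \<phi>0 \<kappa>(2,3) by auto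
  qed
  obtain E \<phi> where hom: "hom_on E \<phi>" and ext: "range e \<subseteq> E" "\<And>x. x \<in> range e \<Longrightarrow> \<phi> x = \<phi>0 x"
    and place: "\<And>x. x \<notin> E \<Longrightarrow> inverse x \<in> E \<and> \<phi> (inverse x) = 0"
    by (rule place_exists[OF hom0]) (assumption | rule that)+
  note P = polys_over_add[OF hom] polys_over_mult[OF hom] polys_over_sum[OF hom] polys_over_diff[OF hom]
    polys_over_0[OF hom] polys_over_pderiv[OF hom] polys_over_minus[OF hom] polys_over_power[OF hom]
  note H = map_poly_hom_add[OF hom] map_poly_hom_mult[OF hom] map_poly_hom_sum[OF hom] map_poly_hom_diff[OF hom]
    map_poly_hom_pderiv[OF hom] map_poly_hom_minus[OF hom] map_poly_hom_power[OF hom] map_poly_hom_1[OF hom]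
  let ?red = "map_poly \<phi>" and ?P = "polys_over E"
  have NE: "map_poly e (N i) \<in> ?P" for i
    using ext(1) by (auto simp: polys_over_def coeff_map_poly e0)
  have redN: "?red (map_poly e (N i)) = map_poly \<kappa> (N i)" for i
    by (rule poly_eqI) (simp add: coeff_map_hom[OF hom] coeff_map_poly e0 \<kappa>0 ext(2) \<phi>0)
  let ?G = "comp_mat n (\<lambda>i. map_poly e (N i))"
  have GE: "?G l l' \<in> ?P" for l l' unfolding comp_mat_def by (intro P) (auto simp: NE P)
  have redG: "?red (?G l l') = comp_mat n (\<lambda>i. map_poly \<kappa> (N i)) l l'" for l l'
    unfolding comp_mat_def by (subst H) (auto simp: NE P redN)
  \<comment> \<open>The nonzero coefficients of \<open>S\<close>. Division by one of least valuation
    moves all of them into \<open>E\<close> and turns one into 1, so that the reduction is not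
    zero.\<close>
  define C where "C = (\<Union>I\<in>?X. set (coeffs (S I))) - {0}"
  have "finite C" by (auto simp: C_def)
  moreover have "lead_coeff (S I0) \<in> C" "0 \<notin> C"
    using nz coeff_in_coeffs[of "S I0" "degree (S I0)"] by (auto simp: C_def)
  ultimately obtain s where s: "s \<in> C" "\<And>x. x \<in> C \<Longrightarrow> x / s \<in> E"
    using dividing_element[of C E \<phi>] place hom by blast
  have s0: "s \<noteq> 0" using s(1) by (auto simp: C_def)
  define S1 where "S1 = (\<lambda>I. smult (inverse s) (S I))"
  have S1E: "S1 I \<in> ?P" if "I \<in> ?X" for I unfolding polys_over_def mem_Collect_eq
  proof
    fix i
    show "coeff (S1 I) i \<in> E"
    proof (cases "coeff (S I) i = 0")
      case False
      then have "coeff (S I) i \<in> C" using that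
        by (auto simp: C_def intro!: bexI[of _ I] coeff_in_coeffs le_degree)
      from s(2)[OF this] show ?thesis by (simp add: S1_def divide_inverse mult.commute)
    qed (simp add: S1_def hom_on_0[OF hom])
  qed
  obtain I1 j1 where I1: "I1 \<in> ?X" "coeff (S1 I1) j1 = 1"
  proof -
    from s(1) obtain I where I: "I \<in> ?X" "s \<in> set (coeffs (S I))" by (auto simp: C_def)
    then obtain j where "s = coeff (S I) j" by (auto simp: coeffs_def split: if_splits)
    with I s0 that[of I j] show ?thesis by (simp add: S1_def)
  qed
  have redI1: "?red (S1 I1) \<noteq> 0"
  proof
    assume "?red (S1 I1) = 0"
    then have "coeff (?red (S1 I1)) j1 = 0" by simp
    then show False by (simp add: coeff_map_hom[OF hom] I1 hom_on_1[OF hom])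
  qed
  define Z where "Z = (\<lambda>I. map_poly e (N n) * pderiv (S1 I) + tact n ?G S1 I)"
  have upd: "I[i := l] \<in> ?X" if "I \<in> ?X" "l < n" for I i l using that by (rule idx_update)
  have ZE: "Z I \<in> ?P" if "I \<in> ?X" for I
    unfolding Z_def tact_def by (intro P NE GE S1E upd that) auto
  have redZ: "?red (Z I) = map_poly \<kappa> (N n) * pderiv (?red (S1 I)) +
      tact n (comp_mat n (\<lambda>i. map_poly \<kappa> (N i))) (\<lambda>I. ?red (S1 I)) I" if I: "I \<in> ?X" for I
  proof -
    have t: "?G a b * S1 (I[i := l]) \<in> ?P" if "l < n" for a b i l by (intro P GE S1E upd I that)
    have "?red (Z I) = ?red (map_poly e (N n) * pderiv (S1 I)) + ?red (tact n ?G S1 I)"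
      unfolding Z_def tact_def by (intro H P NE S1E I t) auto
    also have "?red (map_poly e (N n) * pderiv (S1 I)) = map_poly \<kappa> (N n) * pderiv (?red (S1 I))"
      using H(2)[OF NE P(6)[OF S1E[OF I]]] H(5)[OF S1E[OF I]] by (simp add: redN)
    also have "?red (tact n ?G S1 I) = (\<Sum>i<length I. \<Sum>l<n. ?red (?G (I ! i) l * S1 (I[i := l])))"
      unfolding tact_def by (subst H(3), intro P t, simp, intro sum.cong refl H(3) t, simp)
    also have "\<dots> = tact n (comp_mat n (\<lambda>i. map_poly \<kappa> (N i))) (\<lambda>I. ?red (S1 I)) I"
      unfolding tact_def by (intro sum.cong refl) (simp add: H(2)[OF GE S1E[OF upd[OF I]]] redG)
    finally show ?thesis .
  qed
  have ZS: "Z I = v * S1 I" if "I \<in> ?X" for I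
  proof -
    have "tact n ?G (\<lambda>I. [:inverse s:] * S I) I = [:inverse s:] * tact n ?G S I" by (rule tact_smult_right)
    then have "Z I = smult (inverse s) (map_poly e (N n) * pderiv (S I) + tact n ?G S I)"
      by (simp add: Z_def S1_def pderiv_smult smult_add_right)
    also have "\<dots> = v * S1 I" using eq that by (simp add: tensor_eq_def S1_def)
    finally show ?thesis .
  qed
  have vE: "v \<in> ?P"
  proof (rule ccontr)
    assume "v \<notin> ?P"
    then obtain j where j: "coeff v j \<notin> E" by (auto simp: polys_over_def)
    define V where "V = set (coeffs v) - {0}"
    have jV: "coeff v j \<in> V" using j hom_on_0[OF hom]
      by (auto simp: V_def intro!: coeff_in_coeffs le_degree)
    have "finite V" "V \<noteq> {}" "0 \<notin> V" using jV by (auto simp: V_def)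
    then obtain t where t: "t \<in> V" "\<And>x. x \<in> V \<Longrightarrow> x / t \<in> E"
      using dividing_element[of V E \<phi>] place hom by blast
    have t0: "t \<noteq> 0" using t(1) by (auto simp: V_def)
    have "t \<notin> E"
    proof
      assume "t \<in> E"
      from hom_on_mult(1)[OF hom t(2)[OF jV] this] t0 j show False by simp
    qed
    with place have it: "inverse t \<in> E" "\<phi> (inverse t) = 0" by auto
    \<comment> \<open>Here t is a coefficient of \<open>v\<close> of least valuation, so that v/t
      has nonzero reduction. But (v/t) S1 = Z/t reduces to zero, since 1/t does.\<close>
    define w where "w = smult (inverse t) v"
    have wE: "w \<in> ?P" unfolding polys_over_def mem_Collect_eq
    proof
      fix i
      show "coeff w i \<in> E"
      proof (cases "coeff v i = 0")
        case False
        then have "coeff v i \<in> V" by (auto simp: V_def intro!: coeff_in_coeffs le_degree)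
        from t(2)[OF this] show ?thesis by (simp add: w_def divide_inverse mult.commute)
      qed (simp add: w_def hom_on_0[OF hom])
    qed
    obtain i where i: "coeff v i = t" using t(1) by (auto simp: V_def coeffs_def split: if_splits)
    have "coeff (?red w) i = 1" using t0 by (simp add: coeff_map_hom[OF hom] w_def i hom_on_1[OF hom])
    then have w0: "?red w \<noteq> 0" by auto
    have "?red w * ?red (S1 I1) = ?red (w * S1 I1)" by (rule H(2)[symmetric]) (intro wE S1E I1)+
    also have "w * S1 I1 = [:inverse t:] * Z I1" by (simp add: w_def ZS[OF I1(1)])
    also have "?red \<dots> = ?red [:inverse t:] * ?red (Z I1)"
      by (rule H(2)) (intro ZE I1 polys_over_pCons[OF hom it(1)] P)+
    also have "\<dots> = 0" by (simp add: map_poly_hom_const[OF hom] it)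
    finally show False using w0 redI1 by simp
  qed
  define S' where "S' = (\<lambda>I. ?red (S1 I))"
  have "tensor_eq n (Suc k) (\<lambda>i. map_poly \<kappa> (N i)) (?red v) S'"
    unfolding tensor_eq_def
  proof
    fix I assume I: "I \<in> ?X"
    have "?red (Z I) = ?red v * S' I" unfolding ZS[OF I] S'_def by (rule H(2)[OF vE S1E[OF I]])
    then show "map_poly \<kappa> (N n) * pderiv (S' I) + tact n (comp_mat n (\<lambda>i. map_poly \<kappa> (N i))) S' I = ?red v * S' I"
      using redZ[OF I] by (simp add: S'_def)
  qed
  moreover have "pluecker n (Suc k) S'" unfolding pluecker_def
  proof (intro ballI)
    fix I J assume I: "I \<in> idx n (Suc (Suc k))" and J: "J \<in> idx n (Suc k - 1)"
    note i1 = S1E[OF idx_nth_Cons[OF I J _ zero_less_Suc]] and i2 = S1E[OF idx_omit[OF I]]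
    let ?t = "\<lambda>i. (-1) ^ i * S1 (I ! i # J) * S1 (omit i I)"
    have "(\<Sum>i\<le>Suc k. ?t i) = [:inverse s * inverse s:] * plsum (Suc k) (\<lambda>l. S (l # J)) S I"
      unfolding plsum_def sum_distrib_left by (intro sum.cong refl) (simp add: S1_def)
    also have "\<dots> = 0" using pl I J unfolding pluecker_def by simp
    finally have 0: "(\<Sum>i\<le>Suc k. ?t i) = 0" .
    have 1: "1 \<in> ?P" using P(8)[of 0 0] P(5) by simp
    have m1: "(-1) ^ i \<in> ?P" for i by (intro P 1)
    have "plsum (Suc k) (\<lambda>l. S' (l # J)) S' I = (\<Sum>i\<le>Suc k. ?red (?t i))"
      unfolding plsum_def
    proof (rule sum.cong[OF refl])
      fix i assume "i \<in> {..Suc k}"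
      then have i: "i \<le> Suc k" by simp
      have "?red ((-1) ^ i) = (-1) ^ i" using H(7)[OF P(7)[OF 1]] H(6)[OF 1] H(8) by simp
      then show "(-1) ^ i * S' (I ! i # J) * S' (omit i I) = ?red (?t i)"
        unfolding S'_def using H(2)[OF P(2)[OF m1 i1[OF i]] i2[OF i]] H(2)[OF m1 i1[OF i]] by simp
    qed
    also have "\<dots> = ?red (\<Sum>i\<le>Suc k. ?t i)"
      by (rule H(3)[symmetric]) (intro P m1 i1 i2, auto)
    finally show "plsum (Suc k) (\<lambda>l. S' (l # J)) S' I = 0" unfolding 0 by simp
  qed
  moreover have "S' I1 \<noteq> 0" using redI1 by (simp add: S'_def)
  ultimately show ?thesis using I1(1) by blast
qed

text \<open>The action on tensors becomes a single matrix with rows and columns in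
  \<open>idx n k\<close>. Different slots and values may lead to the same list, which is why its
  entries are sums of conditionals.\<close>

lemma (in field_derivation) residue_tensor:
  assumes \<alpha>: "\<And>l l'. fls_map d (\<alpha> l l') = 0"
    and eq: "\<And>I. I \<in> idx n k \<Longrightarrow> fls_deriv (Y I) + tact n \<alpha> Y I = u * Y I"
    and nz: "I0 \<in> idx n k" "Y I0 \<noteq> 0"
  shows "d (u $$ (-1)) = 0"
proof -
  let ?A = "\<lambda>I J. \<Sum>i<k. \<Sum>l<n. if J = I[i := l] then \<alpha> (I ! i) l else 0"
  show ?thesis
  proof (rule residue_d_eq_0[where S="idx n k" and Y=Y and A="?A" and u=u and ?i0.0=I0])
  show "fls_map d (?A I J) = 0" for I J
    unfolding dfls_sum by (intro sum.neutral ballI) (simp add: \<alpha>)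
  fix I assume I: "I \<in> idx n k"
  have "(\<Sum>J\<in>idx n k. ?A I J * Y J) =
      (\<Sum>J\<in>idx n k. \<Sum>i<k. \<Sum>l<n. if J = I[i := l] then \<alpha> (I ! i) l * Y (I[i := l]) else 0)"
    unfolding sum_distrib_right by (intro sum.cong refl) auto
  also have "\<dots> = (\<Sum>i<k. \<Sum>l<n. \<Sum>J\<in>idx n k. if J = I[i := l] then \<alpha> (I ! i) l * Y (I[i := l]) else 0)"
    by (subst sum.swap) (intro sum.cong refl sum.swap)
  also have "\<dots> = tact n \<alpha> Y I"
    using I idx_update[OF I] by (simp add: tact_def) (simp add: idx_def)
  finally show "fls_deriv (Y I) + (\<Sum>J\<in>idx n k. ?A I J * Y J) = u * Y I" using eq[OF I] by simp
  qed (use nz in auto)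
qed

lemma (in field_derivation) dfls_eval:
  assumes "fls_map d \<xi> = 0"
  shows "fls_map d (fls_eval \<xi> q) = fls_eval \<xi> (map_poly d q)"
proof -
  have c: "fls_map d (fls_const a) = fls_const (d a)" for a
    by (rule fls_eqI) auto
  show ?thesis by (induction q) (auto simp: map_poly_pCons dfls_add dfls_mult assms c)
qed

lemma fls_eval_X_inv_nth:
  assumes "i > 0"
  shows "fls_eval fls_X_inv q $$ i = 0"
  using assms by (induction q arbitrary: i) (auto simp: fls_X_inv_times_conv_shift)

lemma fls_eval_X_inv_nonzero:
  assumes "q \<noteq> 0"
  shows "fls_eval fls_X_inv q \<noteq> 0"
proof
  assume "fls_eval fls_X_inv q = 0"
  then have "fps_to_fls (rev_fps (degree q) q) = 0" by (subst rev_fps_fls) auto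
  then have "rev_fps (degree q) q $ 0 = 0" by simp
  then show False using assms by (simp add: rev_fps_def)
qed

text \<open>In the coordinate $t = 1/x$ the derivation $d/dx$ is $-t^2\,d/dt$; the solution is $t^m S(1/t)$.\<close>

lemma tensor_eq_at_infinity:
  fixes N :: "nat \<Rightarrow> 'a::field_char_0 poly"
  assumes eq: "tensor_eq n k N v S" and N: "\<And>i. i \<le> n \<Longrightarrow> degree (N i) \<le> d" and v: "degree v \<le> d"
    and m: "\<And>I. I \<in> idx n k \<Longrightarrow> degree (S I) \<le> m" and I: "I \<in> idx n k"
  shows "rev_fps d (N n) * (fps_const (of_nat m) * fps_X * rev_fps m (S I) - fps_X ^ 2 * fps_deriv (rev_fps m (S I))) +
    tact n (\<lambda>l l'. rev_fps d (comp_mat n N l l')) (\<lambda>I. rev_fps m (S I)) I = rev_fps d v * rev_fps m (S I)"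
proof -
  let ?e = "fls_eval (fls_X_inv :: 'a fls)" and ?X = "fls_X :: 'a fls" and ?T = "fls_X_inv :: 'a fls"
  let ?Y = "\<lambda>I. fps_to_fls (rev_fps m (S I))"
  have XT: "?X * ?T = 1" by (simp flip: fls_inverse_X)
  have Y: "?Y J = ?X ^ m * ?e (S J)" if "J \<in> idx n k" for J using m[OF that] by (rule rev_fps_fls)
  \<comment> \<open>Differentiating t^m produces the term m t Y; this is where the degree enters the
    equation.\<close>
  have dY: "?X ^ 2 * fls_deriv (?Y I) = of_nat m * ?X * ?Y I - ?X ^ m * ?e (pderiv (S I))"
  proof -
    have dX: "?X * fls_deriv (?X ^ m) = of_nat m * ?X ^ m"
      by (induction m) (simp_all add: algebra_simps)
    have dT: "fls_deriv ?T = - ?T * ?T"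
    proof -
      have "fls_deriv (?X * ?T) = 0" unfolding XT by simp
      then have "?X * fls_deriv ?T = - ?T" unfolding fls_deriv_mult by (simp add: eq_neg_iff_add_eq_0)
      then have "?T * (?X * fls_deriv ?T) = - ?T * ?T" by simp
      then show ?thesis using XT by (metis mult.assoc mult.commute mult_1)
    qed
    have "?X ^ 2 * fls_deriv (?Y I) = ?X ^ 2 * (?X ^ m * fls_deriv (?e (S I))) + ?X * (?X * fls_deriv (?X ^ m)) * ?e (S I)"
      unfolding Y[OF I] fls_deriv_mult by (simp add: algebra_simps power2_eq_square)
    also have "?X ^ 2 * (?X ^ m * fls_deriv (?e (S I))) = - ((?X * ?T) ^ 2 * (?X ^ m * ?e (pderiv (S I))))"
      unfolding fls_deriv_eval dT by (simp add: power2_eq_square mult_ac)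
    finally show ?thesis unfolding dX XT Y[OF I] by (simp add: mult_ac)
  qed
  have Gd: "degree (comp_mat n N l l') \<le> d" if "l < n" for l l'
    using N that by (intro degree_comp_mat) auto
  have "?e (N n * pderiv (S I) + tact n (comp_mat n N) S I) = ?e (v * S I)"
    using eq I by (simp add: tensor_eq_def)
  then have ev: "?e (N n) * ?e (pderiv (S I)) + tact n (\<lambda>l l'. ?e (comp_mat n N l l')) (\<lambda>I. ?e (S I)) I = ?e v * ?e (S I)"
    by (simp add: fls_eval_add fls_eval_mult tact_hom[of ?e])
  have "fps_to_fls (rev_fps d (N n) * (fps_const (of_nat m) * fps_X * rev_fps m (S I) - fps_X ^ 2 * fps_deriv (rev_fps m (S I))) +
    tact n (\<lambda>l l'. rev_fps d (comp_mat n N l l')) (\<lambda>I. rev_fps m (S I)) I) =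
    ?X ^ d * ?e (N n) * (of_nat m * ?X * ?Y I - ?X ^ 2 * fls_deriv (?Y I)) +
    tact n (\<lambda>l l'. fps_to_fls (rev_fps d (comp_mat n N l l'))) ?Y I"
    using N[of n]
    by (simp add: fls_times_fps_to_fls fps_to_fls_power fls_deriv_fps_to_fls rev_fps_fls[of "N n"]
        tact_hom[of fps_to_fls] fls_of_nat)
  also have "tact n (\<lambda>l l'. fps_to_fls (rev_fps d (comp_mat n N l l'))) ?Y I =
      tact n (\<lambda>l l'. ?X ^ d * ?e (comp_mat n N l l')) (\<lambda>I. ?X ^ m * ?e (S I)) I"
    using Gd by (intro tact_cong[OF I] Y) (simp_all add: rev_fps_fls)
  also have "\<dots> = ?X ^ d * ?X ^ m * tact n (\<lambda>l l'. ?e (comp_mat n N l l')) (\<lambda>I. ?e (S I)) I"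
    by (simp add: tact_smult_left tact_smult_right)
  also have "?X ^ d * ?e (N n) * (of_nat m * ?X * ?Y I - ?X ^ 2 * fls_deriv (?Y I)) + \<dots> =
      ?X ^ d * ?X ^ m * (?e (N n) * ?e (pderiv (S I)) + tact n (\<lambda>l l'. ?e (comp_mat n N l l')) (\<lambda>I. ?e (S I)) I)"
    unfolding dY by (simp add: algebra_simps)
  also have "\<dots> = fps_to_fls (rev_fps d v * rev_fps m (S I))"
    unfolding ev using v by (simp add: fls_times_fps_to_fls rev_fps_fls Y[OF I] mult_ac)
  finally show ?thesis by (simp only: fps_to_fls_eq_iff)
qed

section \<open>Specialization\<close>

lemma divide_equation:
  fixes e :: "'a::field"
  assumes "e \<noteq> 0" "e * y + t = v * z"
  shows "y + inverse e * t = v / e * z"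
  using assms by (simp add: field_simps)

lemma unital_ring_hom_hom_on: "unital_ring_hom h \<Longrightarrow> hom_on UNIV h"
  by (simp add: unital_ring_hom_def hom_on_def)

lemma polys_over_UNIV [simp]: "polys_over UNIV = UNIV"
  by (simp add: polys_over_def)

lemma (in field_derivation) map_poly_d_comp_mat:
  assumes "\<And>i. map_poly d (N i) = 0"
  shows "map_poly d (comp_mat n N l l') = 0"
proof -
  have "d (coeff (N i) j) = 0" for i j
    using arg_cong[OF assms[of i], of "\<lambda>p. coeff p j"] by (simp add: coeff_map_poly)
  then show ?thesis by (intro poly_eqI) (simp add: coeff_map_poly comp_mat_def d_diff)
qed

section \<open>The embedding of the coordinate ring into the ultrapower\<close>

definition base :: "'r::idom \<Rightarrow> ('r, 'c::{alg_closed_field, field_char_0}) ultrapower" where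
  "base r = ult (\<lambda>c. c r)"

context
  assumes hom: "almost_all (\<lambda>c::'r::idom \<Rightarrow> 'c::{alg_closed_field, field_char_0}. unital_ring_hom c)"
    and sep: "\<And>S. finite S \<Longrightarrow> almost_all (\<lambda>c::'r \<Rightarrow> 'c. inj_on c (group_closure S))"
begin

lemma hom_0: "almost_all (\<lambda>c::'r \<Rightarrow> 'c. c 0 = 0)"
  using hom by (rule eventually_mono) (rule hom_on_0(2)[OF unital_ring_hom_hom_on])

lemma almost_all_imp_ex: "almost_all (P :: ('r \<Rightarrow> 'c) \<Rightarrow> bool) \<Longrightarrow> \<exists>c. P c"
  using bad_ultrafilter(1) eventually_happens[of P bad_ultrafilter]
  by (auto simp: ultrafilter_def)

lemma base_hom: "base 1 = (1 :: ('r, 'c) ultrapower)" "base (x + y) = (base x + base y :: ('r, 'c) ultrapower)"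
  "base (x * y) = (base x * base y :: ('r, 'c) ultrapower)"
proof -
  show "base 1 = (1 :: ('r, 'c) ultrapower)" unfolding base_def ult_1[symmetric] ult_eq_iff
    using hom by (rule eventually_mono) (simp add: unital_ring_hom_def)
  show "base (x + y) = (base x + base y :: ('r, 'c) ultrapower)" unfolding base_def ult_add[symmetric] ult_eq_iff
    using hom by (rule eventually_mono) (simp add: unital_ring_hom_def)
  show "base (x * y) = (base x * base y :: ('r, 'c) ultrapower)" unfolding base_def ult_mult[symmetric] ult_eq_iff
    using hom by (rule eventually_mono) (simp add: unital_ring_hom_def)
qed

lemma base_0: "base 0 = (0 :: ('r, 'c) ultrapower)"
  unfolding base_def ult_eq_0_iff by (rule hom_0)

text \<open>Elements with the same image agree at some c that is injective on the group they
  generate.\<close>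

lemma inj_base: "inj (base :: 'r \<Rightarrow> ('r, 'c) ultrapower)"
proof (rule injI)
  fix x y assume "base x = (base y :: ('r, 'c) ultrapower)"
  then have "almost_all (\<lambda>c::'r \<Rightarrow> 'c. c x = c y)" by (simp add: base_def ult_eq_iff)
  with sep[of "{x, y}"] have "almost_all (\<lambda>c::'r \<Rightarrow> 'c. inj_on c (group_closure {x, y}) \<and> c x = c y)"
    by (auto intro: eventually_conj)
  from almost_all_imp_ex[OF this] obtain c :: "'r \<Rightarrow> 'c" where "inj_on c (group_closure {x, y})" "c x = c y" by auto
  then show "x = y" by (auto simp: inj_on_def intro: group_closure.base)
qed

lemma coeff_map_base: "coeff (map_poly (base :: 'r \<Rightarrow> ('r, 'c) ultrapower) p) i = base (coeff p i)"
  by (simp add: coeff_map_poly base_0)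

lemma base_eq_0_iff: "base x = (0 :: ('r, 'c) ultrapower) \<longleftrightarrow> x = 0"
  using injD[OF inj_base, of x 0] base_0 by auto

lemma map_poly_base_nonzero: "p \<noteq> 0 \<Longrightarrow> map_poly (base :: 'r \<Rightarrow> ('r, 'c) ultrapower) p \<noteq> 0"
  by (auto simp: poly_eq_iff coeff_map_base base_eq_0_iff)

lemma almost_all_nonzero: "x \<noteq> 0 \<Longrightarrow> almost_all (\<lambda>c::'r \<Rightarrow> 'c. c x \<noteq> 0)"
  using base_eq_0_iff[of x]
  by (simp add: base_def ult_eq_0_iff ultrafilter_not[OF bad_ultrafilter(1)])

lemma almost_all_map_poly_nonzero:
  assumes "p \<noteq> 0"
  shows "almost_all (\<lambda>c::'r \<Rightarrow> 'c. map_poly c p \<noteq> 0)"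
proof -
  have "almost_all (\<lambda>c::'r \<Rightarrow> 'c. c (lead_coeff p) \<noteq> 0)"
    by (rule almost_all_nonzero) (use assms in simp)
  with hom_0 show ?thesis
    by (rule eventually_elim2) (metis coeff_map_poly coeff_0)
qed

lemma degree_map_poly_base:
  "degree (map_poly (base :: 'r \<Rightarrow> ('r, 'c) ultrapower) p) \<le> degree p" "almost_all (\<lambda>c::'r \<Rightarrow> 'c. degree (map_poly c p) \<le> degree p)"
proof -
  show "degree (map_poly (base :: 'r \<Rightarrow> ('r, 'c) ultrapower) p) \<le> degree p"
    by (rule degree_le) (simp add: coeff_map_poly base_0 coeff_eq_0)
  show "almost_all (\<lambda>c::'r \<Rightarrow> 'c. degree (map_poly c p) \<le> degree p)"
    using hom_0 by (rule eventually_mono) (rule degree_le, simp add: coeff_map_poly coeff_eq_0)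
qed

lemma poly_lim_base: "poly_lim (\<lambda>c. map_poly c p) (map_poly (base :: 'r \<Rightarrow> ('r, 'c) ultrapower) p)"
  unfolding poly_lim_def
proof (intro conjI allI exI)
  show "almost_all (\<lambda>c::'r \<Rightarrow> 'c. degree (map_poly c p) \<le> degree p)" by (rule degree_map_poly_base)
  fix k
  show "coeff (map_poly (base :: 'r \<Rightarrow> ('r, 'c) ultrapower) p) k = ult (\<lambda>c. coeff (map_poly c p) k)"
    unfolding coeff_map_base unfolding base_def ult_eq_iff
    using hom_0 by (rule eventually_mono) (simp add: coeff_map_poly)
qed

text \<open>The group of all $\sum_i p_i m^i$ is generated by the coefficients of \<open>p\<close>, whatever the
  integer \<open>m\<close>: this is where ad-open sets, as opposed to Zariski open ones, are needed.\<close>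

lemma bounded_if_algebraic:
  fixes M :: "('r \<Rightarrow> 'c) \<Rightarrow> nat" and p :: "'r poly"
  assumes p: "p \<noteq> 0" and root: "poly (map_poly base p) (ult (\<lambda>c. of_nat (M c))) = 0"
  shows "\<exists>B. almost_all (\<lambda>c. M c \<le> B)"
proof -
  let ?C = "set (coeffs p)"
  \<comment> \<open>C[X] has characteristic zero because some c maps it to a field of characteristic
    zero. Hence \<open>p\<close> has only finitely many natural roots.\<close>
  have "inj (of_nat :: nat \<Rightarrow> 'r)"
  proof (rule injI)
    fix k l assume kl: "(of_nat k :: 'r) = of_nat l"
    obtain c :: "'r \<Rightarrow> 'c" where "unital_ring_hom c" using almost_all_imp_ex[OF hom] by blast
    from hom_on_of_nat(2)[OF unital_ring_hom_hom_on[OF this]] kl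
    have "(of_nat k :: 'c) = of_nat l" by metis
    then show "k = l" by simp
  qed
  then have "finite (of_nat -` {x. poly p x = 0} :: nat set)"
    by (intro finite_vimageI poly_roots_finite p)
  then obtain B where B: "\<And>m. poly p (of_nat m) = 0 \<Longrightarrow> m \<le> B"
    by (auto simp: finite_nat_set_iff_bounded_le)
  have "poly (map_poly base p) (ult (\<lambda>c. of_nat (M c))) =
      ult (\<lambda>c. \<Sum>i\<le>degree p. c (coeff p i) * of_nat (M c) ^ i)"
    unfolding poly_eq_sum[OF degree_map_poly_base(1)] coeff_map_base ult_sum ult_mult ult_power
    by (simp add: base_def)
  with root have "almost_all (\<lambda>c. (\<Sum>i\<le>degree p. c (coeff p i) * of_nat (M c) ^ i) = 0)"
    by (simp add: ult_eq_0_iff)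
  with hom sep[of ?C] have "almost_all (\<lambda>c. unital_ring_hom c \<and> inj_on c (group_closure ?C) \<and>
      (\<Sum>i\<le>degree p. c (coeff p i) * of_nat (M c) ^ i) = 0)"
    by (auto intro: eventually_conj)
  then have "almost_all (\<lambda>c. M c \<le> B)"
  proof (rule eventually_mono)
    fix c :: "'r \<Rightarrow> 'c"
    assume c: "unital_ring_hom c \<and> inj_on c (group_closure ?C) \<and>
      (\<Sum>i\<le>degree p. c (coeff p i) * of_nat (M c) ^ i) = 0"
    note h = unital_ring_hom_hom_on[of c]
    have "c (poly p (of_nat (M c))) = (\<Sum>i\<le>degree p. c (coeff p i) * of_nat (M c) ^ i)"
      unfolding poly_altdef using c
      by (simp add: hom_on_sum(2)[OF h] hom_on_mult(2)[OF h] hom_on_power(2)[OF h] hom_on_of_nat(2)[OF h])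
    then have "c (poly p (of_nat (M c))) = c 0" using c hom_on_0(2)[OF h] by simp
    moreover have "poly p (of_nat (M c)) \<in> group_closure ?C"
    proof -
      have sum: "(\<Sum>i\<in>A. f i) \<in> group_closure ?C" if "\<And>i. i \<in> A \<Longrightarrow> f i \<in> group_closure ?C"
        for A and f :: "nat \<Rightarrow> 'r"
        using that by (induction A rule: infinite_finite_induct) (auto intro: group_closure_add)
      have "coeff p i * of_nat (M c ^ i) \<in> group_closure ?C" if "i \<le> degree p" for i
        using that p by (intro group_closure_scalar_mult_right group_closure.base) (simp add: coeff_in_coeffs)
      then show ?thesis unfolding poly_altdef by (intro sum) simp
    qed
    ultimately have "poly p (of_nat (M c)) = 0" using c by (auto simp: inj_on_def)
    then show "M c \<le> B" by (rule B)
  qed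
  then show ?thesis ..
qed

text \<open>\<kappa> will be the embedding of C[X] into an algebraic closure of C(X). Reducibility
  at almost all points is carried to the generic point in the form of the tensor equation with the
  Pluecker relations, which can be stated over every field.\<close>

lemma reducible_generic:
  fixes N :: "nat \<Rightarrow> 'r poly" and \<kappa> :: "'r \<Rightarrow> 'k::alg_closed_field"
  assumes N: "N n \<noteq> 0"
    and red: "almost_all (\<lambda>c::'r \<Rightarrow> 'c. reducible_skew (op_of n (\<lambda>i. map_poly c (N i))))"
    and \<kappa>: "unital_ring_hom \<kappa>" "map_poly \<kappa> (N n) \<noteq> 0"
  shows "reducible_skew (op_of n (\<lambda>i. map_poly \<kappa> (N i)))"
proof -
  let ?N = "\<lambda>c i. map_poly c (N i)"
  define sol where "sol = (\<lambda>k (c :: 'r \<Rightarrow> 'c) vS. Suc k < n \<and> tensor_eq n (Suc k) (?N c) (fst vS) (snd vS) \<and>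
      pluecker n (Suc k) (snd vS) \<and> (\<forall>x. \<exists>I\<in>idx n (Suc k). poly (snd vS I) x \<noteq> 0))"
  have "almost_all (\<lambda>c. \<exists>k\<in>{..<n}. \<exists>vS. sol k c vS)"
    using red almost_all_map_poly_nonzero[OF N]
  proof (rule eventually_elim2)
    fix c :: "'r \<Rightarrow> 'c"
    assume "reducible_skew (op_of n (?N c))" "map_poly c (N n) \<noteq> 0"
    from reducible_imp_tensor_eq[OF this(2,1)] obtain k v S where
      "Suc k < n" "tensor_eq n (Suc k) (?N c) v S" "pluecker n (Suc k) S"
      "\<forall>x. \<exists>I\<in>idx n (Suc k). poly (S I) x \<noteq> 0" by blast
    then show "\<exists>k\<in>{..<n}. \<exists>vS. sol k c vS"
      unfolding sol_def by (intro bexI[of _ k] exI[of _ "(v, S)"]) auto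
  qed
  \<comment> \<open>The order of the left factor has finitely many possible values, so one of them
    occurs for almost all c.\<close>
  from ultrafilter_bex[OF bad_ultrafilter(1) finite_lessThan this]
  obtain k where "almost_all (\<lambda>c. \<exists>vS. sol k c vS)" by (elim bexE)
  then obtain vS where vS: "almost_all (\<lambda>c. sol k c (vS c))"
    unfolding eventually_ex by blast
  define v where "v = (\<lambda>c. fst (vS c))"
  define S where "S = (\<lambda>c. snd (vS c))"
  let ?X = "idx n (Suc k)"
  have kn: "Suc k < n" using almost_all_imp_ex[OF vS] by (auto simp: sol_def)
  have eq: "almost_all (\<lambda>c. tensor_eq n (Suc k) (?N c) (v c) (S c))"
    and pl: "almost_all (\<lambda>c. pluecker n (Suc k) (S c))"
    and prim: "almost_all (\<lambda>c. \<forall>x. \<exists>I\<in>?X. poly (S c I) x \<noteq> 0)"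
    using vS unfolding v_def S_def sol_def by (auto elim: eventually_mono)
  define d where "d = (\<Sum>i\<le>n. degree (N i))"
  have d: "degree (N i) \<le> d" if "i \<le> n" for i
    unfolding d_def by (rule member_le_sum) (use that in auto)
  have degN: "almost_all (\<lambda>c::'r \<Rightarrow> 'c. \<forall>i\<in>{..n}. degree (?N c i) \<le> d)"
  proof (intro eventually_ball_finite ballI)
    fix i assume "i \<in> {..n}"
    then show "almost_all (\<lambda>c::'r \<Rightarrow> 'c. degree (?N c i) \<le> d)"
      using degree_map_poly_base(2)[of "N i"] d[of i] by (auto elim: eventually_mono)
  qed simp
  have degv: "almost_all (\<lambda>c. degree (v c) \<le> d)"
    using eventually_conj[OF eq eventually_conj[OF degN prim]]
  proof (rule eventually_mono, elim conjE)
    fix c assume c: "tensor_eq n (Suc k) (?N c) (v c) (S c)" "\<forall>i\<in>{..n}. degree (?N c i) \<le> d"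
      "\<forall>x. \<exists>I\<in>?X. poly (S c I) x \<noteq> 0"
    from c(3) obtain I where "I \<in> ?X" "poly (S c I) 0 \<noteq> 0" by blast
    then show "degree (v c) \<le> d" using c by (intro tensor_eq_degree[OF c(1), of d I]) auto
  qed
  obtain vF where vF: "poly_lim v vF" "degree vF \<le> d" using poly_lim_exists[OF degv] .
  let ?NF = "\<lambda>i. map_poly (base :: 'r \<Rightarrow> ('r, 'c) ultrapower) (N i)"
  let ?G = "comp_mat n ?NF"
  have limG: "poly_lim (\<lambda>c. comp_mat n (?N c) l l') (?G l l')" if "l < n" "l' < n" for l l'
    using that by (intro poly_lim_comp_mat poly_lim_base)
  have degNF: "degree (?NF i) \<le> d" if "i \<le> n" for i
    using degree_map_poly_base(1)[of "N i"] d[OF that] by simp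
  have degG: "degree (?G l l') \<le> d" if "l < n" for l l'
    using that degNF by (intro degree_comp_mat) auto
  define M where "M = (\<lambda>c. Max ((\<lambda>I. degree (S c I)) ` ?X))"
  have M: "degree (S c I) \<le> M c" if "I \<in> ?X" for I c unfolding M_def using that by (intro Max_ge) auto
  show ?thesis
  proof (cases "\<exists>B. almost_all (\<lambda>c. M c \<le> B)")
    case True
    then obtain B where B: "almost_all (\<lambda>c. M c \<le> B)" by blast
    have degS: "almost_all (\<lambda>c. degree (S c I) \<le> B)" if "I \<in> ?X" for I
      using B by (rule eventually_mono) (use M[OF that] in \<open>auto intro: order_trans\<close>)
    define SF where "SF = (\<lambda>I. SOME q. poly_lim (\<lambda>c. S c I) q)"
    have SF: "poly_lim (\<lambda>c. S c I) (SF I)" if "I \<in> ?X" for I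
      unfolding SF_def using poly_lim_exists[OF degS[OF that]] by (metis someI)
    have "tensor_eq n (Suc k) ?NF vF SF" unfolding tensor_eq_def
    proof
      fix I assume I: "I \<in> ?X"
      have 1: "poly_lim (\<lambda>c. ?N c n * pderiv (S c I) + tact n (comp_mat n (?N c)) (S c) I)
          (?NF n * pderiv (SF I) + tact n ?G SF I)"
        by (intro poly_lim_add poly_lim_mult poly_lim_pderiv poly_lim_tact[OF I] poly_lim_base SF I limG)
      have "almost_all (\<lambda>c. ?N c n * pderiv (S c I) + tact n (comp_mat n (?N c)) (S c) I = v c * S c I)"
        using eq by (rule eventually_mono) (use I in \<open>auto simp: tensor_eq_def\<close>)
      from poly_lim_cong[OF 1 this] poly_lim_mult[OF vF(1) SF[OF I]]
      show "?NF n * pderiv (SF I) + tact n ?G SF I = vF * SF I" by (rule poly_lim_unique)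
    qed
    moreover have "pluecker n (Suc k) SF" unfolding pluecker_def
    proof (intro ballI)
      fix I J assume I: "I \<in> idx n (Suc (Suc k))" and J: "J \<in> idx n (Suc k - 1)"
      have 1: "poly_lim (\<lambda>c. plsum (Suc k) (\<lambda>l. S c (l # J)) (S c) I) (plsum (Suc k) (\<lambda>l. SF (l # J)) SF I)"
        unfolding plsum_def
        by (intro poly_lim_sum poly_lim_mult poly_lim_power poly_lim_uminus poly_lim_1 SF
            idx_nth_Cons[OF I J] idx_omit[OF I]) auto
      have "almost_all (\<lambda>c. plsum (Suc k) (\<lambda>l. S c (l # J)) (S c) I = 0)"
        using pl by (rule eventually_mono) (use I J in \<open>unfold pluecker_def, blast\<close>)
      from poly_lim_cong[OF 1 this] poly_lim_0
      show "plsum (Suc k) (\<lambda>l. SF (l # J)) SF I = 0" by (rule poly_lim_unique)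
    qed
    \<comment> \<open>With degrees bounded by \<open>B\<close>, nonvanishing concerns finitely many
      coefficients and is therefore preserved in the limit.\<close>
    moreover have "\<exists>I\<in>?X. SF I \<noteq> 0"
    proof (rule ccontr)
      assume "\<not> ?thesis"
      then have z: "almost_all (\<lambda>c. coeff (S c I) j = 0)" if "I \<in> ?X" for I j
        using SF[OF that] that by (auto simp: poly_lim_def simp flip: ult_eq_0_iff)
      have "almost_all (\<lambda>c. \<forall>I\<in>?X. \<forall>j\<in>{..B}. coeff (S c I) j = 0)"
        by (intro eventually_ball_finite ballI z) auto
      with eventually_conj[OF B prim]
      have "almost_all (\<lambda>c::'r \<Rightarrow> 'c. False)"
      proof (rule eventually_elim2, elim conjE)
        fix c assume c: "\<forall>I\<in>?X. \<forall>j\<in>{..B}. coeff (S c I) j = 0" "M c \<le> B" "\<forall>x. \<exists>I\<in>?X. poly (S c I) x \<noteq> 0"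
        from c(3) obtain I where I: "I \<in> ?X" "poly (S c I) 0 \<noteq> 0" by blast
        then have "lead_coeff (S c I) = 0" using c(1,2) M[OF I(1), of c] by auto
        then show False using I by simp
      qed
      then show False using almost_all_imp_ex by blast
    qed
    then obtain I0 where "I0 \<in> ?X" "SF I0 \<noteq> 0" by blast
    ultimately obtain v' S' where "tensor_eq n (Suc k) (\<lambda>i. map_poly \<kappa> (N i)) v' S'" "pluecker n (Suc k) S'"
      "\<exists>I\<in>?X. S' I \<noteq> 0"
      using place_reduction[OF base_hom inj_base, of \<kappa> n k N vF SF I0] \<kappa>(1)
      unfolding unital_ring_hom_def by blast
    then show ?thesis using tensor_eq_imp_reducible[of k n "\<lambda>i. map_poly \<kappa> (N i)", OF kn \<kappa>(2)] by blast
  next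
    case False
    \<comment> \<open>The degree of \<open>S\<close> as an element of the ultrapower. It is
      transcendental over C[X] by \<open>bounded_if_algebraic\<close>, so that its derivative can be
      prescribed.\<close>
    let ?m = "ult (\<lambda>c. of_nat (M c)) :: ('r, 'c) ultrapower"
    obtain D where D: "\<And>x y. D (x + y) = D x + D y" "\<And>x y. D (x * y) = D x * y + x * D y"
      "\<And>r. D (base r) = 0" "D ?m = 1"
      by (rule derivation_exists[of base ?m])
        (use base_hom False bounded_if_algebraic[of _ M] in \<open>blast+\<close>)
    interpret field_derivation D by unfold_locales (rule D)+
    let ?D = "?NF n"
    have D0: "?D \<noteq> 0" by (rule map_poly_base_nonzero) (rule N)
    have cN: "D (coeff (?NF i) j) = 0" for i j by (simp add: coeff_map_base D(3))
    have dN: "map_poly D (?NF i) = 0" for i by (rule poly_eqI) (simp add: coeff_map_poly cN)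
    have dG: "map_poly D (?G l l') = 0" for l l' by (rule map_poly_d_comp_mat) (rule dN)
    \<comment> \<open>The coefficients of \<open>?D\<close> and \<open>?G\<close> come from C[X] and
      are killed by \<open>D\<close>, those of \<open>vF\<close> need not be; \<open>v1\<close>
      measures this.\<close>
    define v1 where "v1 = map_poly D vF"
    have finite_res: "(fls_eval (fls_const p + fls_X) v1 / fls_eval (fls_const p + fls_X) ?D) $$ (-1) = 0"
      if p: "poly ?D p = 0" for p
    proof -
      obtain \<pi> where \<pi>: "p = ult \<pi>" by (rule ult_surj)
      \<comment> \<open>The limit of the Taylor expansions of \<open>S\<close> at p, a power series
        that need not be a polynomial.\<close>
      define Y where "Y = (\<lambda>I. fps_ult (\<lambda>c. taylor (\<pi> c) (S c I)))"
      have Y: "taylor p ?D * fps_deriv (Y I) + tact n (\<lambda>l l'. taylor p (?G l l')) Y I = taylor p vF * Y I"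
        if I: "I \<in> ?X" for I
      proof -
        have "almost_all (\<lambda>c. taylor (\<pi> c) (?N c n) * fps_deriv (taylor (\<pi> c) (S c I)) +
            tact n (\<lambda>l l'. taylor (\<pi> c) (comp_mat n (?N c) l l')) (\<lambda>I. taylor (\<pi> c) (S c I)) I =
            taylor (\<pi> c) (v c) * taylor (\<pi> c) (S c I))"
          using eq
        proof (rule eventually_mono)
          fix c assume "tensor_eq n (Suc k) (?N c) (v c) (S c)"
          then have "taylor (\<pi> c) (?N c n * pderiv (S c I) + tact n (comp_mat n (?N c)) (S c) I) =
              taylor (\<pi> c) (v c * S c I)" using I by (simp add: tensor_eq_def)
          then show "taylor (\<pi> c) (?N c n) * fps_deriv (taylor (\<pi> c) (S c I)) +
            tact n (\<lambda>l l'. taylor (\<pi> c) (comp_mat n (?N c) l l')) (\<lambda>I. taylor (\<pi> c) (S c I)) I =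
            taylor (\<pi> c) (v c) * taylor (\<pi> c) (S c I)"
            by (simp add: taylor_add taylor_mult taylor_pderiv tact_hom[of "taylor (\<pi> c)"])
        qed
        from fps_ult_cong[OF this]
        have "taylor p ?D * fps_deriv (Y I) +
            tact n (\<lambda>l l'. fps_ult (\<lambda>c. taylor (\<pi> c) (comp_mat n (?N c) l l'))) Y I = taylor p vF * Y I"
          unfolding fps_ult_add fps_ult_mult fps_ult_deriv fps_ult_tact fps_ult_taylor[OF poly_lim_base]
            fps_ult_taylor[OF vF(1)] \<pi>[symmetric] Y_def .
        also have "tact n (\<lambda>l l'. fps_ult (\<lambda>c. taylor (\<pi> c) (comp_mat n (?N c) l l'))) Y I =
            tact n (\<lambda>l l'. taylor p (?G l l')) Y I"
          by (rule tact_cong[OF I]) (simp_all add: fps_ult_taylor[OF limG] \<pi>)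
        finally show ?thesis .
      qed
      \<comment> \<open>Absence of common zeros, used at the points \<pi> c that represent p, gives
        a coordinate whose expansion has a nonzero constant term.\<close>
      obtain I0 where I0: "I0 \<in> ?X" "Y I0 \<noteq> 0"
      proof -
        have "almost_all (\<lambda>c. \<exists>I\<in>?X. poly (S c I) (\<pi> c) \<noteq> 0)" using prim by (rule eventually_mono) blast
        from ultrafilter_bex[OF bad_ultrafilter(1) finite_idx this]
        obtain I where I: "I \<in> ?X" "almost_all (\<lambda>c. poly (S c I) (\<pi> c) \<noteq> 0)" by blast
        have "Y I $ 0 \<noteq> 0" using ult_nonzero[OF I(2)] by (simp add: Y_def taylor_nth_0)
        then have "Y I \<noteq> 0" by auto
        with I(1) show ?thesis by (rule that)
      qed
      let ?\<xi> = "fls_const p + fls_X" and ?Y = "\<lambda>I. fps_to_fls (Y I)"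
      \<comment> \<open>A root of \<open>?D\<close> is algebraic over constants of \<open>D\<close>,
        hence constant; so \<open>D\<close> acts on expansions at p through the coefficients of the
        polynomial.\<close>
      have Dp: "D p = 0" by (rule d_root[OF cN D0 p])
      have \<xi>: "fls_map D ?\<xi> = 0" by (rule fls_eqI) (simp add: Dp fls_X_def)
      have E0: "fls_eval ?\<xi> ?D \<noteq> 0" by (rule fls_eval_shift_nonzero[OF D0])
      let ?\<alpha> = "\<lambda>l l'. inverse (fls_eval ?\<xi> ?D) * fls_eval ?\<xi> (?G l l')"
      have dD: "fls_map D (fls_eval ?\<xi> ?D) = 0" by (simp only: dfls_eval[OF \<xi>] dN fls_eval_simps)
      have "D ((fls_eval ?\<xi> vF / fls_eval ?\<xi> ?D) $$ (-1)) = 0"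
      proof (rule residue_tensor[of ?\<alpha> n "Suc k" ?Y _ I0])
        fix l l'
        have "fls_map D (fls_eval ?\<xi> (?G l l') / fls_eval ?\<xi> ?D) = 0"
          unfolding dfls_divide[OF dD] dfls_eval[OF \<xi>] dG by simp
        then show "fls_map D (?\<alpha> l l') = 0" by (simp add: divide_inverse mult.commute)
      next
        fix I assume I: "I \<in> ?X"
        have "fps_to_fls (taylor p ?D * fps_deriv (Y I) + tact n (\<lambda>l l'. taylor p (?G l l')) Y I) = fps_to_fls (taylor p vF * Y I)"
          using Y[OF I] by simp
        then have "fls_eval ?\<xi> ?D * fls_deriv (?Y I) + tact n (\<lambda>l l'. fls_eval ?\<xi> (?G l l')) ?Y I = fls_eval ?\<xi> vF * ?Y I"
          by (simp add: fls_times_fps_to_fls taylor_fls fls_deriv_fps_to_fls tact_hom[of fps_to_fls])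
        then show "fls_deriv (?Y I) + tact n ?\<alpha> ?Y I = fls_eval ?\<xi> vF / fls_eval ?\<xi> ?D * ?Y I"
          unfolding tact_smult_left by (rule divide_equation[OF E0])
      qed (use I0 in auto)
      then have "fls_map D (fls_eval ?\<xi> vF / fls_eval ?\<xi> ?D) $$ (-1) = 0" by simp
      then show ?thesis unfolding dfls_divide[OF dD] dfls_eval[OF \<xi>] v1_def .
    qed
    let ?T = "fls_X_inv :: ('r, 'c) ultrapower fls"
    let ?e = "fls_eval ?T"
    have XT: "fls_X * ?T = 1" by (simp flip: fls_inverse_X)
    have dT: "fls_deriv ?T = - ?T * ?T"
      by (rule fls_eqI) (auto simp: fls_X_inv_times_conv_shift)
    \<comment> \<open>The finite residues of v1/D vanish, hence so does the residue at
      infinity.\<close>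
    have res_inf: "(fls_deriv ?T * (?e v1 / ?e ?D)) $$ (-1) = 0"
    proof (rule residue_theorem[OF fls_eval_X_inv_nonzero _ D0 finite_res])
      fix q
      have "fls_deriv ?T * ?e q = - (?T * (?T * ?e q))" unfolding dT by (simp add: mult.assoc)
      then show "(fls_deriv ?T * ?e q) $$ (-1) = 0"
        by (simp add: fls_X_inv_times_conv_shift fls_eval_X_inv_nth)
    qed
    \<comment> \<open>Each \<open>S c\<close> is multiplied by its own power t^(M c), so that its
      entries become power series in t. In the limit the exponent survives only as the coefficient
      \<open>?m\<close>.\<close>
    define Y where "Y = (\<lambda>I. fps_ult (\<lambda>c. rev_fps (M c) (S c I)))"
    have Y: "rev_fps d ?D * (fps_const ?m * fps_X * Y I - fps_X ^ 2 * fps_deriv (Y I)) +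
        tact n (\<lambda>l l'. rev_fps d (?G l l')) Y I = rev_fps d vF * Y I" if I: "I \<in> ?X" for I
    proof -
      have "almost_all (\<lambda>c. rev_fps d (?N c n) * (fps_const (of_nat (M c)) * fps_X * rev_fps (M c) (S c I) -
          fps_X ^ 2 * fps_deriv (rev_fps (M c) (S c I))) +
          tact n (\<lambda>l l'. rev_fps d (comp_mat n (?N c) l l')) (\<lambda>I. rev_fps (M c) (S c I)) I =
          rev_fps d (v c) * rev_fps (M c) (S c I))"
        using eventually_conj[OF eq eventually_conj[OF degN degv]]
        by (rule eventually_mono, elim conjE) (rule tensor_eq_at_infinity[OF _ _ _ M I], auto)
      from fps_ult_cong[OF this]
      have "rev_fps d ?D * (fps_const ?m * fps_X * Y I - fps_X ^ 2 * fps_deriv (Y I)) +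
          tact n (\<lambda>l l'. fps_ult (\<lambda>c. rev_fps d (comp_mat n (?N c) l l'))) Y I = rev_fps d vF * Y I"
        unfolding fps_ult_add fps_ult_mult fps_ult_diff fps_ult_deriv fps_ult_tact fps_ult_const fps_ult_X
          fps_ult_power fps_ult_rev_fps[OF poly_lim_base] fps_ult_rev_fps[OF vF(1)] Y_def .
      also have "tact n (\<lambda>l l'. fps_ult (\<lambda>c. rev_fps d (comp_mat n (?N c) l l'))) Y I =
          tact n (\<lambda>l l'. rev_fps d (?G l l')) Y I"
        by (rule tact_cong[OF I]) (simp_all add: fps_ult_rev_fps[OF limG])
      finally show ?thesis .
    qed
    \<comment> \<open>The maximal degree \<open>M c\<close> is attained by some entry; its leading
      coefficient is the constant term of the reversed expansion.\<close>
    obtain I0 where I0: "I0 \<in> ?X" "Y I0 \<noteq> 0"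
    proof -
      have "almost_all (\<lambda>c. \<exists>I\<in>?X. coeff (S c I) (M c) \<noteq> 0)" using prim
      proof (rule eventually_mono)
        fix c assume "\<forall>x. \<exists>I\<in>?X. poly (S c I) x \<noteq> 0"
        then obtain I2 where I2: "I2 \<in> ?X" "poly (S c I2) 0 \<noteq> 0" by blast
        have "M c \<in> (\<lambda>I. degree (S c I)) ` ?X" unfolding M_def using I2 by (intro Max_in) auto
        then obtain I1 where I1: "I1 \<in> ?X" "degree (S c I1) = M c" by auto
        show "\<exists>I\<in>?X. coeff (S c I) (M c) \<noteq> 0"
        proof (cases "S c I1 = 0")
          case True
          then have "M c = 0" using I1 by simp
          then have "degree (S c I2) = M c" using M[OF I2(1), of c] by simp
          moreover have "S c I2 \<noteq> 0" using I2 by auto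
          ultimately have "coeff (S c I2) (M c) \<noteq> 0" by (metis leading_coeff_0_iff)
          with I2 show ?thesis by blast
        next
          case False
          then have "coeff (S c I1) (M c) \<noteq> 0" using I1 by (metis leading_coeff_0_iff)
          with I1 show ?thesis by blast
        qed
      qed
      from ultrafilter_bex[OF bad_ultrafilter(1) finite_idx this]
      obtain I where I: "I \<in> ?X" "almost_all (\<lambda>c. coeff (S c I) (M c) \<noteq> 0)" by blast
      have "Y I $ 0 \<noteq> 0" using ult_nonzero[OF I(2)] by (simp add: Y_def rev_fps_def)
      then have "Y I \<noteq> 0" by auto
      with I(1) show ?thesis by (rule that)
    qed
    let ?Y = "\<lambda>I. fps_to_fls (Y I)"
    have \<xi>: "fls_map D ?T = 0" by (rule fls_eqI) simp
    have E0: "?e ?D \<noteq> 0" by (rule fls_eval_X_inv_nonzero[OF D0])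
    have dD: "fls_map D (?e ?D) = 0" by (simp only: dfls_eval[OF \<xi>] dN fls_eval_simps)
    \<comment> \<open>The factor -1/(t^2 D) that makes the coefficient of Y' equal to 1, in
      accordance with d/dx = -t^2 d/dt.\<close>
    let ?w = "- (?T * ?T) * inverse (?e ?D)"
    have dw: "fls_map D (?w * f) = - (?T * ?T) * (fls_map D f / ?e ?D)" for f
    proof -
      have "?w * f = - (?T * ?T) * (f / ?e ?D)" by (simp add: divide_inverse)
      moreover have "fls_map D (- (?T * ?T)) = 0"
        using dfls_diff[of 0 "?T * ?T"] by (simp add: dfls_mult \<xi>)
      ultimately show ?thesis by (simp only: dfls_mult dfls_divide[OF dD] mult_zero_left add_0_left)
    qed
    \<comment> \<open>The logarithmic derivative m/t of t^m adds \<open>?m\<close> to the residue of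
      what comes from \<open>vF\<close>.\<close>
    let ?u = "fls_const ?m * ?T + ?w * ?e vF"
    have "D (?u $$ (-1)) = 0"
    proof (rule residue_tensor[of "\<lambda>l l'. ?w * ?e (?G l l')" n "Suc k" ?Y _ I0])
      fix l l'
      show "fls_map D (?w * ?e (?G l l')) = 0" unfolding dw dfls_eval[OF \<xi>] dG by simp
    next
      fix I assume I: "I \<in> ?X"
      have "fps_to_fls (rev_fps d ?D * (fps_const ?m * fps_X * Y I - fps_X ^ 2 * fps_deriv (Y I)) +
        tact n (\<lambda>l l'. rev_fps d (?G l l')) Y I) = fps_to_fls (rev_fps d vF * Y I)" using Y[OF I] by simp
      then have "fls_X ^ d * ?e ?D * (fls_const ?m * fls_X * ?Y I - fls_X ^ 2 * fls_deriv (?Y I)) +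
        tact n (\<lambda>l l'. fps_to_fls (rev_fps d (?G l l'))) ?Y I = fls_X ^ d * ?e vF * ?Y I"
        using degNF[of n] vF(2)
        by (simp add: fls_times_fps_to_fls fps_to_fls_power fls_deriv_fps_to_fls rev_fps_fls tact_hom[of fps_to_fls])
      also have "tact n (\<lambda>l l'. fps_to_fls (rev_fps d (?G l l'))) ?Y I = fls_X ^ d * tact n (\<lambda>l l'. ?e (?G l l')) ?Y I"
        unfolding tact_smult_left[symmetric] using degG by (intro tact_cong[OF I]) (simp_all add: rev_fps_fls)
      finally have "fls_X ^ d * (?e ?D * (fls_const ?m * fls_X * ?Y I - fls_X ^ 2 * fls_deriv (?Y I)) +
        tact n (\<lambda>l l'. ?e (?G l l')) ?Y I) = fls_X ^ d * (?e vF * ?Y I)"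
        by (simp add: algebra_simps)
      then have *: "?e ?D * (fls_const ?m * fls_X * ?Y I - fls_X ^ 2 * fls_deriv (?Y I)) +
        tact n (\<lambda>l l'. ?e (?G l l')) ?Y I = ?e vF * ?Y I" by simp
      have T2: "?T * ?T * fls_X ^ 2 = 1" "?T * ?T * fls_X = ?T"
        using XT by (simp_all add: power2_eq_square mult_ac)
      have "?w * (?e ?D * (fls_const ?m * fls_X * ?Y I - fls_X ^ 2 * fls_deriv (?Y I))) =
         (inverse (?e ?D) * ?e ?D) * (?T * ?T * fls_X ^ 2 * fls_deriv (?Y I) - fls_const ?m * (?T * ?T * fls_X) * ?Y I)"
        by (simp add: algebra_simps)
      also have "\<dots> = fls_deriv (?Y I) - fls_const ?m * ?T * ?Y I" unfolding T2 using E0 by simp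
      finally have "fls_deriv (?Y I) - fls_const ?m * ?T * ?Y I + ?w * tact n (\<lambda>l l'. ?e (?G l l')) ?Y I = ?w * (?e vF * ?Y I)"
        unfolding *[symmetric] distrib_left by simp
      then show "fls_deriv (?Y I) + tact n (\<lambda>l l'. ?w * ?e (?G l l')) ?Y I = ?u * ?Y I"
        unfolding tact_smult_left by (simp add: algebra_simps)
    qed (use I0 in auto)
    then have *: "fls_map D ?u $$ (-1) = 0" by (simp only: dfls_nth)
    have "fls_map D (fls_const ?m) = fls_const (D ?m)" by (rule fls_eqI) auto
    then have **: "fls_map D ?u = fls_const (D ?m) * ?T + fls_deriv ?T * (?e v1 / ?e ?D)"
      unfolding dfls_add dw dfls_mult[of "fls_const ?m"] \<xi> dfls_eval[OF \<xi>] v1_def dT by simp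
    \<comment> \<open>The residue of D(u) is D(m) = 1 plus that of v1/D at infinity, which is 0; but
      \<open>residue_tensor\<close> makes it vanish.\<close>
    have "(fls_const (D ?m) * ?T + fls_deriv ?T * (?e v1 / ?e ?D)) $$ (-1) = 1"
      unfolding fls_plus_nth res_inf by (simp add: D(4))
    with * ** have "(1 :: ('r, 'c) ultrapower) = 0" by (simp only:)
    then show ?thesis by simp
  qed
qed

end

text \<open>\<open>N\<close> is formed in C[X][x], before any homomorphism is applied, by
  multiplying each numerator with all the other denominators. So one \<open>N\<close> serves the
  generic point and all specializations.\<close>

lemma clear_denominators:
  fixes h :: "'r::idom \<Rightarrow> 'k::field" and num den :: "nat \<Rightarrow> 'r poly" and n :: nat
  defines "N \<equiv> \<lambda>i. num i * (\<Prod>j\<in>{..n} - {i}. den j)"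
  assumes h: "unital_ring_hom h" and den: "\<And>i. i \<le> n \<Longrightarrow> map_poly h (den i) \<noteq> 0"
  obtains r where "r \<noteq> 0"
    "(\<Sum>i\<le>n. monom (Fract (map_poly h (num i)) (map_poly h (den i))) i) = smult r (op_of n (\<lambda>i. map_poly h (N i)))"
proof
  have hom: "hom_on UNIV h" by (rule unital_ring_hom_hom_on[OF h])
  have mult: "map_poly h (p * q) = map_poly h p * map_poly h q" for p q
    by (rule map_poly_hom_mult[OF hom]) auto
  have prod: "map_poly h (\<Prod>j\<in>A. f j) = (\<Prod>j\<in>A. map_poly h (f j))" for A and f :: "nat \<Rightarrow> 'r poly"
    by (induction A rule: infinite_finite_induct) (simp_all add: mult map_poly_hom_1[OF hom])
  let ?P = "\<Prod>j\<in>{..n}. map_poly h (den j)"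
  have P0: "?P \<noteq> 0" using den by (simp add: prod_zero_iff)
  show "inverse (to_fract ?P) \<noteq> 0" using P0 by simp
  show "(\<Sum>i\<le>n. monom (Fract (map_poly h (num i)) (map_poly h (den i))) i) =
    smult (inverse (to_fract ?P)) (op_of n (\<lambda>i. map_poly h (N i)))"
  proof (rule poly_eqI)
    fix i
    show "coeff (\<Sum>i\<le>n. monom (Fract (map_poly h (num i)) (map_poly h (den i))) i) i =
      coeff (smult (inverse (to_fract ?P)) (op_of n (\<lambda>i. map_poly h (N i)))) i"
    proof (cases "i \<le> n")
      case True
      have P: "?P = map_poly h (den i) * (\<Prod>j\<in>{..n} - {i}. map_poly h (den j))"
        by (rule prod.remove) (use True in auto)
      have "(\<Prod>j\<in>{..n} - {i}. map_poly h (den j)) \<noteq> 0" using P P0 by auto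
      then have "Fract (map_poly h (num i)) (map_poly h (den i)) = inverse (to_fract ?P) * to_fract (map_poly h (N i))"
        unfolding N_def mult prod P using den[OF True]
        by (simp add: Fract_conv_to_fract field_simps)
      then show ?thesis using True by (simp add: coeff_sum coeff_op_of)
    qed (simp add: coeff_sum coeff_op_of)
  qed
qed

text \<open>Denominators and leading coefficient involve finitely many nonzero polynomials, so that
  specialization is defined almost everywhere and failure there means reducibility. By
  \<open>reducible_generic\<close> the operator is then reducible over the closure of C(X), against
  the hypothesis.\<close>

lemma no_counterexample: "\<not> counterexample (bad_ultrafilter :: ('r::idom \<Rightarrow> 'c::{alg_closed_field, field_char_0}) filter)"
proof
  assume "counterexample (bad_ultrafilter :: ('r \<Rightarrow> 'c) filter)"
  then obtain \<iota> :: "'c \<Rightarrow> 'r" and n a num den where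
    a: "a n \<noteq> 0" and den: "\<And>i. i \<le> n \<Longrightarrow> den i \<noteq> 0"
    and quot: "\<And>i. i \<le> n \<Longrightarrow> a i = Fract (fract_poly (num i)) (fract_poly (den i))"
    and irr: "irreducible_op (op_to_ac (\<Sum>i\<le>n. rat_op (a i) * delta ^ i))"
    and ad: "\<And>V. ad_open \<iota> V \<Longrightarrow> almost_all (\<lambda>c. c \<in> V)"
    and bad: "almost_all (\<lambda>c::'r \<Rightarrow> 'c. \<not> (specialization_defined c n num den \<and> irreducible_op (specialized_op c n num den)))"
    unfolding counterexample_def by blast
  have basic: "almost_all (\<lambda>c. c \<in> points \<iota> \<and> inj_on c (group_closure S))" if "finite S" for S
  proof -
    have "ad_open \<iota> {c \<in> points \<iota>. inj_on c (group_closure S)}"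
      unfolding ad_open_def basic_ad_open_def
      by (rule exI[of _ "{{c \<in> points \<iota>. inj_on c (group_closure S)}}"]) (use that in auto)
    from ad[OF this] show ?thesis by simp
  qed
  have hom: "almost_all (\<lambda>c::'r \<Rightarrow> 'c. unital_ring_hom c)"
    using basic[of "{}"] by (auto simp: points_def elim: eventually_mono)
  have sep: "almost_all (\<lambda>c::'r \<Rightarrow> 'c. inj_on c (group_closure S))" if "finite S" for S
    using basic[OF that] by (auto elim: eventually_mono)
  define \<kappa> :: "'r \<Rightarrow> 'r fract alg_closure" where "\<kappa> = (\<lambda>r. to_ac (to_fract r))"
  define N where "N = (\<lambda>i. num i * (\<Prod>j\<in>{..n} - {i}. den j))"
  have \<kappa>: "unital_ring_hom \<kappa>" by (simp add: unital_ring_hom_def \<kappa>_def)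
  have \<kappa>0: "\<kappa> x = 0 \<longleftrightarrow> x = 0" for x by (simp add: \<kappa>_def)
  have \<kappa>_poly: "map_poly \<kappa> p \<noteq> 0" if "p \<noteq> 0" for p
    using that by (auto simp: poly_eq_iff coeff_map_poly \<kappa>0)
  have "num n \<noteq> 0"
  proof
    assume "num n = 0"
    then have "a n = 0" using quot[of n] by (simp add: Fract_conv_to_fract)
    with a show False ..
  qed
  then have Nn: "N n \<noteq> 0" using den by (auto simp: N_def prod_zero_iff)
  obtain r where r: "r \<noteq> 0" "(\<Sum>i\<le>n. monom (Fract (map_poly \<kappa> (num i)) (map_poly \<kappa> (den i))) i) =
      smult r (op_of n (\<lambda>i. map_poly \<kappa> (N i)))"
    unfolding N_def by (rule clear_denominators[OF \<kappa>, of n den num]) (use \<kappa>_poly[OF den] in auto)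
  have "op_poly (op_to_ac (\<Sum>i\<le>n. rat_op (a i) * delta ^ i)) = map_poly rat_to_ac (\<Sum>i\<le>n. monom (a i) i)"
    by (simp add: op_to_ac_def op_poly_normal_form Diffop_inverse)
  also have "\<dots> = (\<Sum>i\<le>n. monom (Fract (map_poly \<kappa> (num i)) (map_poly \<kappa> (den i))) i)"
  proof (rule poly_eqI)
    fix i
    have 0: "rat_to_ac (0 :: 'r fract poly fract) = 0"
      by (simp add: fract_expand(1) rat_to_ac_Fract)
    have k: "map_poly to_ac (fract_poly p) = map_poly \<kappa> p" for p :: "'r poly"
      by (rule poly_eqI) (simp add: coeff_map_poly \<kappa>_def)
    have "rat_to_ac (a i) = Fract (map_poly \<kappa> (num i)) (map_poly \<kappa> (den i))" if "i \<le> n"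
      using quot[OF that] den[OF that] by (simp add: rat_to_ac_Fract k)
    then show "coeff (map_poly rat_to_ac (\<Sum>i\<le>n. monom (a i) i)) i =
        coeff (\<Sum>i\<le>n. monom (Fract (map_poly \<kappa> (num i)) (map_poly \<kappa> (den i))) i) i"
      by (simp add: coeff_map_poly 0 coeff_sum)
  qed
  finally have "op_poly (op_to_ac (\<Sum>i\<le>n. rat_op (a i) * delta ^ i)) = smult r (op_of n (\<lambda>i. map_poly \<kappa> (N i)))"
    unfolding r(2) .
  with irr have irr': "n > 0" "\<not> reducible_skew (op_of n (\<lambda>i. map_poly \<kappa> (N i)))"
    using r(1) degree_op_of[of "\<lambda>i. map_poly \<kappa> (N i)" n] \<kappa>_poly[OF Nn]
    by (simp_all add: irreducible_op_iff reducible_skew_smult)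
  have nz: "almost_all (\<lambda>c::'r \<Rightarrow> 'c. map_poly c p \<noteq> 0)" if "p \<noteq> 0" for p
    by (rule almost_all_map_poly_nonzero[OF hom]) (use sep that in auto)
  have "almost_all (\<lambda>c::'r \<Rightarrow> 'c. \<forall>i\<in>{..n}. map_poly c (den i) \<noteq> 0)"
    by (intro eventually_ball_finite ballI nz) (use den in auto)
  with bad hom nz[OF \<open>num n \<noteq> 0\<close>] nz[OF Nn]
  have "almost_all (\<lambda>c::'r \<Rightarrow> 'c. reducible_skew (op_of n (\<lambda>i. map_poly c (N i))))"
  proof eventually_elim
    case (elim c)
    have d: "map_poly c (den i) \<noteq> 0" if "i \<le> n" for i using elim that by auto
    have "specialization_defined c n num den"
      using d elim by (auto simp: specialization_defined_def specialized_coeff_def Fract_conv_to_fract)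
    with elim have irr: "\<not> irreducible_op (specialized_op c n num den)" by simp
    obtain r where r: "r \<noteq> 0" "(\<Sum>i\<le>n. monom (Fract (map_poly c (num i)) (map_poly c (den i))) i) =
        smult r (op_of n (\<lambda>i. map_poly c (N i)))"
      unfolding N_def by (rule clear_denominators[OF \<open>unital_ring_hom c\<close>, of n den num]) (use d in auto)
    have "op_poly (specialized_op c n num den) = smult r (op_of n (\<lambda>i. map_poly c (N i)))"
      unfolding specialized_op_def op_poly_normal_form r(2)[symmetric] specialized_coeff_def ..
    with irr show ?case
      using r(1) irr'(1) degree_op_of[of "\<lambda>i. map_poly c (N i)" n] elim
      by (simp add: irreducible_op_iff reducible_skew_smult)
  qed
  then have "reducible_skew (op_of n (\<lambda>i. map_poly \<kappa> (N i)))"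
    by (rule reducible_generic[where N=N, OF hom _ Nn _ \<kappa> \<kappa>_poly[OF Nn], rotated]) (rule sep)
  with irr'(2) show False ..
qed

text \<open>Makes the ad-open sets a filter base.\<close>

lemma ad_open_Int: "ad_open \<iota> V \<Longrightarrow> ad_open \<iota> W \<Longrightarrow> ad_open \<iota> (V \<inter> W)"
proof -
  assume "ad_open \<iota> V" "ad_open \<iota> W"
  then obtain \<B> \<C> where "finite \<B>" "\<forall>B\<in>\<B>. basic_ad_open \<iota> B" "V = points \<iota> \<inter> \<Inter>\<B>"
    "finite \<C>" "\<forall>B\<in>\<C>. basic_ad_open \<iota> B" "W = points \<iota> \<inter> \<Inter>\<C>"
    by (auto simp: ad_open_def)
  then show ?thesis unfolding ad_open_def by (intro exI[of _ "\<B> \<union> \<C>"]) auto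
qed

theorem theorem1p1:
  fixes \<iota> :: "'c::{alg_closed_field, field_char_0} \<Rightarrow> 'r::idom"
    and n :: nat
    and a :: "nat \<Rightarrow> 'r fract poly fract"
    and num den :: "nat \<Rightarrow> 'r poly"
    and L :: "'r fract diffop"
  assumes "irreducible_affine_variety \<iota>"
    and "L = (\<Sum>i\<le>n. rat_op (a i) * delta ^ i)"
    and "a n \<noteq> 0"
    and "\<And>i. i \<le> n \<Longrightarrow> den i \<noteq> 0"
    and "\<And>i. i \<le> n \<Longrightarrow> a i = Fract (fract_poly (num i)) (fract_poly (den i))"
    and "irreducible_op (op_to_ac L)"
  shows "\<exists>U. ad_open \<iota> U \<and>
    (\<forall>c\<in>U. specialization_defined c n num den \<and> irreducible_op (specialized_op c n num den))"
proof (rule ccontr)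
  assume neg: "\<not> ?thesis"
  define bad where "bad = {c :: 'r \<Rightarrow> 'c. \<not> (specialization_defined c n num den \<and> irreducible_op (specialized_op c n num den))}"
  \<comment> \<open>Generated by the traces of the ad-open sets on the bad points; it is proper
    because every ad-open set contains a bad point if the theorem fails.\<close>
  define F where "F = (INF V\<in>{V. ad_open \<iota> V}. principal (V \<inter> bad))"
  have "ad_open \<iota> (points \<iota>)" unfolding ad_open_def by (rule exI[of _ "{}"]) simp
  have F: "eventually P F \<longleftrightarrow> (\<exists>V. ad_open \<iota> V \<and> (\<forall>c\<in>V \<inter> bad. P c))" for P
  proof -
    let ?A = "{V. ad_open \<iota> V}"
    have "\<exists>V'\<in>?A. principal (V' \<inter> bad) \<le> inf (principal (V \<inter> bad)) (principal (W \<inter> bad))"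
      if "V \<in> ?A" "W \<in> ?A" for V W
      using that by (intro bexI[of _ "V \<inter> W"]) (auto simp: ad_open_Int)
    moreover have "?A \<noteq> {}" using \<open>ad_open \<iota> (points \<iota>)\<close> by auto
    ultimately show ?thesis unfolding F_def
      by (subst eventually_INF_base) (auto simp: eventually_principal)
  qed
  have "F \<noteq> bot"
    unfolding trivial_limit_def F using neg by (auto simp: bad_def)
  then obtain U where U: "U \<le> F" "ultrafilter U" by (rule ultrafilter_exists)
  have "eventually (\<lambda>c. c \<in> V) U" if "ad_open \<iota> V" for V
    by (rule filter_leD[OF U(1)]) (use that in \<open>auto simp: F\<close>)
  moreover have "eventually (\<lambda>c. \<not> (specialization_defined c n num den \<and> irreducible_op (specialized_op c n num den))) U"
    by (rule filter_leD[OF U(1)]) (use \<open>ad_open \<iota> (points \<iota>)\<close> in \<open>auto simp: F bad_def\<close>)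
  ultimately have "counterexample U"
    unfolding counterexample_def using assms
    by (intro exI[of _ \<iota>] exI[of _ n] exI[of _ a] exI[of _ num] exI[of _ den]) auto
  \<comment> \<open>A counterexample turns the fixed \<open>bad_ultrafilter\<close> into one as
    well, possibly for other data on the same types, and this has been excluded.\<close>
  from bad_ultrafilter(2)[OF U(2) this] no_counterexample show False by blast
qed

end
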